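(* There is an algorithm that, given a monotone and ordered permutation $\tilde\gamma=\zeta_1\circ\dots\circ\zeta_m\in\mathcal S_n$ with $\mathrm{supp}(\tilde\gamma)=[n]$ and cycle supports $N_1,\dots,N_m$, a group $\Gamma\le\langle\tilde\gamma\rangle$, and disjoint sets $I_0,I_1\subseteq[n]$, decides whether $\mathcal X_\Gamma\cap F(I_0,I_1)=\emptyset$, and, if this set is non-empty, computes the complete set of fixings of $\mathcal X_\Gamma\cap F(I_0,I_1)$, i.e. the sets $J_b=\{i\in[n] : x_i=b\text{ for all }x\in\mathcal X_\Gamma\cap F(I_0,I_1)\}$ for $b\in\{0,1\}$, in $O\bigl(n^2\max\{|N_c| : c\in[m]\}\bigr)\subseteq O(n^3)$ time. Moreover, deciding only whether $\mathcal X_\Gamma\cap F(I_0,I_1)=\emptyset$ is possible in $O\bigl(n\max\{|N_c| : c\in[m]\}\bigr)\subseteq O(n^2)$ time.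
   Context: $[n]=\{1,\dots,n\}$; $\mathcal S_n$ is the symmetric group on $[n]$. A permutation $\gamma$ acts on $x\in\mathbb R^n$ by $\gamma(x)=(x_{\gamma^{-1}(1)},\dots,x_{\gamma^{-1}(n)})$. $x\succeq y$ means that $x$ is lexicographically not smaller than $y$. $\mathcal X_\gamma=\{x\in\{0,1\}^n : x\succeq\gamma(x)\}$, $\mathcal X_\Gamma=\bigcap_{\gamma\in\Gamma}\mathcal X_\gamma$. $F(I_0,I_1)=\{x\in\{0,1\}^n : x_i=0 \text{ for } i\in I_0,\ x_i=1\text{ for } i\in I_1\}$. Monotone and ordered: $\zeta_1,\dots,\zeta_m$ are the disjoint (nontrivial) cycles of $\tilde\gamma$, with supports $N_c=\{k:\zeta_c(k)\ne k\}$, so that $[n]=N_1\,\dot\cup\cdots\dot\cup\,N_m$. Each $\zeta_c$ is monotone, i.e. there is exactly one $k$ with $\zeta_c(k)<k$; and they are ordered, i.e. for $c<c'$ all elements of $N_c$ are smaller than all elements of $N_{c'}$. The subgroup $\Gamma$ of the cyclic group $\langle\tilde\gamma\rangle$ may have superpolynomial order; it is represented by a generator (a power of $\tilde\gamma$). Time is counted in elementary operations. *)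

theory Defs
  imports "HOL-Algebra.Sym_Groups" "HOL-Library.Fun_Lexorder" Complex_Main
begin

section \<open>Symmetries of binary vectors\<close>

text \<open>A vector of length \<open>n\<close> is an extensional function on \<open>{1..n}\<close>. All such vectors
  agree outside \<open>{1..n}\<close>, so \<^const>\<open>less_fun\<close> is the strict lexicographic order on them.\<close>

definition binary_vectors :: "nat \<Rightarrow> (nat \<Rightarrow> real) set" where
  "binary_vectors n = {1..n} \<rightarrow>\<^sub>E {0, 1}"

definition perm_act :: "nat \<Rightarrow> (nat \<Rightarrow> nat) \<Rightarrow> (nat \<Rightarrow> real) \<Rightarrow> nat \<Rightarrow> real" where
  "perm_act n \<gamma> x = (\<lambda>i\<in>{1..n}. x (inv' \<gamma> i))"

definition lex_ge :: "(nat \<Rightarrow> real) \<Rightarrow> (nat \<Rightarrow> real) \<Rightarrow> bool" (infix "\<succeq>" 50) where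
  "x \<succeq> y \<longleftrightarrow> \<not> less_fun x y"

definition X_perm :: "nat \<Rightarrow> (nat \<Rightarrow> nat) \<Rightarrow> (nat \<Rightarrow> real) set" where
  "X_perm n \<gamma> = {x \<in> binary_vectors n. x \<succeq> perm_act n \<gamma> x}"

definition X_group :: "nat \<Rightarrow> (nat \<Rightarrow> nat) set \<Rightarrow> (nat \<Rightarrow> real) set" where
  "X_group n \<Gamma> = (\<Inter>\<gamma>\<in>\<Gamma>. X_perm n \<gamma>)"

definition fixing_face :: "nat \<Rightarrow> nat set \<Rightarrow> nat set \<Rightarrow> (nat \<Rightarrow> real) set" where
  "fixing_face n I0 I1 = {x \<in> binary_vectors n. (\<forall>i\<in>I0. x i = 0) \<and> (\<forall>i\<in>I1. x i = 1)}"

definition complete_fixings :: "nat \<Rightarrow> (nat \<Rightarrow> real) set \<Rightarrow> real \<Rightarrow> nat set" where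
  "complete_fixings n X b = {i \<in> {1..n}. \<forall>x\<in>X. x i = b}"


section \<open>Monotone and ordered permutations\<close>

definition supp :: "(nat \<Rightarrow> nat) \<Rightarrow> nat set" where
  "supp \<zeta> = {k. \<zeta> k \<noteq> k}"

definition nontrivial_cycle :: "(nat \<Rightarrow> nat) \<Rightarrow> bool" where
  "nontrivial_cycle \<zeta> \<longleftrightarrow> (\<exists>cs. cycle cs \<and> 2 \<le> length cs \<and> \<zeta> = cycle_of_list cs)"

definition disjoint_cycle_factors :: "(nat \<Rightarrow> nat) list \<Rightarrow> (nat \<Rightarrow> nat) \<Rightarrow> bool" where
  "disjoint_cycle_factors \<zeta>s \<gamma> \<longleftrightarrow>
     \<gamma> = foldr (\<circ>) \<zeta>s id \<and>
     (\<forall>\<zeta>\<in>set \<zeta>s. nontrivial_cycle \<zeta>) \<and>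
     (\<forall>c<length \<zeta>s. \<forall>c'<length \<zeta>s. c \<noteq> c' \<longrightarrow> supp (\<zeta>s ! c) \<inter> supp (\<zeta>s ! c') = {})"

definition monotone_cycle :: "(nat \<Rightarrow> nat) \<Rightarrow> bool" where
  "monotone_cycle \<zeta> \<longleftrightarrow> (\<exists>!k. \<zeta> k < k)"

definition ordered_cycles :: "(nat \<Rightarrow> nat) list \<Rightarrow> bool" where
  "ordered_cycles \<zeta>s \<longleftrightarrow>
     (\<forall>c c'. c < c' \<and> c' < length \<zeta>s \<longrightarrow> (\<forall>a\<in>supp (\<zeta>s ! c). \<forall>b\<in>supp (\<zeta>s ! c'). a < b))"

definition max_cycle_size :: "(nat \<Rightarrow> nat) list \<Rightarrow> nat" where
  "max_cycle_size \<zeta>s = Max ((\<lambda>\<zeta>. card (supp \<zeta>)) ` set \<zeta>s)"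


section \<open>Algorithms and elementary operations\<close>

text \<open>Algorithms are programs for a word RAM with finitely many named registers and arrays of
  natural numbers. A run exists only if every number it touches, including addresses, constants
  and intermediate results, is at most the word bound \<open>W\<close>; there is no rule for overflow.
  Taking \<open>W\<close> polynomial in \<open>n\<close> (words of \<open>O(log n)\<close> bits) is what makes it legitimate to charge
  one unit per arithmetic operation, comparison or memory access.\<close>

type_synonym vname = string

record state =
  reg :: "vname \<Rightarrow> nat"
  arr :: "vname \<Rightarrow> nat \<Rightarrow> nat"

datatype binop = Add | Sub | Mul | IDiv | IMod

datatype aexp = N nat | V vname | Cell vname aexp | Bin binop aexp aexp

datatype bexp = Less aexp aexp | Eq aexp aexp | BNot bexp | BAnd bexp bexp

datatype com =
    Skip
  | Assign vname aexp
  | Store vname aexp aexp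
  | Seq com com
  | If bexp com com
  | While bexp com

fun binop_val :: "binop \<Rightarrow> nat \<Rightarrow> nat \<Rightarrow> nat" where
  "binop_val Add a b = a + b"
| "binop_val Sub a b = a - b"
| "binop_val Mul a b = a * b"
| "binop_val IDiv a b = a div b"
| "binop_val IMod a b = a mod b"

fun aval :: "aexp \<Rightarrow> state \<Rightarrow> nat" where
  "aval (N k) s = k"
| "aval (V x) s = reg s x"
| "aval (Cell a e) s = arr s a (aval e s)"
| "aval (Bin f e1 e2) s = binop_val f (aval e1 s) (aval e2 s)"

fun bval :: "bexp \<Rightarrow> state \<Rightarrow> bool" where
  "bval (Less e1 e2) s = (aval e1 s < aval e2 s)"
| "bval (Eq e1 e2) s = (aval e1 s = aval e2 s)"
| "bval (BNot b) s = (\<not> bval b s)"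
| "bval (BAnd b1 b2) s = (bval b1 s \<and> bval b2 s)"

fun afits :: "nat \<Rightarrow> aexp \<Rightarrow> state \<Rightarrow> bool" where
  "afits W (N k) s = (k \<le> W)"
| "afits W (V x) s = (reg s x \<le> W)"
| "afits W (Cell a e) s = (afits W e s \<and> arr s a (aval e s) \<le> W)"
| "afits W (Bin f e1 e2) s =
     (afits W e1 s \<and> afits W e2 s \<and> binop_val f (aval e1 s) (aval e2 s) \<le> W)"

fun bfits :: "nat \<Rightarrow> bexp \<Rightarrow> state \<Rightarrow> bool" where
  "bfits W (Less e1 e2) s = (afits W e1 s \<and> afits W e2 s)"
| "bfits W (Eq e1 e2) s = (afits W e1 s \<and> afits W e2 s)"
| "bfits W (BNot b) s = bfits W b s"
| "bfits W (BAnd b1 b2) s = (bfits W b1 s \<and> bfits W b2 s)"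

fun acost :: "aexp \<Rightarrow> nat" where
  "acost (N k) = 1"
| "acost (V x) = 1"
| "acost (Cell a e) = acost e + 1"
| "acost (Bin f e1 e2) = acost e1 + acost e2 + 1"

fun bcost :: "bexp \<Rightarrow> nat" where
  "bcost (Less e1 e2) = acost e1 + acost e2 + 1"
| "bcost (Eq e1 e2) = acost e1 + acost e2 + 1"
| "bcost (BNot b) = bcost b + 1"
| "bcost (BAnd b1 b2) = bcost b1 + bcost b2 + 1"

text \<open>\<open>exec W c s t s'\<close>: with word bound \<open>W\<close>, the program \<open>c\<close> started in \<open>s\<close> halts in \<open>s'\<close>
  after \<open>t\<close> elementary operations.\<close>

inductive exec :: "nat \<Rightarrow> com \<Rightarrow> state \<Rightarrow> nat \<Rightarrow> state \<Rightarrow> bool" for W where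
  Skip: "exec W Skip s 1 s"
| Assign: "afits W e s \<Longrightarrow>
    exec W (Assign x e) s (acost e + 1) (s\<lparr>reg := (reg s)(x := aval e s)\<rparr>)"
| Store: "afits W i s \<Longrightarrow> afits W e s \<Longrightarrow>
    exec W (Store a i e) s (acost i + acost e + 1)
      (s\<lparr>arr := (arr s)(a := (arr s a)(aval i s := aval e s))\<rparr>)"
| Seq: "exec W c1 s t1 s' \<Longrightarrow> exec W c2 s' t2 s'' \<Longrightarrow> exec W (Seq c1 c2) s (t1 + t2) s''"
| IfTrue: "bfits W b s \<Longrightarrow> bval b s \<Longrightarrow> exec W c1 s t s' \<Longrightarrow>
    exec W (If b c1 c2) s (bcost b + 1 + t) s'"
| IfFalse: "bfits W b s \<Longrightarrow> \<not> bval b s \<Longrightarrow> exec W c2 s t s' \<Longrightarrow>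
    exec W (If b c1 c2) s (bcost b + 1 + t) s'"
| WhileFalse: "bfits W b s \<Longrightarrow> \<not> bval b s \<Longrightarrow> exec W (While b c) s (bcost b + 1) s"
| WhileTrue: "bfits W b s \<Longrightarrow> bval b s \<Longrightarrow> exec W c s t1 s' \<Longrightarrow>
    exec W (While b c) s' t2 s'' \<Longrightarrow> exec W (While b c) s (bcost b + 1 + t1 + t2) s''"

inductive_cases exec_SkipE: "exec W Skip s t s'"
inductive_cases exec_AssignE: "exec W (Assign x e) s t s'"
inductive_cases exec_StoreE: "exec W (Store a i e) s t s'"
inductive_cases exec_SeqE: "exec W (Seq c1 c2) s t s'"
inductive_cases exec_IfE: "exec W (If b c1 c2) s t s'"
inductive_cases exec_WhileE: "exec W (While b c) s t s'"

text \<open>Determinism: asserting that some halting run has a property asserts it of the only run.\<close>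

lemma exec_deterministic:
  assumes "exec W c s t s'" and "exec W c s u s''"
  shows "u = t \<and> s'' = s'"
  using assms
proof (induction arbitrary: u s'' rule: exec.induct)
  case Skip then show ?case by (elim exec_SkipE) simp_all
next
  case Assign then show ?case by (elim exec_AssignE) simp_all
next
  case Store then show ?case by (elim exec_StoreE) simp_all
next
  case (Seq c1 s t1 s1 c2 t2 s2)
  from Seq.prems obtain v1 r1 v2 where
    "exec W c1 s v1 r1" "exec W c2 r1 v2 s''" "u = v1 + v2"
    by (rule exec_SeqE)
  with Seq.IH show ?case by blast
next
  case (IfTrue b s c1 t s' c2)
  from IfTrue.prems IfTrue.hyps(2) obtain v where "exec W c1 s v s''" "u = Suc (bcost b + v)"
    by (blast elim: exec_IfE)
  with IfTrue.IH show ?case by fastforce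
next
  case (IfFalse b s c2 t s' c1)
  from IfFalse.prems IfFalse.hyps(2) obtain v where "exec W c2 s v s''" "u = Suc (bcost b + v)"
    by (blast elim: exec_IfE)
  with IfFalse.IH show ?case by fastforce
next
  case WhileFalse from WhileFalse.prems show ?case
    by (rule exec_WhileE) (use WhileFalse.hyps in simp_all)
next
  case (WhileTrue b s c t1 s1 t2 s2)
  from WhileTrue.prems obtain v1 r1 v2 where
    "exec W c s v1 r1" "exec W (While b c) r1 v2 s''" "u = Suc (bcost b + v1 + v2)"
    by (rule exec_WhileE) (use WhileTrue.hyps in blast)+
  with WhileTrue.IH show ?case by fastforce
qed

text \<open>Permutations are passed in one-line notation and index sets as 0/1 arrays, at the positions
  \<open>1, \<dots>, n\<close>; all other memory is zero. The group is passed as a permutation \<open>g\<close> generating it.\<close>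

definition input_state ::
    "nat \<Rightarrow> (nat \<Rightarrow> nat) \<Rightarrow> (nat \<Rightarrow> nat) \<Rightarrow> nat set \<Rightarrow> nat set \<Rightarrow> state" where
  "input_state n \<gamma> g I0 I1 =
    \<lparr>reg = (\<lambda>_. 0)(''n'' := n),
     arr = (\<lambda>_ _. 0)(
       ''perm'' := (\<lambda>i. if i \<in> {1..n} then \<gamma> i else 0),
       ''gen'' := (\<lambda>i. if i \<in> {1..n} then g i else 0),
       ''I0'' := (\<lambda>i. of_bool (i \<in> I0)),
       ''I1'' := (\<lambda>i. of_bool (i \<in> I1)))\<rparr>"

definition output_emptiness :: "(nat \<Rightarrow> real) set \<Rightarrow> state \<Rightarrow> bool" where
  "output_emptiness X s \<longleftrightarrow> reg s ''empty'' = of_bool (X = {})"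

definition output_fixings :: "nat \<Rightarrow> (nat \<Rightarrow> real) set \<Rightarrow> state \<Rightarrow> bool" where
  "output_fixings n X s \<longleftrightarrow>
    (\<forall>i\<in>{1..n}. arr s ''J0'' i = of_bool (i \<in> complete_fixings n X 0) \<and>
                arr s ''J1'' i = of_bool (i \<in> complete_fixings n X 1))"

definition valid_instance ::
    "nat \<Rightarrow> (nat \<Rightarrow> nat) \<Rightarrow> (nat \<Rightarrow> nat) list \<Rightarrow> (nat \<Rightarrow> nat) set \<Rightarrow> (nat \<Rightarrow> nat) \<Rightarrow>
     nat set \<Rightarrow> nat set \<Rightarrow> bool" where
  "valid_instance n \<gamma> \<zeta>s \<Gamma> g I0 I1 \<longleftrightarrow>
     n \<ge> 1 \<and> \<gamma> permutes {1..n} \<and> supp \<gamma> = {1..n} \<and>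
     disjoint_cycle_factors \<zeta>s \<gamma> \<and> (\<forall>\<zeta>\<in>set \<zeta>s. monotone_cycle \<zeta>) \<and> ordered_cycles \<zeta>s \<and>
     subgroup \<Gamma> (sym_group n) \<and> \<Gamma> \<subseteq> generate (sym_group n) {\<gamma>} \<and>
     g \<in> \<Gamma> \<and> \<Gamma> = generate (sym_group n) {g} \<and>
     I0 \<subseteq> {1..n} \<and> I1 \<subseteq> {1..n} \<and> I0 \<inter> I1 = {}"

end

theory Submission
  imports Defs "HOL-Number_Theory.Cong"
begin

text \<open>
  A monotone and ordered permutation consists of intervals on which it acts as \<open>i \<mapsto> i + 1\<close>
  cyclically, so a subgroup \<open>\<langle>g\<rangle>\<close> rotates every interval. Lexicographic maximality is decided
  interval by interval: the restriction of \<open>x\<close> to an interval must be maximal among its rotations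
  by the powers of \<open>g\<close> that stabilise all earlier restrictions. These powers are the multiples of
  some \<open>M\<close>, and it is best to keep this stabiliser as small as possible.

  On one interval, a partial word is completed from left to right as in the generation of
  necklaces: \<open>p\<close> is the period with which the prefix must continue, and a free entry gets
  the largest admissible value. When the scan fails, it suffices to revise the latest free entry
  that was set to \<open>1\<close>. Indeed, grafting the tail of a solution with an earlier revision onto the
  prefix with the latest one gives a solution all of whose proper rotations are strictly smaller.
  The same grafting shows that either some solution has a trivial stabiliser or the solution is
  unique, hence a smallest stabiliser exists. Since \<open>M\<close> may be superpolynomial, it is represented
  by the small divisors of it that were contributed by single intervals; they determine
  \<open>gcd l M\<close>, which is all that matters for an interval of length \<open>l\<close>.
\<close>

section \<open>Lexicographically maximal rotations of a word\<close>

text \<open>Plain backtracking over the free entries would be exponential. What tames it: once entry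
  \<open>q - 1\<close> has been lowered from 1 to 0, every nontrivial admissible rotation by less
  than \<open>q\<close> is strictly smaller already within the prefix. A solution branching off
  earlier could therefore be grafted onto that prefix, and earlier choices need never be revisited.
  An interval of length l thus costs at most l restarts of about l steps each. With l at most the
  maximal cycle length L, the intervals sum to n * L, and probing both values of each of the n
  entries gives n * n * L.

  Keeping the stabiliser small matters because only its elements constrain the later intervals: a
  continuation that is maximal under a group of rotations is maximal under each subgroup.

  The greedy scan gets stuck for two reasons: a prescribed 1 exceeds the bound set by the period, or
  the completed word has a period other than l. In the second case it is still a solution if the
  period divides l, and the search goes on only because a strict solution would leave a smaller
  stabiliser.\<close>

definition lexless :: "nat \<Rightarrow> (nat \<Rightarrow> nat) \<Rightarrow> (nat \<Rightarrow> nat) \<Rightarrow> bool" where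
  "lexless l u v \<longleftrightarrow> (\<exists>k<l. u k < v k \<and> (\<forall>i<k. u i = v i))"

definition agree :: "nat \<Rightarrow> (nat \<Rightarrow> nat) \<Rightarrow> (nat \<Rightarrow> nat) \<Rightarrow> bool" where
  "agree m x y \<longleftrightarrow> (\<forall>i<m. x i = y i)"

definition rot :: "nat \<Rightarrow> nat \<Rightarrow> (nat \<Rightarrow> nat) \<Rightarrow> nat \<Rightarrow> nat" where
  "rot l t x i = x ((i + t) mod l)"

text \<open>The suffix from \<open>t\<close> on falls below the prefix at a place inside the
  \<open>m\<close> letters present, so no later letter can undo it.\<close>

definition drops :: "nat \<Rightarrow> (nat \<Rightarrow> nat) \<Rightarrow> nat \<Rightarrow> bool" where
  "drops m y t \<longleftrightarrow> (\<exists>c. t + c < m \<and> y (t + c) < y c \<and> (\<forall>i<c. y (t + i) = y i))"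

lemma lex_cases: "lexless l u v \<or> agree l u v \<or> lexless l v u"
proof (cases "agree l u v")
  case False
  then have ex: "\<exists>i. i < l \<and> u i \<noteq> v i" by (auto simp: agree_def)
  define k where "k = (LEAST i. i < l \<and> u i \<noteq> v i)"
  have k: "k < l \<and> u k \<noteq> v k" unfolding k_def by (rule LeastI_ex[OF ex])
  have "\<forall>i<k. u i = v i" using not_less_Least[of _ "\<lambda>i. i < l \<and> u i \<noteq> v i"] k unfolding k_def[symmetric] by (metis less_trans)
  then show ?thesis using k unfolding lexless_def by (metis linorder_neqE_nat)
qed auto

lemma lexless_asym: "lexless l u v \<Longrightarrow> \<not> lexless l v u"
  unfolding lexless_def by (metis less_asym' linorder_neqE_nat less_not_refl)

lemma lexless_not_agree: "lexless l u v \<Longrightarrow> \<not> agree l u v \<and> \<not> agree l v u"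
  unfolding lexless_def agree_def by (metis less_not_refl)

lemma agree_sym: "agree l u v \<Longrightarrow> agree l v u" by (simp add: agree_def)

lemma drops_lexless:
  assumes "drops l y t" "t < l" shows "lexless l (rot l t y) y"
proof -
  obtain c where c: "t + c < l" "y (t + c) < y c" "\<forall>i<c. y (t + i) = y i"
    using assms unfolding drops_def by blast
  have "rot l t y i = y (t + i)" if "i \<le> c" for i using that c by (simp add: rot_def add.commute)
  then show ?thesis unfolding lexless_def using c by (intro exI[of _ c]) auto
qed

section \<open>Prenecklaces with prescribed zeros (\<open>Z\<close>) and ones (\<open>U\<close>)
  under rotations by multiples of \<open>d\<close>\<close>

locale cyclic_word =
  fixes l d :: nat and Z U :: "nat set"
  assumes d_pos: "0 < d" and d_dvd: "d dvd l" and l_pos: "0 < l"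
begin

definition compatible :: "nat \<Rightarrow> (nat \<Rightarrow> nat) \<Rightarrow> bool" where
  "compatible m x \<longleftrightarrow> (\<forall>i<m. x i \<le> 1 \<and> (i \<in> Z \<longrightarrow> x i = 0) \<and> (i \<in> U \<longrightarrow> x i = 1))"

definition sol :: "(nat \<Rightarrow> nat) \<Rightarrow> bool" where
  "sol x \<longleftrightarrow> compatible l x \<and> (\<forall>t. d dvd t \<longrightarrow> \<not> lexless l x (rot l t x))"

text \<open>For a solution this says that no admissible rotation except the trivial one fixes
  it.\<close>

definition strict :: "(nat \<Rightarrow> nat) \<Rightarrow> bool" where
  "strict x \<longleftrightarrow> (\<forall>t. d dvd t \<longrightarrow> 0 < t \<longrightarrow> t < l \<longrightarrow> lexless l (rot l t x) x)"

text \<open>For \<open>d = 1\<close> and \<open>k > 0\<close> these are the Lyndon words over the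
  alphabet in which 1 precedes 0.\<close>

definition aperiodic :: "nat \<Rightarrow> (nat \<Rightarrow> nat) \<Rightarrow> bool" where
  "aperiodic k y \<longleftrightarrow> (\<forall>t. d dvd t \<and> 0 < t \<and> t < k \<longrightarrow> drops k y t)"

text \<open>Only the rotations by multiples of \<open>d\<close> act. If \<open>m < p\<close>, the rotations by less than \<open>p\<close> are
  already strictly smaller and the entry at \<open>m\<close> is not yet bounded by an earlier one.\<close>

definition prenecklace :: "nat \<Rightarrow> nat \<Rightarrow> (nat \<Rightarrow> nat) \<Rightarrow> bool" where
  "prenecklace m p y \<longleftrightarrow> d dvd p \<and> 0 < p \<and> p \<le> m + d \<and> (\<forall>i. p \<le> i \<and> i < m \<longrightarrow> y i = y (i - p)) \<and>
     (\<forall>t. d dvd t \<and> 0 < t \<and> t < p \<longrightarrow> drops m y t)"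

lemma rot_mod: "rot l (t mod l) x = rot l t x"
  by (rule ext) (simp add: rot_def mod_add_right_eq)

lemma sol_small:
  assumes "compatible l x" and "\<And>t. d dvd t \<Longrightarrow> 0 < t \<Longrightarrow> t < l \<Longrightarrow> \<not> lexless l x (rot l t x)"
  shows "sol x"
  unfolding sol_def
proof (intro conjI allI impI assms(1))
  fix t assume t: "d dvd t"
  have "d dvd t mod l" using t d_dvd by (simp add: dvd_mod)
  moreover have "t mod l < l" using l_pos by simp
  moreover have "\<not> lexless l x (rot l 0 x)"
    unfolding lexless_def rot_def by auto
  ultimately have "\<not> lexless l x (rot l (t mod l) x)"
    using assms(2)[of "t mod l"] by (cases "t mod l = 0") auto
  then show "\<not> lexless l x (rot l t x)" by (simp add: rot_mod)
qed

lemma strict_sol: "compatible l x \<Longrightarrow> strict x \<Longrightarrow> sol x"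
  by (rule sol_small) (auto simp: strict_def dest: lexless_asym)

text \<open>Beyond the period nothing new happens: the suffix at \<open>t\<close> is the suffix at
  \<open>t - p\<close> cut short by \<open>p\<close> letters. It inherits the drop of that suffix,
  or ties if the drop has been cut off.\<close>

lemma prenecklace_tie:
  assumes P: "prenecklace m p y"
  shows "d dvd t \<Longrightarrow> 0 < t \<Longrightarrow> drops m y t \<or> (\<forall>i. t + i < m \<longrightarrow> y (t + i) = y i)"
proof (induction t rule: less_induct)
  case (less t)
  have per: "\<And>i. p \<le> i \<Longrightarrow> i < m \<Longrightarrow> y i = y (i - p)" and p: "d dvd p" "0 < p"
    using P by (auto simp: prenecklace_def)
  consider "t < p" | "t = p" | "p < t" by linarith
  then show ?case
  proof cases
    case 1 then show ?thesis using P less.prems by (auto simp: prenecklace_def)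
  next
    case 2 then show ?thesis using per by auto
  next
    case 3
    have eq: "y (t + i) = y (t - p + i)" if "t + i < m" for i using per[of "t + i"] that 3 by simp
    have "drops m y (t - p) \<or> (\<forall>i. t - p + i < m \<longrightarrow> y (t - p + i) = y i)"
      using 3 p less.prems by (intro less.IH) (auto intro: dvd_diff_nat)
    then show ?thesis
    proof
      assume "drops m y (t - p)"
      then obtain c where c: "t - p + c < m" "y (t - p + c) < y c" "\<forall>i<c. y (t - p + i) = y i"
        unfolding drops_def by blast
      show ?thesis
      proof (cases "t + c < m")
        case True
        then have "y (t + c) < y c \<and> (\<forall>i<c. y (t + i) = y i)" using c eq by auto
        then show ?thesis using True unfolding drops_def by blast
      next
        case False
        then have "\<forall>i. t + i < m \<longrightarrow> y (t + i) = y i" using c eq by auto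
        then show ?thesis by blast
      qed
    next
      assume "\<forall>i. t - p + i < m \<longrightarrow> y (t - p + i) = y i"
      then show ?thesis using eq by simp
    qed
  qed
qed

text \<open>A shift that has not dropped before \<open>q\<close> ties up to \<open>q\<close>, and
  then \<open>y (q - t)\<close> is at least \<open>y q = 1\<close>. Lowering entry \<open>q\<close>
  creates the drop exactly there, since entry \<open>q - t\<close> is untouched.\<close>

lemma lower_drops:
  assumes P: "prenecklace m p y" and q: "q < m" "y q = 1" and t: "d dvd t" "0 < t" "t \<le> q"
  shows "drops (Suc q) (y(q := 0)) t"
proof -
  let ?z = "y(q := 0)"
  consider c where "t + c < q" "y (t + c) < y c" "\<forall>i<c. y (t + i) = y i"
    | "\<forall>i. t + i < q \<longrightarrow> y (t + i) = y i" "1 \<le> y (q - t)"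
  proof (cases "drops m y t")
    case True
    then obtain c where c: "t + c < m" "y (t + c) < y c" "\<forall>i<c. y (t + i) = y i"
      unfolding drops_def by blast
    consider "t + c < q" | "t + c = q" | "q < t + c" by linarith
    then show thesis
    proof cases
      case 1 then show thesis using c that(1) by blast
    next
      case 2
      then have "q - t = c" by simp
      then show thesis using c 2 q that(2) by auto
    next
      case 3
      then have "y (t + (q - t)) = y (q - t)" using c t by (intro c(3)[rule_format]) simp
      then show thesis using c 3 t q that(2) by simp
    qed
  next
    case False
    then have tie: "\<forall>i. t + i < m \<longrightarrow> y (t + i) = y i" using prenecklace_tie[OF P t(1,2)] by blast
    have "y (t + (q - t)) = y (q - t)" using t q by (intro tie[rule_format]) simp
    then show thesis using tie that(2) q t by simp
  qed
  then show ?thesis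
  proof cases
    case (1 c)
    then show ?thesis unfolding drops_def using t by (intro exI[of _ c]) auto
  next
    case 2
    show ?thesis unfolding drops_def using 2 t by (intro exI[of _ "q - t"]) auto
  qed
qed

lemma lower_aperiodic:
  assumes "prenecklace m p y" "q < m" "y q = 1"
  shows "aperiodic (Suc q) (y(q := 0))"
  using lower_drops[OF assms] by (auto simp: aperiodic_def)

lemma next_multiple: "q < (q div d + 1) * d" "(q div d + 1) * d \<le> q + d" "d dvd (q div d + 1) * d"
  using d_pos by (auto simp: dividend_less_div_times)

lemma multiple_less_next: "d dvd t \<Longrightarrow> t < (q div d + 1) * d \<Longrightarrow> t \<le> q"
proof -
  assume "d dvd t" "t < (q div d + 1) * d"
  then obtain s where "t = d * s" by auto
  with \<open>t < _\<close> have "s \<le> q div d" using d_pos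
    by (metis Suc_eq_plus1 less_Suc_eq_le mult.commute mult_less_cancel1)
  then show "t \<le> q" using \<open>t = d * s\<close> by (metis le_trans mult_le_mono2 times_div_less_eq_dividend)
qed

text \<open>All multiples of \<open>d\<close> up to \<open>q\<close> drop now, so the period becomes
  the least multiple of \<open>d\<close> above \<open>q\<close>. It may exceed the length of the
  word; this, and the initial state with \<open>m = 0\<close> and \<open>p = d\<close>, is why
  \<open>prenecklace\<close> asks only for \<open>p \<le> m + d\<close>.\<close>

lemma lower_prenecklace:
  assumes "prenecklace m p y" "q < m" "y q = 1"
  shows "prenecklace (Suc q) ((q div d + 1) * d) (y(q := 0))"
proof -
  have "p \<le> i \<and> i < Suc q \<longrightarrow> False" if "p = (q div d + 1) * d" for i p
    using next_multiple(1)[of q] that by simp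
  moreover have "drops (Suc q) (y(q := 0)) t" if "d dvd t" "0 < t" "t < (q div d + 1) * d" for t
    using lower_drops[OF assms] that multiple_less_next by blast
  moreover have "0 < (q div d + 1) * d" "(q div d + 1) * d \<le> Suc q + d"
    using next_multiple(1,2)[of q] by linarith+
  ultimately show ?thesis
    unfolding prenecklace_def using next_multiple(3) by blast
qed

lemma keep_prenecklace:
  assumes P: "prenecklace m p y" and v: "p \<le> m \<Longrightarrow> v = y (m - p)"
  shows "prenecklace (Suc m) p (y(m := v))"
  unfolding prenecklace_def
proof (intro conjI allI impI)
  fix t assume t: "d dvd t \<and> 0 < t \<and> t < p"
  then have "drops m y t" using P by (auto simp: prenecklace_def)
  then obtain c where "t + c < m \<and> y (t + c) < y c \<and> (\<forall>i<c. y (t + i) = y i)"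
    unfolding drops_def by blast
  then show "drops (Suc m) (y(m := v)) t" unfolding drops_def by (intro exI[of _ c]) auto
next
  fix i assume i: "p \<le> i \<and> i < Suc m"
  show "(y(m := v)) i = (y(m := v)) (i - p)"
  proof (cases "i = m")
    case True
    then show ?thesis using v i P by (simp add: prenecklace_def)
  next
    case False
    then have "y i = y (i - p)" using P i unfolding prenecklace_def by auto
    moreover have "i - p \<noteq> m" using False i by linarith
    ultimately show ?thesis using False i by simp
  qed
qed (use P in \<open>auto simp: prenecklace_def\<close>)

text \<open>The value above which the rotation by \<open>p\<close> would beat the word; while
  \<open>m < p\<close> that rotation does not constrain entry \<open>m\<close>, and only the
  alphabet does.\<close>

definition bound :: "nat \<Rightarrow> nat \<Rightarrow> (nat \<Rightarrow> nat) \<Rightarrow> nat" where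
  "bound m p y = (if m < p then 1 else y (m - p))"

lemma bound_le1: "compatible m y \<Longrightarrow> 0 < p \<Longrightarrow> 0 < m \<or> m < p \<Longrightarrow> bound m p y \<le> 1"
  by (auto simp: bound_def compatible_def)

lemma step_prenecklace:
  assumes P: "prenecklace m p y" and b: "bound m p y \<le> 1" and v: "v \<le> bound m p y"
  shows "prenecklace (Suc m) (if v < bound m p y then (m div d + 1) * d else p) (y(m := v))"
proof (cases "v < bound m p y")
  case True
  then have b1: "bound m p y = 1" "v = 0" using b by auto
  \<comment> \<open>A smaller entry is reached in two moves: continue the period with 1, then lower
    that entry.\<close>
  have "prenecklace (Suc m) p (y(m := 1))"
    using b1 by (intro keep_prenecklace[OF P]) (simp add: bound_def split: if_splits)
  from lower_prenecklace[OF this, of m] have "prenecklace (Suc m) ((m div d + 1) * d) (y(m := 0))" by simp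
  then show ?thesis using True b1 by simp
next
  case False
  then have "v = bound m p y" using v by simp
  then show ?thesis using False keep_prenecklace[OF P] by (simp add: bound_def)
qed

text \<open>By periodicity of the prefix, the rotation by \<open>p\<close> agrees with
  \<open>x\<close> before position \<open>m - p\<close>, where it shows entry \<open>m\<close>. That
  entry must not be larger.\<close>

lemma sol_le_bound:
  assumes P: "prenecklace m p y" and x: "sol x" "agree m x y" and m: "m < l"
  shows "x m \<le> bound m p y"
proof (cases "m < p")
  case True then show ?thesis using x m by (auto simp: bound_def sol_def compatible_def)
next
  case False
  have p: "d dvd p" "0 < p" and per: "\<And>i. p \<le> i \<Longrightarrow> i < m \<Longrightarrow> y i = y (i - p)"
    using P by (auto simp: prenecklace_def)
  have "\<not> lexless l x (rot l p x)" using x p by (auto simp: sol_def)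
  moreover have "x i = rot l p x i" if "i < m - p" for i
    using that x m per[of "i + p"] by (simp add: rot_def agree_def)
  moreover have "rot l p x (m - p) = x m" using False m by (simp add: rot_def)
  moreover have "x (m - p) = y (m - p)" using x p False by (simp add: agree_def)
  ultimately show ?thesis using False m unfolding lexless_def bound_def
    by (metis less_imp_diff_less not_le_imp_less)
qed

text \<open>A suffix of \<open>x\<close> that is also a prefix reaching beyond \<open>i1\<close> begins with \<open>x\<close> up to \<open>i1\<close>, hence is
  smaller than \<open>y\<close>; a shorter one would, by aperiodicity of \<open>y\<close>, make a rotation of \<open>x\<close> exceed \<open>x\<close>.\<close>

lemma graft_strict:
  assumes x: "sol x" and ap: "aperiodic (Suc q) y" and q: "q < l" and i1: "i1 < q"
    and ag: "\<forall>i<i1. x i = y i" and lt: "x i1 < y i1"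
  shows "strict (\<lambda>i. if i \<le> q then y i else x i)" (is "strict ?z")
  unfolding strict_def
proof (intro allI impI)
  fix t assume t: "d dvd t" "0 < t" "t < l"
  show "lexless l (rot l t ?z) ?z"
  proof (cases "t \<le> q")
    case True
    then have "drops (Suc q) y t" using ap t by (auto simp: aperiodic_def)
    then obtain c where "t + c < Suc q" "y (t + c) < y c" "\<forall>i<c. y (t + i) = y i"
      unfolding drops_def by blast
    then have "drops l ?z t" unfolding drops_def using q by (intro exI[of _ c]) auto
    then show ?thesis using t by (intro drops_lexless)
  next
    case False
    \<comment> \<open>As \<open>t > q\<close>, the rotation begins with the last \<open>h\<close>
      letters of \<open>x\<close>, none of them altered by the graft.\<close>
    define h where "h = l - t"
    have h: "0 < h" "t + h = l" "h < l" using t False by (auto simp: h_def)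
    have dh: "d dvd h" unfolding h_def using t d_dvd by (intro dvd_diff_nat)
    have zx: "?z i = x i" if "i < i1" for i using that ag i1 by auto
    have z1: "?z i1 = y i1" using i1 by simp
    have rx: "rot l t x i = x (t + i)" "rot l t ?z i = x (t + i)" if "i < h" for i
      using that h False by (auto simp: rot_def add.commute)
    have nless: "\<not> lexless l x (rot l t x)" using x t by (auto simp: sol_def)
    have witness: "lexless l (rot l t ?z) ?z" if "c < h" "x (t + c) < ?z c" "\<forall>i<c. x (t + i) = ?z i" for c
      unfolding lexless_def using that rx h by (intro exI[of _ c]) auto
    show ?thesis
    proof (cases "\<forall>i<h. x (t + i) = x i")
      case False
      then have "\<not> agree h (\<lambda>i. x (t + i)) x" by (auto simp: agree_def)
      then consider "lexless h (\<lambda>i. x (t + i)) x" | "lexless h x (\<lambda>i. x (t + i))"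
        using lex_cases by blast
      then show ?thesis
      proof cases
        case 1
        then obtain c where c: "c < h" "x (t + c) < x c" "\<forall>i<c. x (t + i) = x i"
          unfolding lexless_def by auto
        show ?thesis
        proof (cases "c < i1")
          case True then show ?thesis using witness[of c] c zx by auto
        next
          case False
          have ylt: "y i1 \<ge> x i1" using lt by simp
          \<comment> \<open>The suffix is not above \<open>x\<close> up to position
            \<open>i1\<close>, where the graft exceeds \<open>x\<close>; so it is already smaller
            there.\<close>
          have "x (t + i1) \<le> x i1" using c False by (cases "c = i1") auto
          then show ?thesis using witness[of i1] c zx False lt z1 by auto
        qed
      next
        case 2
        then obtain c where c: "c < h" "x c < x (t + c)" "\<forall>i<c. x i = x (t + i)"
          unfolding lexless_def by auto
        then have "lexless l x (rot l t x)" unfolding lexless_def using rx h by (intro exI[of _ c]) auto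
        then show ?thesis using nless by blast
      qed
    next
      case True
      show ?thesis
      proof (cases "i1 < h")
        case i1h: True
        then show ?thesis using witness[of i1] True zx lt z1 by auto
      next
        case False
        \<comment> \<open>The suffix is a prefix of length \<open>h \<le> i1\<close>. The drop of
          \<open>y\<close> at shift \<open>h\<close> carries over to \<open>x\<close>, at the latest
          at position \<open>i1\<close>, where \<open>x\<close> is even lower than \<open>y\<close>.
          But the rotation by \<open>t\<close> repeats this prefix and then restarts
          \<open>x\<close>, so it would exceed \<open>x\<close>.\<close>
        have "drops (Suc q) y h" using ap dh h False i1 by (auto simp: aperiodic_def)
        then obtain c where c: "h + c < Suc q" "y (h + c) < y c" "\<forall>i<c. y (h + i) = y i"
          unfolding drops_def by blast
        define J where "J = min c (i1 - h)"
        have rw: "rot l t x (h + j) = x j" if "h + j < l" for j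
        proof -
          have "h + j + t = j + l" using h by simp
          then have "(h + j + t) mod l = j mod l" by (simp only: mod_add_self2)
          then have "(h + j + t) mod l = j" using that by simp
          then show ?thesis by (simp only: rot_def)
        qed
        have before: "x (h + j) = x j" if "j < J" for j
          using that c ag False by (auto simp: J_def)
        have at: "x (h + J) < x J"
        proof (cases "c < i1 - h")
          case True
          then show ?thesis using c ag False h by (auto simp: J_def)
        next
          case F2: False
          then have J: "J = i1 - h" "h + J = i1" using False by (auto simp: J_def)
          have "J = c \<or> J < c" using F2 J(1) by linarith
          then have "y (h + J) \<le> y J" using c(2,3) by (metis less_imp_le order_refl)
          moreover have "x J = y J" using J h ag False by auto
          ultimately show ?thesis using lt J by simp
        qed
        have hJ: "h + J < l" using c q by (simp add: J_def)
        have "lexless l x (rot l t x)" unfolding lexless_def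
        proof (intro exI[of _ "h + J"] conjI allI impI hJ)
          show "x (h + J) < rot l t x (h + J)" using at rw hJ by simp
          fix i assume i: "i < h + J"
          show "x i = rot l t x i"
          proof (cases "i < h")
            case ih: True then show ?thesis using True rx by simp
          next
            case False
            then obtain j where "i = h + j" by (metis le_Suc_ex not_less)
            then show ?thesis using before[of j] rw[of j] i hJ by auto
          qed
        qed
        then show ?thesis using nless by blast
      qed
    qed
  qed
qed

section \<open>Completed words and their stabilisers\<close>

lemma period_mod:
  assumes "prenecklace l p y" "i < l"
  shows "y i = y (i mod p)"
  using assms(2)
proof (induction i rule: less_induct)
  case (less i)
  have p: "0 < p" "\<And>i. p \<le> i \<Longrightarrow> i < l \<Longrightarrow> y i = y (i - p)" using assms by (auto simp: prenecklace_def)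
  show ?case
  proof (cases "i < p")
    case False
    then have "y i = y (i - p)" using p less by auto
    also have "\<dots> = y ((i - p) mod p)" using less p False by (intro less.IH) auto
    finally show ?thesis using False by (simp add: le_mod_geq)
  qed auto
qed

lemma rot_period:
  assumes P: "prenecklace l p y" and pl: "p dvd l"
  shows "agree l (rot l t y) (rot l (t mod p) y)"
  unfolding agree_def rot_def
proof (intro allI impI)
  fix i assume "i < l"
  have "y ((i + t) mod l) = y ((i + t) mod l mod p)" using period_mod[OF P] l_pos by simp
  also have "(i + t) mod l mod p = (i + t mod p) mod l mod p"
    using pl by (simp add: mod_mod_cancel mod_add_right_eq)
  also have "y \<dots> = y ((i + t mod p) mod l)" using period_mod[OF P] l_pos by simp
  finally show "y ((i + t) mod l) = y ((i + t mod p) mod l)" .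
qed

lemma agree_lexless: "agree l u u' \<Longrightarrow> agree l v v' \<Longrightarrow> lexless l u v \<longleftrightarrow> lexless l u' v'"
  unfolding agree_def lexless_def by (metis less_trans)

text \<open>Because \<open>p\<close> divides \<open>l\<close>, the period holds cyclically, and
  rotating by \<open>t\<close> is rotating by \<open>t mod p\<close>: nothing moves if this is 0,
  and the word drops otherwise.\<close>

lemma full_necklace:
  assumes P: "prenecklace l p y" and c: "compatible l y" and pl: "p dvd l"
  shows "sol y" and "d dvd t \<Longrightarrow> agree l (rot l t y) y \<longleftrightarrow> p dvd t" and "p = l \<Longrightarrow> strict y"
proof -
  have p: "d dvd p" "0 < p" "p \<le> l" using P pl l_pos by (auto simp: prenecklace_def dvd_imp_le)
  have main: "if p dvd t then agree l (rot l t y) y else lexless l (rot l t y) y" if t: "d dvd t" for t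
  proof (cases "p dvd t")
    case True
    then have "agree l (rot l t y) (rot l 0 y)" using rot_period[OF P pl, of t] by simp
    then show ?thesis using True by (simp add: agree_def rot_def)
  next
    case False
    then have s: "0 < t mod p" "t mod p < p" "d dvd t mod p"
      using p t by (auto simp: dvd_mod mod_greater_zero_iff_not_dvd)
    then have "drops l y (t mod p)" using P by (auto simp: prenecklace_def)
    then have "lexless l (rot l (t mod p) y) y" using less_le_trans[OF s(2) p(3)] by (intro drops_lexless)
    then have "lexless l (rot l t y) y"
      using agree_lexless[OF rot_period[OF P pl]] by (metis agree_def)
    then show ?thesis using False by simp
  qed
  show "sol y" unfolding sol_def using c main lexless_asym lexless_not_agree by metis
  show "d dvd t \<Longrightarrow> agree l (rot l t y) y \<longleftrightarrow> p dvd t" using main lexless_not_agree by metis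
  show "p = l \<Longrightarrow> strict y" unfolding strict_def using main by (metis nat_dvd_not_less)
qed

text \<open>With \<open>h = l mod p\<close>, the rotation by \<open>l - h\<close>, a multiple of
  \<open>p\<close>, reproduces the first \<open>h\<close> letters and then restarts the word. The
  suffix at \<open>h\<close> drops below that restart, so the rotation is larger.\<close>

lemma broken_necklace:
  assumes P: "prenecklace l p y" and pl: "\<not> p dvd l" and ag: "agree l x y"
  shows "\<not> sol x"
proof
  assume "sol x"
  define h where "h = l mod p"
  have p: "d dvd p" "0 < p" using P by (auto simp: prenecklace_def)
  have h: "0 < h" "h < p" "d dvd h" using p pl d_dvd by (auto simp: h_def dvd_mod mod_greater_zero_iff_not_dvd)
  have hl: "h \<le> l" by (simp add: h_def)
  have "drops l y h" using P h by (auto simp: prenecklace_def)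
  then obtain c where c: "h + c < l" "y (h + c) < y c" "\<forall>i<c. y (h + i) = y i"
    unfolding drops_def by blast
  let ?t = "l - h"
  have dt: "d dvd ?t" using h d_dvd by (intro dvd_diff_nat)
  have pt: "p dvd ?t" by (simp add: h_def minus_mod_eq_mult_div)
  have low: "rot l ?t x i = x i" if "i < h" for i
  proof -
    have il: "i + ?t < l" using that hl by simp
    then have "rot l ?t x i = y (i + ?t)" using ag by (simp add: rot_def agree_def)
    also have "\<dots> = y ((i + ?t) mod p)" using period_mod[OF P il] .
    also have "(i + ?t) mod p = i mod p" using pt by (metis add.right_neutral dvd_imp_mod_0 mod_add_right_eq)
    also have "y (i mod p) = y i" using period_mod[OF P, of i] il by simp
    also have "\<dots> = x i" using ag il by (simp add: agree_def)
    finally show ?thesis .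
  qed
  have high: "rot l ?t x (h + j) = x j" if "h + j < l" for j
  proof -
    have "h + j + ?t = j + l" using hl by simp
    then have "(h + j + ?t) mod l = j mod l" by (simp only: mod_add_self2)
    then have "(h + j + ?t) mod l = j" using that by simp
    then show ?thesis by (simp only: rot_def)
  qed
  have "lexless l x (rot l ?t x)" unfolding lexless_def
  proof (intro exI[of _ "h + c"] conjI allI impI c(1))
    show "x (h + c) < rot l ?t x (h + c)" using high c ag by (simp add: agree_def)
    fix i assume i: "i < h + c"
    show "x i = rot l ?t x i"
    proof (cases "i < h")
      case True then show ?thesis using low by simp
    next
      case False
      then obtain j where "i = h + j" by (metis le_Suc_ex not_less)
      then show ?thesis using high[of j] c i ag by (simp add: agree_def)
    qed
  qed
  then show False using \<open>sol x\<close> dt by (auto simp: sol_def)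
qed

text \<open>Any nontrivial rotation fixing \<open>x\<close> is by more than \<open>q\<close>, and so
  is its inverse, whence \<open>2 * q + 2 \<le> l\<close>. This leaves room for a multiple of the
  period of \<open>y\<close> just above \<open>q\<close>. It rotates \<open>x\<close> so that the
  first \<open>q + 1\<close> letters dominate those of \<open>y\<close>, which beat \<open>x\<close>
  at \<open>q\<close>.\<close>

lemma other_sol_strict:
  assumes P: "prenecklace l p y" and c: "compatible l y" and pl: "p dvd l" "p < l"
    and q: "q < l" "y q = 1" and holes: "\<And>i. q < i \<Longrightarrow> i < l \<Longrightarrow> i \<notin> Z \<union> U \<Longrightarrow> y i = 0"
    and x: "sol x" "agree q x y" "x q = 0"
  shows "strict x"
proof (rule ccontr)
  assume "\<not> strict x"
  then obtain t where t: "d dvd t" "0 < t" "t < l" "\<not> lexless l (rot l t x) x" by (auto simp: strict_def)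
  then have tie: "agree l x (rot l t x)" using x(1) lex_cases unfolding sol_def by blast
  have ap: "aperiodic (Suc q) (y(q := 0))" using lower_aperiodic[OF P q] .
  have xy: "(y(q := 0)) i = x i" if "i \<le> q" for i using that x by (auto simp: agree_def)
  \<comment> \<open>The first \<open>q + 1\<close> letters of \<open>x\<close> form the lowered
    word; its drops exclude a tie at any shift up to \<open>q\<close>.\<close>
  have big: "q < s" if s: "d dvd s" "0 < s" "s < l" and ts: "agree l x (rot l s x)" for s
  proof (rule ccontr)
    assume "\<not> q < s"
    then obtain k where k: "s + k < Suc q" "(y(q := 0)) (s + k) < (y(q := 0)) k"
      using ap s unfolding aperiodic_def drops_def by force
    then have "x (s + k) < x k" using xy[of "s+k"] xy[of k] by simp
    moreover have "x k = rot l s x k" using ts k q unfolding agree_def by auto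
    moreover have "rot l s x k = x (s + k)" using k q by (simp add: rot_def add.commute)
    ultimately show False by simp
  qed
  have "q < t" using big t tie by blast
  have "agree l x (rot l (l - t) x)"
    unfolding agree_def
  proof (intro allI impI)
    fix i assume "i < l"
    let ?j = "(i + (l - t)) mod l"
    have "x ?j = rot l t x ?j" using tie l_pos unfolding agree_def by simp
    also have "\<dots> = x ((?j + t) mod l)" unfolding rot_def ..
    also have "(?j + t) mod l = (i + (l - t) + t) mod l" by (simp add: mod_add_left_eq)
    also have "\<dots> = i" using t \<open>i < l\<close> by simp
    finally show "x i = rot l (l - t) x i" by (simp add: rot_def)
  qed
  then have "q < l - t" using big[of "l - t"] t d_dvd by (simp add: dvd_diff_nat)
  then have q2: "2 * q + 2 \<le> l" using \<open>q < t\<close> by simp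
  have p: "d dvd p" "0 < p" using P by (auto simp: prenecklace_def)
  have p2: "2 * p \<le> l" using pl
  proof -
    obtain j where "l = p * j" using pl by auto
    then have "2 \<le> j" using pl l_pos by (cases j; cases "j - 1") auto
    then show ?thesis using \<open>l = p * j\<close> by simp
  qed
  \<comment> \<open>The least multiple of \<open>p\<close> above \<open>q\<close>. It is less than
    \<open>l\<close> because \<open>2 * q + 2\<close> and \<open>2 * p\<close> are both at most
    \<open>l\<close>.\<close>
  define s where "s = (q div p + 1) * p"
  have s: "q < s" "s \<le> q + p" "p dvd s"
    using p by (auto simp: s_def dividend_less_div_times)
  have sl: "s < l" using s q2 p2 by linarith
  have ds: "d dvd s" using p s dvd_trans by blast
  have yrot: "y ((i + s) mod l) = y i" if "i < l" for i
    using rot_period[OF P pl(1), of s] s that by (simp add: agree_def rot_def)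
  \<comment> \<open>The position \<open>(i + s) mod l\<close> is never \<open>q\<close>. Elsewhere
    \<open>x\<close> is at least \<open>y\<close>: they agree before \<open>q\<close> and at
    prescribed entries, and the free entries of \<open>y\<close> after \<open>q\<close> are
    0.\<close>
  have ge: "y i \<le> x ((i + s) mod l)" if i: "i \<le> q" for i
  proof -
    let ?j = "(i + s) mod l"
    have jl: "?j < l" using l_pos by simp
    have "?j \<noteq> q"
    proof (cases "i + s < l")
      case True then show ?thesis using s by simp
    next
      case False
      then have "?j = i + s - l" using i q sl by (simp add: mod_if)
      then show ?thesis using i sl False by simp
    qed
    then consider "?j < q" | "q < ?j" by linarith
    then have "y ?j \<le> x ?j"
    proof cases
      case 1 then show ?thesis using x by (simp add: agree_def)
    next
      case 2
      show ?thesis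
      proof (cases "?j \<in> Z \<union> U")
        case True then show ?thesis using c x(1) jl unfolding compatible_def sol_def by fastforce
      next
        case False then show ?thesis using holes[OF 2 jl] by simp
      qed
    qed
    then show ?thesis using yrot i q by simp
  qed
  have "\<not> lexless l x (rot l s x)" using x ds by (auto simp: sol_def)
  moreover have "\<not> lexless (Suc q) (rot l s x) x"
  proof
    assume "lexless (Suc q) (rot l s x) x"
    then obtain i where i: "i < Suc q" "rot l s x i < x i" by (auto simp: lexless_def)
    then have "i \<noteq> q" using x by auto
    then show False using i ge[of i] x by (simp add: rot_def agree_def)
  qed
  moreover have "\<not> agree (Suc q) (rot l s x) x"
    using ge[of q] q x by (auto simp: agree_def rot_def)
  moreover have "lexless l x (rot l s x)" if "lexless (Suc q) x (rot l s x)"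
    using that q unfolding lexless_def by (meson Suc_leI less_le_trans)
  ultimately show False using lex_cases by blast
qed

end

section \<open>Backtracking to the latest choice\<close>

context cyclic_word begin

lemma not_lexlessD:
  assumes "\<not> lexless m y x" "\<not> agree m x y"
  obtains i where "i < m" "x i < y i" "\<forall>j<i. x j = y j"
  using assms lex_cases[of m y x] agree_sym unfolding lexless_def by blast

lemma sol_compatible: "sol x \<Longrightarrow> compatible l x"
  by (simp add: sol_def)

lemma agree_rot: "agree l x y \<Longrightarrow> agree l (rot l t x) (rot l t y)"
  using l_pos by (simp add: agree_def rot_def)

text \<open>\<open>m\<close> entries are placed. All entries before \<open>k\<close> are final: \<open>k - 1\<close> is the last entry revised
  from \<open>1\<close> to \<open>0\<close> (\<open>k = 0\<close> if there is none). The latest free entry from \<open>k\<close> on that was set to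
  \<open>1\<close> is \<open>q - 1\<close> (\<open>q = 0\<close> if there is none). \<open>Q\<close> holds of the solutions still sought.\<close>

definition scan ::
  "nat \<Rightarrow> nat \<Rightarrow> nat \<Rightarrow> nat \<Rightarrow> ((nat \<Rightarrow> nat) \<Rightarrow> bool) \<Rightarrow> (nat \<Rightarrow> nat) \<Rightarrow> bool" where
  "scan m p q k Q y \<longleftrightarrow> m \<le> l \<and> prenecklace m p y \<and> compatible m y \<and>
     k \<le> m \<and> aperiodic k y \<and> (0 < k \<longrightarrow> y (k - 1) = 0) \<and>
     (q \<noteq> 0 \<longrightarrow> k < q \<and> q \<le> m \<and> y (q - 1) = 1 \<and> q - 1 \<notin> Z \<union> U) \<and>
     (\<forall>i. k \<le> i \<and> q \<le> i \<and> i < m \<and> i \<notin> Z \<union> U \<longrightarrow> y i = 0) \<and>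
     (\<forall>x. sol x \<and> strict x \<longrightarrow> Q x) \<and> (\<forall>x. Q x \<longrightarrow> sol x \<and> \<not> lexless m y x)"

text \<open>Used to set a periodic solution aside once it is recorded. Strict solutions must stay in
  \<open>Q\<close> because grafts are strict.\<close>

lemma scan_subset:
  assumes "scan m p q k Q y" "\<And>x. Q' x \<Longrightarrow> Q x" "\<And>x. sol x \<Longrightarrow> strict x \<Longrightarrow> Q' x"
  shows "scan m p q k Q' y"
  using assms unfolding scan_def by blast

lemma scan_bound: "scan m p q k Q y \<Longrightarrow> bound m p y \<le> 1"
  by (rule bound_le1) (auto simp: scan_def prenecklace_def)

text \<open>The new entry is the largest admissible one, so by \<open>sol_le_bound\<close> the
  prefix remains an upper bound for every sought solution.\<close>

lemma scan_step:
  assumes S: "scan m p q k Q y" and m: "m < l"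
    and v: "v \<le> bound m p y" "m \<in> Z \<Longrightarrow> v = 0" "m \<in> U \<Longrightarrow> v = 1"
      "m \<notin> Z \<union> U \<Longrightarrow> v = bound m p y"
  shows "scan (Suc m) (if v < bound m p y then (m div d + 1) * d else p)
           (if m \<notin> Z \<union> U \<and> v = 1 then Suc m else q) k Q (y(m := v))"
    (is "scan _ ?p ?q _ _ ?y")
proof -
  note b = scan_bound[OF S]
  have P: "prenecklace m p y" and comp: "compatible m y" and k: "k \<le> m"
    using S by (auto simp: scan_def)
  have "prenecklace (Suc m) ?p ?y" using step_prenecklace[OF P b v(1)] .
  moreover have "compatible (Suc m) ?y" using comp v b by (auto simp: compatible_def less_Suc_eq)
  moreover have "aperiodic k ?y"
    unfolding aperiodic_def
  proof (intro allI impI)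
    fix t assume "d dvd t \<and> 0 < t \<and> t < k"
    then have "drops k y t" using S by (auto simp: scan_def aperiodic_def)
    then show "drops k ?y t" unfolding drops_def using k by (elim exE, intro exI) auto
  qed
  moreover have "0 < k \<longrightarrow> ?y (k - 1) = 0" using S by (auto simp: scan_def)
  moreover have "?q \<noteq> 0 \<longrightarrow> k < ?q \<and> ?q \<le> Suc m \<and> ?y (?q - 1) = 1 \<and> ?q - 1 \<notin> Z \<union> U"
  proof (cases "m \<notin> Z \<union> U \<and> v = 1")
    case False
    have "q \<noteq> 0 \<longrightarrow> k < q \<and> q \<le> m \<and> y (q - 1) = 1 \<and> q - 1 \<notin> Z \<union> U"
      using S by (simp add: scan_def)
    then show ?thesis unfolding if_not_P[OF False] by auto
  qed (use k in auto)
  moreover have "\<forall>i. k \<le> i \<and> ?q \<le> i \<and> i < Suc m \<and> i \<notin> Z \<union> U \<longrightarrow> ?y i = 0"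
  proof (intro allI impI)
    fix i assume i: "k \<le> i \<and> ?q \<le> i \<and> i < Suc m \<and> i \<notin> Z \<union> U"
    show "?y i = 0"
    proof (cases "i = m")
      case True
      then show ?thesis using i v b by (cases "v = 1") auto
    next
      case False
      have "q \<le> i" using i False by (cases "m \<notin> Z \<union> U \<and> v = 1") auto
      then show ?thesis using S i False by (auto simp: scan_def)
    qed
  qed
  moreover have "\<not> lexless (Suc m) ?y x" if Q: "Q x" for x
  proof
    have x: "sol x" "\<not> lexless m y x" using S Q by (auto simp: scan_def)
    assume "lexless (Suc m) ?y x"
    then obtain i where i: "i < Suc m" "?y i < x i" "\<forall>j<i. ?y j = x j" by (auto simp: lexless_def)
    show False
    proof (cases "i = m")
      case False
      then have "lexless m y x" using i unfolding lexless_def by (intro exI[of _ i]) auto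
      then show False using x by simp
    next
      case True
      then have "agree m x y" using i by (auto simp: agree_def)
      then have "x m \<le> bound m p y" by (rule sol_le_bound[OF P x(1) _ m])
      moreover have "m \<in> Z \<longrightarrow> x m = 0" "x m \<le> 1"
        using sol_compatible[OF x(1)] m unfolding compatible_def by blast+
      moreover have "v < x m" using i True by simp
      ultimately show False using v by (cases "m \<in> Z"; cases "m \<in> U") auto
    qed
  qed
  ultimately show ?thesis using S m unfolding scan_def by simp
qed

lemma scan_conflict:
  assumes S: "scan m p q k Q y" and m: "m < l" "m \<in> U" "bound m p y = 0" and Q: "Q x"
  shows "\<not> agree m x y"
proof
  assume "agree m x y"
  then have "x m \<le> bound m p y" using S Q m by (intro sol_le_bound[of m p y]) (auto simp: scan_def)
  moreover have "compatible l x" using S Q sol_compatible unfolding scan_def by blast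
  then have "x m = 1" using m unfolding compatible_def by blast
  ultimately show False using m by simp
qed

text \<open>The first difference is at a free 1 of \<open>y\<close>. From \<open>k\<close> on such
  entries end at \<open>q - 1\<close>, and entry \<open>k - 1\<close> is already 0.\<close>

lemma scan_branch:
  assumes S: "scan m p q k Q y" and Q: "Q x" "\<not> agree m x y"
  obtains i where "i < m" "x i < y i" "\<forall>j<i. x j = y j" "i < k - 1 \<or> q \<noteq> 0 \<and> i \<le> q - 1"
proof -
  have x: "sol x" "\<not> lexless m y x" using S Q by (auto simp: scan_def)
  then obtain i where i: "i < m" "x i < y i" "\<forall>j<i. x j = y j" using not_lexlessD Q(2) by blast
  have comp: "compatible m y" "m \<le> l" using S by (auto simp: scan_def)
  have "i \<notin> Z \<union> U"
  proof
    assume "i \<in> Z \<union> U"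
    moreover have "i < l" using comp i by simp
    ultimately have "x i = y i" using comp(1) sol_compatible[OF x(1)] i(1)
      unfolding compatible_def by (metis Un_iff)
    then show False using i by simp
  qed
  moreover have "y i \<noteq> 0" using i by simp
  ultimately have "\<not> (k \<le> i \<and> q \<le> i)" using S i unfolding scan_def by auto
  moreover have "i \<noteq> k - 1" if "0 < k" using S i that unfolding scan_def by auto
  ultimately have "i < k - 1 \<or> q \<noteq> 0 \<and> i \<le> q - 1" by linarith
  then show thesis using that i by blast
qed

text \<open>Every remaining solution falls below \<open>y\<close> at \<open>q - 1\<close> or
  earlier, so the prefix with that entry lowered still bounds them all.\<close>

lemma scan_restart:
  assumes S: "scan m p q k Q y" and q: "q \<noteq> 0" and dead: "\<And>x. Q x \<Longrightarrow> \<not> agree m x y"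
  shows "scan q (((q - 1) div d + 1) * d) 0 q Q (y(q - 1 := 0))" (is "scan _ ?p _ _ _ ?y")
proof -
  have P: "prenecklace m p y" and y: "q - 1 < m" "y (q - 1) = 1" "k \<le> q - 1" "q - 1 \<notin> Z \<union> U"
    using S q by (auto simp: scan_def)
  have sq: "Suc (q - 1) = q" using q by simp
  have "prenecklace q ?p ?y" using lower_prenecklace[OF P y(1,2)] sq by simp
  moreover have "aperiodic q ?y" using lower_aperiodic[OF P y(1,2)] sq by simp
  moreover have "compatible q ?y" using S y by (auto simp: scan_def compatible_def)
  moreover have "\<not> lexless q ?y x" if Q: "Q x" for x
  proof -
    obtain i where i: "i < m" "x i < y i" "\<forall>j<i. x j = y j" "i < k - 1 \<or> q \<noteq> 0 \<and> i \<le> q - 1"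
      using scan_branch[OF S Q dead[OF Q]] by blast
    have iq: "i \<le> q - 1" using i(4) y(3) by linarith
    show ?thesis
    proof (cases "i = q - 1")
      case True
      then have "?y j = x j" if "j < q" for j using that i(2,3) y(2) by (cases "j = i") auto
      then have "agree q ?y x" unfolding agree_def by blast
      then show ?thesis using lexless_not_agree by blast
    next
      case False
      then have "lexless q x ?y" unfolding lexless_def using i iq q by (intro exI[of _ i]) auto
      then show ?thesis using lexless_asym by blast
    qed
  qed
  ultimately show ?thesis using S y q unfolding scan_def by auto
qed

text \<open>A solution branching before \<open>k - 1\<close> can be grafted onto the prefix ending
  there. The graft is strict, hence still sought, yet it agrees with \<open>y\<close> before
  \<open>k\<close> and so cannot branch where \<open>scan_branch\<close> requires.\<close>

lemma scan_exhausted: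
  assumes S: "scan m p 0 k Q y" and dead: "\<And>x. Q x \<Longrightarrow> \<not> agree m x y"
  shows "\<not> Q x"
proof
  assume Q: "Q x"
  then obtain i where i: "i < m" "x i < y i" "\<forall>j<i. x j = y j" "i < k - 1"
    using scan_branch[OF S Q dead[OF Q]] by blast
  let ?z = "\<lambda>i. if i \<le> k - 1 then y i else x i"
  have k: "0 < k" "k \<le> m" "m \<le> l" "aperiodic (Suc (k - 1)) y" "compatible m y"
    using S i by (auto simp: scan_def)
  have x: "sol x" using S Q by (auto simp: scan_def)
  have "strict ?z" using i k by (intro graft_strict[OF x k(4), of i]) auto
  moreover have "compatible l ?z" using sol_compatible[OF x] k(1-3,5) unfolding compatible_def by auto
  ultimately have "Q ?z" using S strict_sol unfolding scan_def by blast
  moreover obtain j where "?z j < y j" "j < k - 1"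
    using scan_branch[OF S calculation dead[OF calculation]] by blast
  ultimately show False by simp
qed

text \<open>Once a periodic solution \<open>x1\<close> of period \<open>r\<close> has been met, the search goes on for a strict
  one; any solution met after that is strict.\<close>

definition recorded :: "nat \<Rightarrow> nat \<Rightarrow> ((nat \<Rightarrow> nat) \<Rightarrow> bool) \<Rightarrow> (nat \<Rightarrow> nat) \<Rightarrow> bool" where
  "recorded r k Q y \<longleftrightarrow> (r = 0 \<and> Q = sol) \<or>
     (0 < r \<and> r < l \<and> r dvd l \<and> d dvd r \<and>
      (\<exists>x1. sol x1 \<and> (\<forall>t. d dvd t \<longrightarrow> (agree l (rot l t x1) x1 \<longleftrightarrow> r dvd t)) \<and>
            Q = (\<lambda>x. sol x \<and> \<not> agree l x x1)) \<and>
      (\<forall>x. sol x \<longrightarrow> agree k x y \<longrightarrow> strict x))"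

definition search_inv :: "nat \<Rightarrow> nat \<Rightarrow> nat \<Rightarrow> nat \<Rightarrow> nat \<Rightarrow> (nat \<Rightarrow> nat) \<Rightarrow> bool" where
  "search_inv m p q k r y \<longleftrightarrow> (\<exists>Q. scan m p q k Q y \<and> recorded r k Q y)"

text \<open>Zero codes infeasibility. Otherwise \<open>r\<close> generates the least stabiliser of a
  solution; \<open>r = l\<close> means that a strict solution exists.\<close>

definition search_result :: "nat \<Rightarrow> bool" where
  "search_result r \<longleftrightarrow>
     (if r = 0 then \<forall>x. \<not> sol x
      else r dvd l \<and> d dvd r \<and>
        (\<exists>x. sol x \<and> (\<forall>t. d dvd t \<longrightarrow> (agree l (rot l t x) x \<longleftrightarrow> r dvd t))) \<and>
        (\<forall>x t. sol x \<longrightarrow> r dvd t \<longrightarrow> agree l (rot l t x) x))"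

lemma search_inv_init: "search_inv 0 d 0 0 0 y"
proof -
  have "drops 0 y t" if "d dvd t" "0 < t" "t < d" for t
    using that by (meson dvd_imp_le leD)
  then have "scan 0 d 0 0 sol y"
    unfolding scan_def prenecklace_def compatible_def aperiodic_def lexless_def using d_pos by auto
  then show ?thesis unfolding search_inv_def recorded_def by blast
qed

lemma search_inv_step:
  assumes S: "search_inv m p q k r y" and m: "m < l"
    and v: "v \<le> bound m p y" "m \<in> Z \<Longrightarrow> v = 0" "m \<in> U \<Longrightarrow> v = 1"
      "m \<notin> Z \<union> U \<Longrightarrow> v = bound m p y"
  shows "search_inv (Suc m) (if v < bound m p y then (m div d + 1) * d else p)
           (if m \<notin> Z \<union> U \<and> v = 1 then Suc m else q) k r (y(m := v))"
proof -
  obtain Q where Q: "scan m p q k Q y" "recorded r k Q y" using S by (auto simp: search_inv_def)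
  then have "k \<le> m" by (simp add: scan_def)
  then have "agree k x (y(m := v)) \<longleftrightarrow> agree k x y" for x by (auto simp: agree_def)
  then have "recorded r k Q (y(m := v))" using Q(2) by (simp add: recorded_def)
  then show ?thesis using scan_step[OF Q(1) m v] unfolding search_inv_def by blast
qed

lemma search_success:
  assumes S: "search_inv l l q k r y"
  shows "search_result l"
proof -
  have y: "prenecklace l l y" "compatible l y" using S by (auto simp: search_inv_def scan_def)
  have "agree l (rot l t x) x" if "l dvd t" for t x
    using that rot_mod[of t x] by (auto simp: agree_def rot_def)
  then show ?thesis
    using full_necklace(1,2)[OF y dvd_refl] l_pos d_dvd unfolding search_result_def by auto
qed

text \<open>With nothing left to seek, a recorded solution is the only one on the first
  \<open>l\<close> letters, so its period speaks for all.\<close>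

lemma recorded_result:
  assumes "recorded r k Q y" "\<And>x. \<not> Q x"
  shows "search_result r"
proof (cases "r = 0")
  case True
  then show ?thesis using assms by (auto simp: recorded_def search_result_def)
next
  case False
  then obtain x1 where x1: "sol x1" "\<forall>t. d dvd t \<longrightarrow> (agree l (rot l t x1) x1 \<longleftrightarrow> r dvd t)"
      "Q = (\<lambda>x. sol x \<and> \<not> agree l x x1)" and r: "r dvd l" "d dvd r"
    using assms(1) unfolding recorded_def by blast
  have "agree l (rot l t x) x" if x: "sol x" "r dvd t" for x t
  proof -
    have a: "agree l x x1" using assms(2)[of x] x1(3) x by auto
    have "d dvd t" using x(2) r(2) dvd_trans by blast
    then have "agree l (rot l t x1) x1" using x1 x by blast
    then show ?thesis using a agree_rot[OF a, of t] by (auto simp: agree_def)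
  qed
  then show ?thesis using False x1(1,2) r unfolding search_result_def by auto
qed

text \<open>The dead ends are a prescribed 1 above the bound, a completed word whose period does not
  divide \<open>l\<close>, and a periodic solution. The last arises only while \<open>r = 0\<close>,
  because a recorded \<open>r\<close> makes every solution extending the final prefix
  strict.\<close>

lemma search_dead:
  assumes S: "search_inv m p q k r y"
    and dead: "m < l \<and> m \<in> U \<and> bound m p y = 0 \<and> r' = r \<or>
               m = l \<and> p \<noteq> l \<and> r' = (if p dvd l \<and> r = 0 then p else r)"
  shows "q \<noteq> 0 \<Longrightarrow> search_inv q (((q - 1) div d + 1) * d) 0 q r' (y(q - 1 := 0))"
    and "q = 0 \<Longrightarrow> search_result r'"
proof -
  let ?y = "y(q - 1 := 0)"
  obtain Q where Q: "scan m p q k Q y" "recorded r k Q y" using S by (auto simp: search_inv_def)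
  have P: "prenecklace m p y" "compatible m y" "k \<le> m" using Q by (auto simp: scan_def)
  have keep: "recorded r q Q ?y" if "q \<noteq> 0"
  proof -
    have "k \<le> q - 1" using Q(1) that by (auto simp: scan_def)
    then have "agree k x y" if "agree q x ?y" for x using that \<open>q \<noteq> 0\<close> unfolding agree_def by auto
    then show ?thesis using Q(2) unfolding recorded_def by blast
  qed
  have "\<exists>Q'. scan m p q k Q' y \<and> (\<forall>x. Q' x \<longrightarrow> \<not> agree m x y) \<and>
          (q \<noteq> 0 \<longrightarrow> recorded r' q Q' ?y) \<and> (q = 0 \<longrightarrow> (\<forall>x. \<not> Q' x) \<longrightarrow> search_result r')"
  proof (cases "m < l")
    case True
    then have "\<not> agree m x y" if "Q x" for x using scan_conflict[OF Q(1)] dead that by blast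
    then show ?thesis using True dead Q keep recorded_result[OF Q(2)] by auto
  next
    case False
    then have m: "m = l" "p \<noteq> l" "r' = (if p dvd l \<and> r = 0 then p else r)" using dead by auto
    note P = P[unfolded m(1)]
    show ?thesis
    proof (cases "p dvd l")
      case False
      have "\<not> agree m x y" if "Q x" for x
        using broken_necklace[OF P(1) False] that Q(1) m unfolding scan_def by blast
      then show ?thesis using False m Q keep recorded_result[OF Q(2)] by auto
    next
      case pl: True
      have p: "d dvd p" "0 < p" "p < l" using P pl l_pos m by (auto simp: prenecklace_def dest: dvd_imp_le)
      note y = full_necklace[OF P(1,2) pl]
      have nstrict: "\<not> strict y"
      proof
        assume "strict y"
        then have "lexless l (rot l p y) y" using p unfolding strict_def by simp
        then show False using y(2)[OF p(1)] lexless_not_agree by simp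
      qed
      show ?thesis
      proof (cases "r = 0")
        case False
        then have "strict y" using Q(2) y(1) by (auto simp: recorded_def agree_def)
        then show ?thesis using nstrict by simp
      next
        case True
        then have Qs: "Q = sol" using Q(2) by (auto simp: recorded_def)
        let ?Q = "\<lambda>x. sol x \<and> \<not> agree l x y"
        have str: "sol x \<Longrightarrow> strict x \<Longrightarrow> ?Q x" for x
        proof -
          assume x: "sol x" "strict x"
          have "\<not> agree l x y"
          proof
            assume a: "agree l x y"
            have "agree l (rot l p x) x"
              using agree_rot[OF a, of p] a y(2)[of p] p by (auto simp: agree_def)
            moreover have "lexless l (rot l p x) x" using x(2) p unfolding strict_def by simp
            ultimately show False using lexless_not_agree by blast
          qed
          then show "?Q x" using x by simp
        qed
        have sc: "scan m p q k ?Q y" by (rule scan_subset[OF Q(1)]) (use str Qs in auto)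
        have rp: "r' = p" using m pl True by simp
        have rec: "recorded p q ?Q ?y" if q: "q \<noteq> 0"
        proof -
          have q1: "q - 1 < l" "y (q - 1) = 1" "k \<le> q - 1"
            using Q(1) q m by (auto simp: scan_def)
          have holes: "y i = 0" if "q - 1 < i" "i < l" "i \<notin> Z \<union> U" for i
            using Q(1) that q1 m unfolding scan_def by auto
          have "strict x" if "sol x" "agree q x ?y" for x
          proof (rule other_sol_strict[OF P(1,2) pl p(3) q1(1,2) holes that(1)])
            show "agree (q - 1) x y" using that(2) by (auto simp: agree_def)
            show "x (q - 1) = 0" using that(2) q by (auto simp: agree_def)
          qed
          moreover have "\<exists>x1. sol x1 \<and> (\<forall>t. d dvd t \<longrightarrow> (agree l (rot l t x1) x1 \<longleftrightarrow> p dvd t)) \<and>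
              ?Q = (\<lambda>x. sol x \<and> \<not> agree l x x1)"
            by (intro exI[of _ y] conjI y(1) allI impI y(2) refl)
          ultimately show ?thesis using p pl unfolding recorded_def by simp
        qed
        have res: "search_result p" if "\<forall>x. \<not> ?Q x"
        proof -
          have "agree l (rot l t x) x" if x: "sol x" "p dvd t" for x t
          proof -
            have a: "agree l x y" using \<open>\<forall>x. \<not> ?Q x\<close> x by auto
            have "d dvd t" using x(2) p(1) dvd_trans by blast
            then have "agree l (rot l t y) y" using y(2) x by blast
            then show ?thesis using agree_rot[OF a, of t] a by (auto simp: agree_def)
          qed
          moreover have "\<exists>x. sol x \<and> (\<forall>t. d dvd t \<longrightarrow> (agree l (rot l t x) x \<longleftrightarrow> p dvd t))"
            by (intro exI[of _ y] conjI y(1) allI impI y(2))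
          ultimately show ?thesis using p pl unfolding search_result_def by simp
        qed
        show ?thesis
          by (intro exI[of _ ?Q] conjI sc) (use rec res rp m in simp_all)
      qed
    qed
  qed
  then obtain Q' where Q': "scan m p q k Q' y" "\<forall>x. Q' x \<longrightarrow> \<not> agree m x y"
    "q \<noteq> 0 \<longrightarrow> recorded r' q Q' ?y" "q = 0 \<longrightarrow> (\<forall>x. \<not> Q' x) \<longrightarrow> search_result r'" by blast
  show "q \<noteq> 0 \<Longrightarrow> search_inv q (((q - 1) div d + 1) * d) 0 q r' ?y"
    using scan_restart[OF Q'(1)] Q' unfolding search_inv_def by blast
  show "search_result r'" if "q = 0"
    using scan_exhausted[of m p k Q' y] Q' that by blast
qed

end

section \<open>Timed weakest preconditions\<close>

text \<open>Syntactic write sets provide the frame, so that loop invariants mention only what the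
  body changes.\<close>

fun wregs :: "com \<Rightarrow> vname list" where
  "wregs (Assign x e) = [x]"
| "wregs (Seq c1 c2) = wregs c1 @ wregs c2"
| "wregs (If b c1 c2) = wregs c1 @ wregs c2"
| "wregs (While b c) = wregs c"
| "wregs _ = []"

fun warrs :: "com \<Rightarrow> vname list" where
  "warrs (Store a i e) = [a]"
| "warrs (Seq c1 c2) = warrs c1 @ warrs c2"
| "warrs (If b c1 c2) = warrs c1 @ warrs c2"
| "warrs (While b c) = warrs c"
| "warrs _ = []"

definition unchanged :: "com \<Rightarrow> state \<Rightarrow> state \<Rightarrow> bool" where
  "unchanged c s s' \<longleftrightarrow> (\<forall>x. x \<notin> set (wregs c) \<longrightarrow> reg s' x = reg s x) \<and>
     (\<forall>a. a \<notin> set (warrs c) \<longrightarrow> arr s' a = arr s a)"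

lemma unchangedD:
  assumes "unchanged c s s'"
  shows "x \<notin> set (wregs c) \<Longrightarrow> reg s' x = reg s x" "a \<notin> set (warrs c) \<Longrightarrow> arr s' a = arr s a"
  using assms by (auto simp: unchanged_def)

lemma unchanged_refl [simp]: "unchanged c s s"
  by (simp add: unchanged_def)

lemma unchanged_trans: "unchanged c s s' \<Longrightarrow> unchanged c s' s'' \<Longrightarrow> unchanged c s s''"
  by (simp add: unchanged_def)

lemma exec_unchanged: "exec W c s t s' \<Longrightarrow> unchanged c s s'"
  by (induction rule: exec.induct) (auto simp: unchanged_def)

text \<open>Total correctness: a run exists, by determinism the only one, and with it comes the
  guarantee that every number fits the word.\<close>

definition wp :: "nat \<Rightarrow> com \<Rightarrow> (nat \<Rightarrow> state \<Rightarrow> bool) \<Rightarrow> state \<Rightarrow> bool" where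
  "wp W c Q s \<longleftrightarrow> (\<exists>t s'. exec W c s t s' \<and> Q t s')"

lemma wp_mono: "wp W c Q s \<Longrightarrow> (\<And>t s'. Q t s' \<Longrightarrow> unchanged c s s' \<Longrightarrow> R t s') \<Longrightarrow> wp W c R s"
  unfolding wp_def using exec_unchanged by blast

lemma wp_Skip: "wp W Skip Q s \<longleftrightarrow> Q 1 s"
  unfolding wp_def by (metis exec.Skip exec_SkipE)

lemma wp_Assign: "wp W (Assign x e) Q s \<longleftrightarrow>
    afits W e s \<and> Q (acost e + 1) (s\<lparr>reg := (reg s)(x := aval e s)\<rparr>)"
  unfolding wp_def by (metis exec.Assign exec_AssignE)

lemma wp_Store: "wp W (Store a i e) Q s \<longleftrightarrow> afits W i s \<and> afits W e s \<and>
    Q (acost i + acost e + 1) (s\<lparr>arr := (arr s)(a := (arr s a)(aval i s := aval e s))\<rparr>)"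
  unfolding wp_def by (metis exec.Store exec_StoreE)

lemma wp_Seq: "wp W (Seq c1 c2) Q s \<longleftrightarrow> wp W c1 (\<lambda>t1. wp W c2 (\<lambda>t2. Q (t1 + t2))) s"
  unfolding wp_def by (metis (no_types, lifting) exec.Seq exec_SeqE)

lemma wp_If: "wp W (If b c1 c2) Q s \<longleftrightarrow> bfits W b s \<and>
    (if bval b s then wp W c1 (\<lambda>t. Q (bcost b + 1 + t)) s else wp W c2 (\<lambda>t. Q (bcost b + 1 + t)) s)"
proof -
  have "(\<exists>t s'. exec W (If b c1 c2) s t s' \<and> Q t s') \<longleftrightarrow>
      bfits W b s \<and> (\<exists>t s'. exec W (if bval b s then c1 else c2) s t s' \<and> Q (Suc (bcost b + t)) s')"
    (is "?L \<longleftrightarrow> ?R")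
  proof
    assume ?L
    then obtain t s' where e: "exec W (If b c1 c2) s t s'" and Q: "Q t s'" by blast
    from e show ?R by (rule exec_IfE) (use Q in auto)
  next
    assume ?R
    then obtain t s' where "bfits W b s" "exec W (if bval b s then c1 else c2) s t s'"
      and Q: "Q (Suc (bcost b + t)) s'" by blast
    then have "exec W (If b c1 c2) s (Suc (bcost b + t)) s'"
      using exec.IfTrue[of W b s c1 t s' c2] exec.IfFalse[of W b s c2 t s' c1]
      by (cases "bval b s") simp_all
    then show ?L using Q by blast
  qed
  then show ?thesis unfolding wp_def by (cases "bval b s") simp_all
qed

text \<open>The potential \<open>\<Phi>\<close> pays for the running time and thereby also proves termination.\<close>

lemma wp_While:
  assumes step: "\<And>s. I s \<Longrightarrow> unchanged c s0 s \<Longrightarrow> bfits W b s \<and>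
      (bval b s \<longrightarrow> wp W c (\<lambda>t s'. I s' \<and> \<Phi> s' + t + bcost b + 1 \<le> \<Phi> s) s)"
    and I: "I s0"
  shows "wp W (While b c) (\<lambda>t s'. I s' \<and> \<not> bval b s' \<and> t + \<Phi> s' \<le> \<Phi> s0 + bcost b + 1) s0"
proof -
  have "\<exists>t s'. exec W (While b c) s t s' \<and> I s' \<and> \<not> bval b s' \<and> t + \<Phi> s' \<le> \<Phi> s + bcost b + 1"
    if "I s" "unchanged c s0 s" for s
    using that
  proof (induction "\<Phi> s" arbitrary: s rule: less_induct)
    case less
    show ?case
    proof (cases "bval b s")
      case False
      then show ?thesis using step[OF less.prems] less.prems exec.WhileFalse[of W b s c] by force
    next
      case True
      with step[OF less.prems] obtain t s1 where
        s1: "exec W c s t s1" "I s1" "\<Phi> s1 + t + bcost b + 1 \<le> \<Phi> s" and fits: "bfits W b s"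
        unfolding wp_def by blast
      have "unchanged c s0 s1" using less.prems(2) exec_unchanged[OF s1(1)] by (rule unchanged_trans)
      moreover have "\<Phi> s1 < \<Phi> s" using s1 by simp
      ultimately obtain t2 s2 where s2: "exec W (While b c) s1 t2 s2" "I s2" "\<not> bval b s2"
          "t2 + \<Phi> s2 \<le> \<Phi> s1 + bcost b + 1"
        using less.hyps s1 by blast
      then show ?thesis using exec.WhileTrue[OF fits True s1(1) s2(1)] s1 by fastforce
    qed
  qed
  from this[OF I unchanged_refl] show ?thesis unfolding wp_def .
qed

lemma wp_WhileI:
  assumes "I s0"
    and "\<And>s. I s \<Longrightarrow> unchanged c s0 s \<Longrightarrow> bfits W b s"
    and "\<And>s. I s \<Longrightarrow> unchanged c s0 s \<Longrightarrow> bval b s \<Longrightarrow>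
      wp W c (\<lambda>t s'. I s' \<and> \<Phi> s' + t + bcost b + 1 \<le> \<Phi> s) s"
    and "\<And>t s. I s \<Longrightarrow> \<not> bval b s \<Longrightarrow> unchanged c s0 s \<Longrightarrow> t + \<Phi> s \<le> \<Phi> s0 + bcost b + 1 \<Longrightarrow> Q t s"
  shows "wp W (While b c) Q s0"
proof (rule wp_mono)
  show "wp W (While b c) (\<lambda>t s'. I s' \<and> \<not> bval b s' \<and> t + \<Phi> s' \<le> \<Phi> s0 + bcost b + 1) s0"
    by (rule wp_While) (use assms in auto)
next
  fix t s' assume "I s' \<and> \<not> bval b s' \<and> t + \<Phi> s' \<le> \<Phi> s0 + bcost b + 1" "unchanged (While b c) s0 s'"
  then show "Q t s'" using assms(4)[of s' t] by (auto simp: unchanged_def)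
qed

lemmas wp_simps = wp_Skip wp_Assign wp_Store wp_Seq wp_If

section \<open>The search program\<close>

abbreviation plus_exp (infixl "[+]" 65) where "e1 [+] e2 \<equiv> Bin Add e1 e2"
abbreviation minus_exp (infixl "[-]" 65) where "e1 [-] e2 \<equiv> Bin Sub e1 e2"
abbreviation times_exp (infixl "[*]" 70) where "e1 [*] e2 \<equiv> Bin Mul e1 e2"
abbreviation div_exp (infixl "[div]" 70) where "e1 [div] e2 \<equiv> Bin IDiv e1 e2"
abbreviation mod_exp (infixl "[mod]" 70) where "e1 [mod] e2 \<equiv> Bin IMod e1 e2"
notation Seq (infixr ";;" 60)
notation Assign ("(_ ::= _)" [1000, 61] 61)

lemma wp_assoc: "wp W ((c1 ;; c2) ;; c3) Q s = wp W (c1 ;; c2 ;; c3) Q s"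
proof -
  have "wp W (c2 ;; c3) Q' = wp W c2 (\<lambda>t1. wp W c3 (\<lambda>t2. Q' (t1 + t2)))" for Q'
    by (rule ext) (rule wp_Seq)
  then show ?thesis by (simp add: wp_Seq add.assoc)
qed

lemma wp_If_Seq: "wp W (If b c1 c2 ;; c3) Q s \<longleftrightarrow>
    bfits W b s \<and> wp W ((if bval b s then c1 else c2) ;; c3) (\<lambda>t. Q (bcost b + 1 + t)) s"
  by (simp add: wp_Seq wp_If add.assoc)

lemma wp_bind:
  assumes "wp W c1 R s" "\<And>t s'. R t s' \<Longrightarrow> unchanged c1 s s' \<Longrightarrow> wp W c2 (\<lambda>t2. Q (t + t2)) s'"
  shows "wp W (c1 ;; c2) Q s"
  unfolding wp_Seq by (rule wp_mono[OF assms(1)]) (rule assms(2))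

text \<open>Registers: \<open>a\<close> and \<open>c\<close> are the first and last point of the current interval, \<open>l\<close> its length, \<open>e\<close>
  the rotation by which the generator acts on it; \<open>d\<close>, \<open>m\<close>, \<open>p\<close>, \<open>q\<close>, \<open>k\<close>, \<open>r\<close> are as in the
  invariants of the scan; \<open>h\<close> signals a dead end and \<open>f\<close> the end of the search; \<open>b\<close> is the bound on
  the next entry and \<open>v\<close> its value. The array \<open>y\<close> is indexed from \<open>0\<close>, the inputs from \<open>1\<close>.\<close>

definition scan_place :: com where
  "scan_place =
     If (BAnd (Eq (Cell ''I1'' (V ''a'' [+] V ''m'')) (N 1)) (Eq (V ''b'') (N 0)))
       (''h'' ::= N 1)
       (If (Eq (Cell ''I0'' (V ''a'' [+] V ''m'')) (N 1)) (''v'' ::= N 0)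
          (If (Eq (Cell ''I1'' (V ''a'' [+] V ''m'')) (N 1)) (''v'' ::= N 1)
             (''v'' ::= V ''b'' ;; If (Eq (V ''b'') (N 1)) (''q'' ::= V ''m'' [+] N 1) Skip)) ;;
        Store ''y'' (V ''m'') (V ''v'') ;;
        If (Less (V ''v'') (V ''b''))
          (''p'' ::= (V ''m'' [div] V ''d'' [+] N 1) [*] V ''d'') Skip ;;
        ''m'' ::= V ''m'' [+] N 1)"

definition scan_letter :: com where
  "scan_letter =
     (''b'' ::= N 1 ;;
      If (Less (V ''m'') (V ''p'')) Skip (''b'' ::= Cell ''y'' (V ''m'' [-] V ''p''))) ;;
     scan_place"

text \<open>A strict solution overrides a recorded period by \<open>r = l\<close>. Any other
  completed word is a dead end, and its period is kept only if it belongs to the first solution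
  met.\<close>

definition scan_end :: com where
  "scan_end =
     If (Eq (V ''p'') (V ''l'')) (''r'' ::= V ''l'' ;; ''f'' ::= N 1)
       (''h'' ::= N 1 ;;
        If (BAnd (Eq (V ''l'' [mod] V ''p'') (N 0)) (Eq (V ''r'') (N 0))) (''r'' ::= V ''p'') Skip)"

text \<open>Lowering entry \<open>q - 1\<close> makes everything up to it final, so the choice point
  is cleared; it is cleared last because the other assignments read it.\<close>

definition scan_backtrack :: com where
  "scan_backtrack =
     If (Eq (V ''q'') (N 0)) (''f'' ::= N 1)
       (''m'' ::= V ''q'' ;; ''k'' ::= V ''q'' ;;
        ''p'' ::= ((V ''q'' [-] N 1) [div] V ''d'' [+] N 1) [*] V ''d'' ;;
        Store ''y'' (V ''q'' [-] N 1) (N 0) ;; ''q'' ::= N 0)"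

definition search_body :: com where
  "search_body =
     ''h'' ::= N 0 ;;
     If (Less (V ''m'') (V ''l'')) scan_letter scan_end ;;
     If (Eq (V ''h'') (N 1)) scan_backtrack Skip"

definition search :: com where
  "search =
     ''m'' ::= N 0 ;; ''p'' ::= V ''d'' ;; ''q'' ::= N 0 ;; ''k'' ::= N 0 ;; ''r'' ::= N 0 ;; ''f'' ::= N 0 ;;
     While (Eq (V ''f'') (N 0)) search_body"

text \<open>A restart raises \<open>k\<close>, and the factor \<open>l + 2\<close> then pays for
  scanning the word again. The constant 110 covers one iteration: 91 for the branch taken, 6 for
  resetting \<open>h\<close> and testing \<open>m < l\<close>, 4 for the loop guard. The last
  summand pays for the final iteration.\<close>

definition pot :: "nat \<Rightarrow> nat \<Rightarrow> nat \<Rightarrow> nat \<Rightarrow> nat" where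
  "pot l k m f = 110 * ((l - k) * (l + 2) + (l - m)) + (if f = 0 then 110 else 0)"

lemma pot_step: "m < l \<Longrightarrow> pot l k (Suc m) f + 110 \<le> pot l k m f"
  by (simp add: pot_def)

lemma pot_finish: "pot l k m 1 + 110 \<le> pot l k m 0"
  by (simp add: pot_def)

lemma pot_restart: assumes "k < q" "q \<le> l" shows "pot l q q f + 110 \<le> pot l k m f"
proof -
  have "l - k = (l - q) + (q - k)" "1 \<le> q - k" using assms by auto
  then have "(l - q) * (l + 2) + (l + 2) \<le> (l - k) * (l + 2)"
    by (metis add_mult_distrib add_left_mono mult_le_mono1 nat_mult_1)
  moreover have "A + (l + 2) \<le> B \<Longrightarrow> 110 * (A + (l - q)) + c + 110 \<le> 110 * (B + (l - m)) + c"
    for A B c :: nat by (rule order_trans[of _ "110 * (A + (l + 2)) + c"]) simp_all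
  ultimately show ?thesis unfolding pot_def by blast
qed

lemma pot_init: "pot l 0 0 0 \<le> 110 * (l * (l + 3) + 1)"
  by (simp add: pot_def algebra_simps)

section \<open>Correctness and cost of the search\<close>

context cyclic_word begin

lemma search_inv_bounds:
  assumes "search_inv m p q k r y"
  shows "m \<le> l" "0 < p" "p \<le> 2 * l" "q \<le> m" "k \<le> m" "q \<noteq> 0 \<Longrightarrow> k < q" "r \<le> l" "bound m p y \<le> 1"
proof -
  obtain Q where Q: "scan m p q k Q y" "recorded r k Q y" using assms by (auto simp: search_inv_def)
  have "d \<le> l" using d_dvd l_pos by (simp add: dvd_imp_le)
  then show "m \<le> l" "0 < p" "p \<le> 2 * l" "q \<le> m" "k \<le> m" "q \<noteq> 0 \<Longrightarrow> k < q"
    using Q(1) by (auto simp: scan_def prenecklace_def)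
  show "r \<le> l" using Q(2) by (auto simp: recorded_def)
  show "bound m p y \<le> 1" by (rule scan_bound[OF Q(1)])
qed

text \<open>The requirement \<open>4 * l + 4 \<le> W\<close> leaves room for \<open>p\<close>, which
  may reach \<open>2 * l\<close>.\<close>

definition search_state :: "nat \<Rightarrow> state \<Rightarrow> bool" where
  "search_state W s \<longleftrightarrow>
     reg s ''l'' = l \<and> reg s ''d'' = d \<and> reg s ''a'' + l \<le> W \<and> 4 * l + 4 \<le> W \<and>
     (\<forall>i<l. arr s ''I0'' (reg s ''a'' + i) = of_bool (i \<in> Z) \<and>
            arr s ''I1'' (reg s ''a'' + i) = of_bool (i \<in> U) \<and> \<not> (i \<in> Z \<and> i \<in> U))"

lemma next_multiple_le: "m \<le> l \<Longrightarrow> (m div d + 1) * d \<le> 2 * l"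
  using next_multiple(2)[of m] d_dvd l_pos dvd_imp_le[of d l] by linarith

lemma search_stateD:
  assumes "search_state W s"
  shows "reg s ''l'' = l" "reg s ''d'' = d" "4 * l + 4 \<le> W" "reg s ''a'' + l \<le> W"
  using assms by (auto simp: search_state_def)

lemma search_state_cong:
  assumes "search_state W s"
    and "\<And>x. x \<in> {''l'', ''d'', ''a''} \<Longrightarrow> reg s' x = reg s x"
    and "\<And>x. x \<in> {''I0'', ''I1''} \<Longrightarrow> arr s' x = arr s x"
  shows "search_state W s'"
proof -
  have eqs: "reg s' ''l'' = reg s ''l''" "reg s' ''d'' = reg s ''d''" "reg s' ''a'' = reg s ''a''"
    "arr s' ''I0'' = arr s ''I0''" "arr s' ''I1'' = arr s ''I1''"
    using assms(2,3) by simp_all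
  show ?thesis using assms(1) unfolding search_state_def eqs .
qed

definition search_ok :: "state \<Rightarrow> bool" where
  "search_ok s \<longleftrightarrow>
     (if reg s ''f'' = 0
      then search_inv (reg s ''m'') (reg s ''p'') (reg s ''q'') (reg s ''k'') (reg s ''r'') (arr s ''y'')
      else reg s ''f'' = 1 \<and> search_result (reg s ''r''))"

definition search_pot :: "state \<Rightarrow> nat" where
  "search_pot s = pot l (reg s ''k'') (reg s ''m'') (reg s ''f'')"

definition searched :: "nat \<Rightarrow> state \<Rightarrow> nat \<Rightarrow> state \<Rightarrow> bool" where
  "searched T s t s' \<longleftrightarrow> t \<le> T \<and> search_ok s' \<and> search_pot s' + 110 \<le> search_pot s"

lemma scan_backtrack_wp:
  assumes st: "search_state W s"
    and f: "reg s ''f'' = 0" and q: "reg s ''q'' = q" "k < q \<or> q = 0" "q \<le> l"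
    and r: "reg s ''r'' = r" and k: "reg s ''k'' = k" and y: "arr s ''y'' = y"
    and dead: "q \<noteq> 0 \<Longrightarrow> search_inv q (((q - 1) div d + 1) * d) 0 q r (y(q - 1 := 0))"
      "q = 0 \<Longrightarrow> search_result r"
  shows "wp W scan_backtrack (searched 40 s) s"
proof (cases "q = 0")
  case True
  then show ?thesis
    using f q r dead pot_finish search_stateD[OF st]
    by (simp add: scan_backtrack_def wp_simps searched_def search_ok_def search_pot_def)
next
  case False
  have "(q - 1) div d \<le> l" using q by (meson diff_le_self div_le_dividend le_trans)
  moreover have "((q - 1) div d + 1) * d \<le> 2 * l" using q by (intro next_multiple_le) simp
  moreover have "search_inv q (((q - 1) div d + 1) * d) 0 q r (y(q - 1 := 0))" using dead False by blast
  moreover have "q - 1 \<le> W" "d \<le> W"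
    using q search_stateD(3)[OF st] d_dvd l_pos dvd_imp_le[of d l] by linarith+
  ultimately show ?thesis
    using False f q r k y pot_restart[of k q l] search_stateD[OF st]
    by (simp add: scan_backtrack_def wp_simps searched_def search_ok_def search_pot_def
          del: One_nat_def mult_Suc add_mult_distrib)
qed

lemma scan_end_wp:
  assumes st: "search_state W s"
    and inv: "search_inv l p q k r y" and m: "reg s ''m'' = l" "reg s ''f'' = 0" "reg s ''h'' = 0"
    and vals: "reg s ''p'' = p" "reg s ''q'' = q" "reg s ''k'' = k" "reg s ''r'' = r" "arr s ''y'' = y"
  shows "wp W (scan_end ;; If (Eq (V ''h'') (N 1)) scan_backtrack Skip) (searched 91 s) s"
proof (cases "p = l")
  case True
  then have "search_result l" using inv search_success by simp
  then show ?thesis using True m vals pot_finish l_pos search_stateD[OF st]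
    by (simp add: scan_end_def wp_simps searched_def search_ok_def search_pot_def)
next
  case False
  note bounds = search_inv_bounds[OF inv]
  define r' where "r' = (if p dvd l \<and> r = 0 then p else r)"
  have dead: "l < l \<and> l \<in> U \<and> bound l p y = 0 \<and> r' = r \<or> l = l \<and> p \<noteq> l \<and> r' = (if p dvd l \<and> r = 0 then p else r)"
    using False by (simp add: r'_def)
  note dead = search_dead[OF inv dead]
  have m1: "l mod p \<le> W" using search_stateD(3)[OF st] mod_less_eq_dividend[of l p] by linarith
  have bt: "wp W scan_backtrack (\<lambda>t s'. t \<le> 40 \<and> search_ok s' \<and> search_pot s' + 110 \<le> search_pot s) s'"
    if "search_state W s'" "reg s' ''m'' = l" "reg s' ''f'' = 0" "reg s' ''q'' = q" "reg s' ''k'' = k"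
       "reg s' ''r'' = r'" "arr s' ''y'' = y" for s'
  proof (rule wp_mono)
    show "wp W scan_backtrack (searched 40 s') s'"
      by (rule scan_backtrack_wp[OF that(1) that(3) that(4) _ _ that(6) that(5) that(7) dead])
         (use bounds in auto)
    show "t \<le> 40 \<and> search_ok s'' \<and> search_pot s'' + 110 \<le> search_pot s" if "searched 40 s' t s''" for t s''
      using that \<open>reg s' ''m'' = l\<close> \<open>reg s' ''f'' = 0\<close> \<open>reg s' ''k'' = k\<close> m vals
      by (simp add: searched_def search_pot_def)
  qed
  show ?thesis
  proof (cases "p dvd l \<and> r = 0")
    case True
    let ?s = "s\<lparr>reg := (reg s)(''h'' := 1, ''r'' := p)\<rparr>"
    have "wp W scan_backtrack (\<lambda>t s'. t \<le> 40 \<and> search_ok s' \<and> search_pot s' + 110 \<le> search_pot s) ?s"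
      by (rule bt, rule search_state_cong[OF st]) (use True m vals in \<open>auto simp: r'_def\<close>)
    then show ?thesis
      using False True bounds m m1 vals search_stateD[OF st]
      by (simp add: scan_end_def wp_simps searched_def del: One_nat_def) (elim wp_mono; simp add: searched_def)
  next
    case F: False
    let ?s = "s\<lparr>reg := (reg s)(''h'' := 1)\<rparr>"
    have "wp W scan_backtrack (\<lambda>t s'. t \<le> 40 \<and> search_ok s' \<and> search_pot s' + 110 \<le> search_pot s) ?s"
      by (rule bt, rule search_state_cong[OF st]) (use F m vals in \<open>auto simp: r'_def\<close>)
    then show ?thesis
      using False F bounds m m1 vals search_stateD[OF st]
      by (cases "p dvd l"; simp add: scan_end_def wp_simps mod_eq_0_iff_dvd del: One_nat_def;
          elim wp_mono; simp add: searched_def)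
  qed
qed

lemma scan_letter_wp:
  assumes st: "search_state W s"
    and inv: "search_inv m p q k r y" and m: "m < l" "reg s ''m'' = m" "reg s ''f'' = 0" "reg s ''h'' = 0"
    and vals: "reg s ''p'' = p" "reg s ''q'' = q" "reg s ''k'' = k" "reg s ''r'' = r" "arr s ''y'' = y"
  shows "wp W (scan_letter ;; If (Eq (V ''h'') (N 1)) scan_backtrack Skip) (searched 91 s) s"
proof -
  note bounds = search_inv_bounds[OF inv]
  note stD = search_stateD[OF st]
  define b where "b = bound m p y"
  have b: "b \<le> 1" "(if m < p then 1 else y (m - p)) = b" using bounds by (auto simp: b_def bound_def)
  have ZU: "arr s ''I0'' (reg s ''a'' + m) = 1 \<longleftrightarrow> m \<in> Z" "arr s ''I1'' (reg s ''a'' + m) = 1 \<longleftrightarrow> m \<in> U"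
    "arr s ''I0'' (reg s ''a'' + m) \<le> 1" "arr s ''I1'' (reg s ''a'' + m) \<le> 1" "m \<in> Z \<Longrightarrow> m \<notin> U"
    using st m by (auto simp: search_state_def)
  let ?s1 = "s\<lparr>reg := (reg s)(''b'' := b)\<rparr>"
  have W1: "1 \<le> W" "m \<le> W" "p \<le> W" "reg s ''a'' + m \<le> W" "b \<le> W" "reg s ''a'' \<le> W" "m + 1 \<le> W" "d \<le> W"
    "m div d \<le> W" "m div d + 1 \<le> W" "(m div d + 1) * d \<le> W"
    using bounds stD m b next_multiple_le[of m] d_dvd l_pos dvd_imp_le[of d l] div_le_dividend[of m d]
    by linarith+
  have key: "wp W (scan_place ;; If (Eq (V ''h'') (N 1)) scan_backtrack Skip)
          (\<lambda>t s'. t \<le> 80 \<and> search_ok s' \<and> search_pot s' + 110 \<le> search_pot s) ?s1"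
  proof (cases "m \<in> U \<and> b = 0")
    case True
    have "m < l \<and> m \<in> U \<and> bound m p y = 0 \<and> r = r \<or> m = l \<and> p \<noteq> l \<and> r = (if p dvd l \<and> r = 0 then p else r)"
      using True m by (simp add: b_def)
    note dead = search_dead[OF inv this]
    let ?s = "s\<lparr>reg := (reg s)(''b'' := b, ''h'' := 1)\<rparr>"
    have st': "search_state W ?s" by (rule search_state_cong[OF st]) auto
    have "wp W scan_backtrack (searched 40 ?s) ?s"
      by (rule scan_backtrack_wp[OF st' _ _ _ _ _ _ _ dead]) (use m vals bounds in auto)
    then have "wp W scan_backtrack (\<lambda>t s'. t \<le> 40 \<and> search_ok s' \<and> search_pot s' + 110 \<le> search_pot s) ?s"
      by (rule wp_mono) (simp add: searched_def search_pot_def)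
    then show ?thesis
      using True m W1 ZU stD vals
      by (simp add: scan_place_def wp_simps del: One_nat_def) (elim wp_mono; simp add: searched_def)
  next
    case False
    define v where "v = (if m \<in> Z then 0 else if m \<in> U then 1 else b)"
    have v: "v \<le> bound m p y" "m \<in> Z \<Longrightarrow> v = 0" "m \<in> U \<Longrightarrow> v = 1" "m \<notin> Z \<union> U \<Longrightarrow> v = bound m p y"
      using False b ZU(5) by (auto simp: v_def b_def[symmetric])
    note step = search_inv_step[OF inv m(1) v, folded b_def]
    have step': "search_ok s'" if "reg s' ''f'' = 0" "reg s' ''m'' = m + 1" "reg s' ''k'' = k" "reg s' ''r'' = r"
      "reg s' ''p'' = (if v < b then (m div d + 1) * d else p)"
      "reg s' ''q'' = (if m \<notin> Z \<union> U \<and> v = 1 then m + 1 else q)"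
      "arr s' ''y'' = y(m := v)" for s'
      using step by (simp only: search_ok_def that simp_thms if_True Suc_eq_plus1)
    have pot': "search_pot s' + 110 \<le> search_pot s"
      if "reg s' ''f'' = 0" "reg s' ''m'' = m + 1" "reg s' ''k'' = k" for s'
      using pot_step[OF m(1)] that vals m by (simp add: search_pot_def)
    have Wv: "v \<le> W" using v b W1 by (simp add: b_def)
    \<comment> \<open>Outside the conflict case only these four runs of the straight-line code
      remain.\<close>
    consider "m \<in> Z" "m \<notin> U" "v = 0" | "m \<notin> Z" "m \<in> U" "v = 1" "b = 1"
      | "m \<notin> Z" "m \<notin> U" "v = b" "b = 0" | "m \<notin> Z" "m \<notin> U" "v = b" "b = 1"
      using False b ZU(5) by (cases "m \<in> Z"; cases "m \<in> U"; cases "b = 0") (auto simp: v_def le_Suc_eq)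
    then show ?thesis
      by cases (use m W1 ZU stD vals Wv False in
        \<open>simp_all add: scan_place_def wp_simps step' pot' del: One_nat_def\<close>)
  qed
  have "y (m - p) = b" if "\<not> m < p" using that b by simp
  moreover have "m < p \<Longrightarrow> b = 1" using b by simp
  moreover have "y (m - p) \<le> W" if "\<not> m < p" using calculation(1)[OF that] W1 by simp
  ultimately have "wp W (''b'' ::= N 1 ;; If (Less (V ''m'') (V ''p'')) Skip (''b'' ::= Cell ''y'' (V ''m'' [-] V ''p'')))
      (\<lambda>t s'. t \<le> 11 \<and> s' = ?s1) s"
    using W1 m vals by (cases "m < p") (simp_all add: wp_simps)
  then have "wp W ((''b'' ::= N 1 ;; If (Less (V ''m'') (V ''p'')) Skip (''b'' ::= Cell ''y'' (V ''m'' [-] V ''p''))) ;;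
      scan_place ;; If (Eq (V ''h'') (N 1)) scan_backtrack Skip) (searched 91 s) s"
  proof (rule wp_bind)
    fix t :: nat and s' assume t: "t \<le> 11 \<and> s' = ?s1"
    show "wp W (scan_place ;; If (Eq (V ''h'') (N 1)) scan_backtrack Skip) (\<lambda>t2. searched 91 s (t + t2)) s'"
      unfolding t[THEN conjunct2] by (rule wp_mono[OF key]) (use t in \<open>simp add: searched_def\<close>)
  qed
  then show ?thesis by (simp only: scan_letter_def wp_assoc)
qed

lemma search_body_wp:
  assumes st: "search_state W s" and ok: "search_ok s" and f: "reg s ''f'' = 0"
  shows "wp W search_body (\<lambda>t s'. search_ok s' \<and> search_pot s' + t + bcost (Eq (V ''f'') (N 0)) + 1 \<le> search_pot s) s"
proof -
  let ?s = "s\<lparr>reg := (reg s)(''h'' := 0)\<rparr>"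
  have st': "search_state W ?s" by (rule search_state_cong[OF st]) auto
  have inv: "search_inv (reg s ''m'') (reg s ''p'') (reg s ''q'') (reg s ''k'') (reg s ''r'') (arr s ''y'')"
    using ok f by (simp add: search_ok_def)
  note stD = search_stateD[OF st] and mb = search_inv_bounds(1)[OF inv]
  have "wp W ((if reg s ''m'' < l then scan_letter else scan_end) ;;
          If (Eq (V ''h'') (N 1)) scan_backtrack Skip) (searched 91 ?s) ?s"
  proof (cases "reg s ''m'' < l")
    case True
    show ?thesis unfolding if_P[OF True]
      by (rule scan_letter_wp[OF st' inv]) (use f True in auto)
  next
    case False
    then have m: "reg s ''m'' = l" using mb by simp
    show ?thesis unfolding if_not_P[OF False]
      by (rule scan_end_wp[OF st' inv[unfolded m]]) (use f m in auto)
  qed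
  from wp_mono[OF this, where R = "\<lambda>t s'. search_ok s' \<and> search_pot s' + (6 + t) + bcost (Eq (V ''f'') (N 0)) + 1 \<le> search_pot s"]
  have "wp W ((if reg s ''m'' < l then scan_letter else scan_end) ;;
          If (Eq (V ''h'') (N 1)) scan_backtrack Skip)
          (\<lambda>t s'. search_ok s' \<and> search_pot s' + (6 + t) + bcost (Eq (V ''f'') (N 0)) + 1 \<le> search_pot s) ?s"
    by (simp add: searched_def search_pot_def)
  moreover have "reg s ''m'' \<le> W" "l \<le> W" using mb stD by linarith+
  ultimately show ?thesis
    unfolding search_body_def wp_Seq[of W "''h'' ::= N 0"] wp_Assign wp_If_Seq
    by (simp add: stD split del: if_split) (elim wp_mono; simp)
qed

lemma search_wp:
  assumes st: "search_state W s"
  shows "wp W search (\<lambda>t s'. search_result (reg s' ''r'') \<and> reg s' ''r'' \<le> l \<and> t \<le> 110 * (l * (l + 3) + 2)) s"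
proof -
  note stD = search_stateD[OF st]
  let ?s = "s\<lparr>reg := (reg s)(''m'' := 0, ''p'' := d, ''q'' := 0, ''k'' := 0, ''r'' := 0, ''f'' := 0)\<rparr>"
  have st': "search_state W ?s" by (rule search_state_cong[OF st]) auto
  \<comment> \<open>The 50 leaves room for the six initial assignments, which cost 12.\<close>
  have "wp W (While (Eq (V ''f'') (N 0)) search_body)
     (\<lambda>t s'. search_result (reg s' ''r'') \<and> reg s' ''r'' \<le> l \<and> 50 + t \<le> 110 * (l * (l + 3) + 2)) ?s"
  proof (rule wp_WhileI[where I = search_ok and \<Phi> = search_pot])
    show "search_ok ?s" by (simp add: search_ok_def search_inv_init)
  next
    fix s' assume "search_ok s'"
    then have "reg s' ''f'' \<le> 1" by (simp add: search_ok_def split: if_splits)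
    then show "bfits W (Eq (V ''f'') (N 0)) s'" using stD by simp
  next
    fix s' assume s': "search_ok s'" "unchanged search_body ?s s'" "bval (Eq (V ''f'') (N 0)) s'"
    have "search_state W s'"
      by (rule search_state_cong[OF st'];
          rule unchangedD[OF s'(2)]) (auto simp: search_body_def scan_letter_def scan_place_def scan_end_def scan_backtrack_def)
    then show "wp W search_body (\<lambda>t s''. search_ok s'' \<and> search_pot s'' + t + bcost (Eq (V ''f'') (N 0)) + 1 \<le> search_pot s') s'"
      using search_body_wp[of W s'] s' by simp
  next
    fix t s' assume s': "search_ok s'" "\<not> bval (Eq (V ''f'') (N 0)) s'" "t + search_pot s' \<le> search_pot ?s + bcost (Eq (V ''f'') (N 0)) + 1"
    then have r: "search_result (reg s' ''r'')" by (simp add: search_ok_def split: if_splits)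
    then have "reg s' ''r'' \<le> l" using l_pos by (auto simp: search_result_def dvd_imp_le split: if_splits)
    then show "search_result (reg s' ''r'') \<and> reg s' ''r'' \<le> l \<and> 50 + t \<le> 110 * (l * (l + 3) + 2)"
      using r s'(3) pot_init[of l] by (simp add: search_pot_def)
  qed
  from wp_mono[OF this] show ?thesis
    unfolding search_def using stD d_dvd l_pos dvd_imp_le[of d l]
    by (simp add: wp_Seq wp_Assign)
qed

end

section \<open>Stabilisers along the blocks\<close>

definition is_block :: "nat \<Rightarrow> (nat \<Rightarrow> nat) \<Rightarrow> nat \<Rightarrow> nat \<Rightarrow> bool" where
  "is_block n \<gamma> a b \<longleftrightarrow> 1 \<le> a \<and> a \<le> b \<and> b \<le> n \<and> \<gamma> b = a \<and> (\<forall>i. a \<le> i \<and> i < b \<longrightarrow> \<gamma> i = Suc i)"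

text \<open>If one block ended inside the other, its last point would go both back to a start and up
  by one.\<close>

lemma is_block_unique:
  assumes "is_block n \<gamma> a b" "is_block n \<gamma> a' b'" "a \<le> k" "k \<le> b" "a' \<le> k" "k \<le> b'"
  shows "a' = a" "b' = b"
proof -
  have "\<not> b < b'" "\<not> b' < b" using assms unfolding is_block_def by (metis le_trans not_less_eq_eq)+
  then show "b' = b" by simp
  then show "a' = a" using assms by (simp add: is_block_def)
qed

text \<open>Bezout: modulo \<open>l\<close>, the shifts \<open>j * e\<close> with \<open>M\<close>
  dividing \<open>j\<close> form the subgroup generated by \<open>gcd l (M * e)\<close>. Hence this
  gcd is all that a block needs to know about \<open>M\<close>.\<close>

lemma multiples_mod:
  fixes l M e t :: nat
  assumes l: "0 < l" and t: "gcd l (M * e) dvd t"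
  obtains j where "M dvd j" "(j * e) mod l = t mod l"
proof (cases "M * e = 0")
  case True
  have "t mod l = 0" using t unfolding True by simp
  then show thesis using that[of 0] by simp
next
  case False
  obtain x where x: "[M * e * x = gcd (M * e) l] (mod l)" using cong_solve_nat by blast
  obtain s where s: "t = gcd l (M * e) * s" using t by auto
  have "[M * e * x * s = gcd (M * e) l * s] (mod l)" using x by (rule cong_scalar_right)
  then have "(M * (x * s) * e) mod l = t mod l" unfolding cong_def s by (simp add: ac_simps gcd.commute)
  then show thesis using that[of "M * (x * s)"] by simp
qed

text \<open>The sets \<open>I0\<close> and \<open>I1\<close> carry no assumption, so the fixing loop
  can instantiate them with modified sets.\<close>

locale block_rotation =
  fixes n L :: nat and \<gamma> g :: "nat \<Rightarrow> nat" and I0 I1 :: "nat set"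
  assumes cover: "1 \<le> k \<Longrightarrow> k \<le> n \<Longrightarrow> \<exists>a b. is_block n \<gamma> a b \<and> a \<le> k \<and> k \<le> b"
    and small: "is_block n \<gamma> a b \<Longrightarrow> b < a + L"
    and rotates: "is_block n \<gamma> a b \<Longrightarrow> \<exists>e\<le>b - a. \<forall>i\<le>b - a. g (a + i) = a + (i + e) mod (Suc b - a)"
begin

abbreviation "block \<equiv> is_block n \<gamma>"

text \<open>The block loop stops at \<open>Suc n\<close>; the starts are the points before which
  only whole blocks lie.\<close>

definition start :: "nat \<Rightarrow> bool" where
  "start a \<longleftrightarrow> a = Suc n \<or> (\<exists>b. block a b)"

lemma iterate:
  assumes B: "block a b" and i: "i \<le> b - a"
  shows "(g ^^ j) (a + i) = a + (i + j * (g a - a)) mod (Suc b - a)" "a \<le> g a" "g a \<le> b"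
proof -
  obtain e where e: "e \<le> b - a" "\<forall>i\<le>b - a. g (a + i) = a + (i + e) mod (Suc b - a)"
    using rotates[OF B] by blast
  have ab: "a \<le> b" using B by (simp add: is_block_def)
  then have "e < Suc b - a" using e by simp
  then have ga: "g a = a + e" using e(2)[rule_format, of 0] by simp
  then show "a \<le> g a" "g a \<le> b" using e ab by auto
  have ge: "g a - a = e" using ga by simp
  show "(g ^^ j) (a + i) = a + (i + j * (g a - a)) mod (Suc b - a)"
    unfolding ge
  proof (induction j)
    case 0 then show ?case using i ab by simp
  next
    case (Suc j)
    let ?l = "Suc b - a"
    have "(i + j * e) mod ?l < ?l" using ab by (intro mod_less_divisor) simp
    then have "(i + j * e) mod ?l \<le> b - a" by simp
    then have "g (a + (i + j * e) mod ?l) = a + ((i + j * e) mod ?l + e) mod ?l" using e by blast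
    also have "((i + j * e) mod ?l + e) mod ?l = (i + Suc j * e) mod ?l"
      by (simp add: mod_simps algebra_simps)
    finally show ?case using Suc by simp
  qed
qed

lemma iterate_block:
  assumes B: "block a b" and k: "a \<le> k" "k \<le> b"
  shows "a \<le> (g ^^ j) k \<and> (g ^^ j) k \<le> b"
proof -
  obtain i where i: "k = a + i" using k le_Suc_ex by blast
  have "(i + j * (g a - a)) mod (Suc b - a) < Suc b - a" using k by (intro mod_less_divisor) simp
  then have "a + (i + j * (g a - a)) mod (Suc b - a) \<le> b" using k by linarith
  then show ?thesis using iterate(1)[OF B, of i j] k i by simp
qed

text \<open>No block straddles a start, so the points below it are permuted among
  themselves.\<close>

lemma iterate_below:
  assumes a: "start a" and k: "1 \<le> k" "k < a"
  shows "1 \<le> (g ^^ j) k \<and> (g ^^ j) k < a"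
proof -
  have "k \<le> n" using a k by (auto simp: start_def is_block_def)
  then obtain a' b' where B: "block a' b'" "a' \<le> k" "k \<le> b'" using cover k by blast
  have "b' < a"
  proof (cases "a = Suc n")
    case True then show ?thesis using B by (auto simp: is_block_def)
  next
    case False
    then obtain b where b: "block a b" using a by (auto simp: start_def)
    show ?thesis
    proof (rule ccontr)
      assume "\<not> b' < a"
      then have "a' = a" using is_block_unique(1)[OF b B(1), of a] B k b by (auto simp: is_block_def)
      then show False using B k by simp
    qed
  qed
  moreover have "1 \<le> a'" using B by (simp add: is_block_def)
  ultimately show ?thesis using iterate_block[OF B, of j] by simp
qed

lemma start_first: "start 1"
proof (cases "n = 0")
  case False
  then obtain a b where "block a b" "a \<le> 1" using cover[of 1] by auto
  then show ?thesis by (auto simp: start_def is_block_def le_Suc_eq)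
next
  case True then show ?thesis unfolding start_def by simp
qed

lemma start_next: assumes B: "block a b" shows "start (Suc b)"
proof (cases "b = n")
  case False
  then have "Suc b \<le> n" using B by (simp add: is_block_def)
  then obtain a' b' where B': "block a' b'" "a' \<le> Suc b" "Suc b \<le> b'" using cover[of "Suc b"] by auto
  have "a' = Suc b"
  proof (rule ccontr)
    assume "a' \<noteq> Suc b"
    then have "b' = b" using is_block_unique(2)[OF B B'(1), of b] B B' by (auto simp: is_block_def)
    then show False using B' by simp
  qed
  then show ?thesis using B' by (auto simp: start_def)
qed (simp add: start_def)

section \<open>Stabilisers of prefixes, measured in exponents of \<open>g\<close>\<close>

definition stable :: "nat \<Rightarrow> (nat \<Rightarrow> nat) \<Rightarrow> nat \<Rightarrow> bool" where
  "stable a y j \<longleftrightarrow> (\<forall>i. 1 \<le> i \<and> i < a \<longrightarrow> y i = y ((g ^^ j) i))"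

text \<open>Lexicographic maximality is phrased through the first difference, with no reference to
  later entries, so that it restricts to prefixes.\<close>

definition feasible :: "nat \<Rightarrow> (nat \<Rightarrow> nat) \<Rightarrow> bool" where
  "feasible a y \<longleftrightarrow>
     (\<forall>k. 1 \<le> k \<and> k < a \<longrightarrow> y k \<le> 1 \<and> (k \<in> I0 \<longrightarrow> y k = 0) \<and> (k \<in> I1 \<longrightarrow> y k = 1)) \<and>
     (\<forall>j k. 1 \<le> k \<and> k < a \<and> stable k y j \<longrightarrow> \<not> y k < y ((g ^^ j) k))"

text \<open>The multiples of \<open>M\<close> are the exponents whose constraints on the next block
  no feasible prefix avoids, and some prefix imposes no others.\<close>

definition minimal_stabiliser :: "nat \<Rightarrow> nat \<Rightarrow> bool" where
  "minimal_stabiliser a M \<longleftrightarrow> (\<exists>y. feasible a y \<and> (\<forall>j. stable a y j \<longleftrightarrow> M dvd j)) \<and>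
     (\<forall>y j. feasible a y \<longrightarrow> M dvd j \<longrightarrow> stable a y j)"

lemma minimal_stabiliser_first: "minimal_stabiliser 1 1"
  by (auto simp: minimal_stabiliser_def feasible_def stable_def)

lemma feasible_mono: "feasible a y \<Longrightarrow> a' \<le> a \<Longrightarrow> feasible a' y"
  by (auto simp: feasible_def)

lemma stable_cong:
  assumes "start a" "\<And>i. 1 \<le> i \<Longrightarrow> i < a \<Longrightarrow> y i = z i" "a' \<le> a"
  shows "stable a' y j \<longleftrightarrow> stable a' z j"
proof -
  have "y i = z i \<and> y ((g ^^ j) i) = z ((g ^^ j) i)" if "1 \<le> i \<and> i < a'" for i
    using that assms iterate_below[OF assms(1), of i j] by simp
  then show ?thesis unfolding stable_def by auto
qed

lemma feasible_cong:
  assumes "start a" "\<And>i. 1 \<le> i \<Longrightarrow> i < a \<Longrightarrow> y i = z i"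
  shows "feasible a y \<longleftrightarrow> feasible a z"
proof -
  have "stable k y j \<longleftrightarrow> stable k z j" if "k < a" for k j
    using that by (intro stable_cong[OF assms]) auto
  moreover have "y ((g ^^ j) k) = z ((g ^^ j) k)" if "1 \<le> k" "k < a" for j k
    using iterate_below[OF assms(1) that, of j] assms(2) by simp
  moreover note assms(2)
  ultimately have "(1 \<le> k \<and> k < a \<and> stable k y j \<longrightarrow> \<not> y k < y ((g ^^ j) k)) \<longleftrightarrow>
      (1 \<le> k \<and> k < a \<and> stable k z j \<longrightarrow> \<not> z k < z ((g ^^ j) k))" for j k
    by auto
  then show ?thesis unfolding feasible_def using assms(2) by simp
qed

section \<open>Appending one block to a prefix\<close>

context
  fixes a b l e :: nat
  assumes B: "block a b" and l: "l = Suc b - a" and e: "e = g a - a"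
begin

abbreviation (input) word :: "(nat \<Rightarrow> nat) \<Rightarrow> nat \<Rightarrow> nat" where
  "word y \<equiv> (\<lambda>i. y (a + i))"

lemma l_pos: "0 < l" and ab: "1 \<le> a" "a \<le> b" "Suc b = a + l"
  using B l by (auto simp: is_block_def)

lemma iterate_word: "i < l \<Longrightarrow> y ((g ^^ j) (a + i)) = rot l (j * e) (word y) i"
  using iterate(1)[OF B, of i j] l e by (simp add: rot_def)

lemma stable_word:
  assumes "m \<le> l"
  shows "stable (a + m) y j \<longleftrightarrow> stable a y j \<and> agree m (word y) (rot l (j * e) (word y))"
proof -
  have "(\<forall>i. 1 \<le> i \<and> i < a + m \<longrightarrow> P i) \<longleftrightarrow> (\<forall>i. 1 \<le> i \<and> i < a \<longrightarrow> P i) \<and> (\<forall>i<m. P (a + i))" for P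
  proof (intro iffI conjI allI impI)
    fix i assume P: "(\<forall>i. 1 \<le> i \<and> i < a \<longrightarrow> P i) \<and> (\<forall>i<m. P (a + i))" and i: "1 \<le> i \<and> i < a + m"
    show "P i"
    proof (cases "i < a")
      case False
      then obtain k where "i = a + k" by (metis le_Suc_ex not_less)
      then show ?thesis using P i by auto
    qed (use P i in auto)
  qed (use ab in auto)
  then have "stable (a + m) y j \<longleftrightarrow> stable a y j \<and> (\<forall>i<m. y (a + i) = y ((g ^^ j) (a + i)))"
    unfolding stable_def .
  then show ?thesis using iterate_word assms by (auto simp: agree_def)
qed

text \<open>A first difference lies before \<open>a\<close>, which concerns the prefix alone, or
  inside the block, which only powers stabilising the prefix can reach.\<close>

lemma feasible_word:
  "feasible (a + l) y \<longleftrightarrow> feasible a y \<and>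
     (\<forall>i<l. y (a + i) \<le> 1 \<and> (a + i \<in> I0 \<longrightarrow> y (a + i) = 0) \<and> (a + i \<in> I1 \<longrightarrow> y (a + i) = 1)) \<and>
     (\<forall>j. stable a y j \<longrightarrow> \<not> lexless l (word y) (rot l (j * e) (word y)))"
    (is "?L \<longleftrightarrow> feasible a y \<and> ?V \<and> ?X")
proof (intro iffI conjI)
  assume F: ?L
  show "feasible a y" using feasible_mono[OF F] by simp
  show ?V using F ab unfolding feasible_def by auto
  show ?X
  proof (intro allI impI notI)
    fix j assume s: "stable a y j" and "lexless l (word y) (rot l (j * e) (word y))"
    then obtain k where k: "k < l" "word y k < rot l (j * e) (word y) k" "\<forall>i<k. word y i = rot l (j * e) (word y) i"
      unfolding lexless_def by blast
    then have "stable (a + k) y j" using stable_word[of k] s by (simp add: agree_def)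
    then show False using F k ab iterate_word[OF k(1), of y j] unfolding feasible_def
      by (metis add_less_cancel_left le_add1 le_trans)
  qed
next
  assume F: "feasible a y \<and> ?V \<and> ?X"
  show ?L
    unfolding feasible_def
  proof (intro conjI allI impI)
    fix k assume k: "1 \<le> k \<and> k < a + l"
    have vals: "y k \<le> 1 \<and> (k \<in> I0 \<longrightarrow> y k = 0) \<and> (k \<in> I1 \<longrightarrow> y k = 1)"
    proof (cases "k < a")
      case True then show ?thesis using F k by (auto simp: feasible_def)
    next
      case False
      then obtain i where "k = a + i" by (metis le_Suc_ex not_less)
      then show ?thesis using F k by auto
    qed
    then show "y k \<le> 1" "k \<in> I0 \<Longrightarrow> y k = 0" "k \<in> I1 \<Longrightarrow> y k = 1" by auto
  next
    fix j k assume k: "1 \<le> k \<and> k < a + l \<and> stable k y j"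
    show "\<not> y k < y ((g ^^ j) k)"
    proof (cases "k < a")
      case True then show ?thesis using F k by (auto simp: feasible_def)
    next
      case False
      then obtain i where i: "k = a + i" by (metis le_Suc_ex not_less)
      then have il: "i < l" using k by simp
      then have st: "stable a y j" "agree i (word y) (rot l (j * e) (word y))"
        using stable_word[of i y j] k i by auto
      then have "\<not> lexless l (word y) (rot l (j * e) (word y))" using F by blast
      then have "\<not> word y i < rot l (j * e) (word y) i"
        using il st(2) unfolding lexless_def agree_def by blast
      then show ?thesis using i iterate_word[OF il, of y j] by simp
    qed
  qed
qed

context
  fixes M d r :: nat
  assumes min: "minimal_stabiliser a M" and d: "d = gcd l (M * e)"
    and r: "cyclic_word.search_result l d {i. a + i \<in> I0} {i. a + i \<in> I1} r"
begin

interpretation cyclic_word l d "{i. a + i \<in> I0}" "{i. a + i \<in> I1}"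
  by unfold_locales (use d l_pos in auto)

lemma shift_multiple: "M dvd j \<Longrightarrow> d dvd j * e"
  unfolding d by (rule dvd_trans[OF gcd_dvd2]) (rule mult_dvd_mono, simp_all)

text \<open>All multiples of \<open>M\<close> stabilise every feasible prefix, and modulo
  \<open>l\<close> their shifts are exactly the multiples of \<open>d\<close>.\<close>

lemma feasible_sol: assumes F: "feasible (Suc b) y" shows "sol (word y)"
  unfolding sol_def
proof (intro conjI allI impI)
  have F: "feasible (a + l) y" using F ab by simp
  then show "compatible l (word y)" using F unfolding feasible_word compatible_def by auto
  fix t assume "d dvd t"
  then obtain j where j: "M dvd j" "(j * e) mod l = t mod l" using multiples_mod[OF l_pos] d by metis
  then have "stable a y j" using min F feasible_word unfolding minimal_stabiliser_def by blast
  then have "\<not> lexless l (word y) (rot l (j * e) (word y))" using F unfolding feasible_word by blast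
  then show "\<not> lexless l (word y) (rot l t (word y))"
    using rot_mod[of "j * e" "word y"] rot_mod[of t "word y"] j by simp
qed

lemma block_infeasible: "r = 0 \<Longrightarrow> \<not> feasible (Suc b) y"
  using feasible_sol r unfolding search_result_def by auto

text \<open>In the extremal case an exponent stabilises the longer prefix iff \<open>M\<close>
  divides it and \<open>r\<close> divides its shift. Gluing a prefix with least stabiliser to such a
  word attains this.\<close>

lemma block_feasible:
  assumes r0: "r \<noteq> 0" and k: "\<And>j. r dvd j * e \<longleftrightarrow> k dvd j"
  shows "minimal_stabiliser (Suc b) (lcm M k)"
  unfolding minimal_stabiliser_def
proof (intro conjI allI impI)
  obtain x where x: "sol x" "\<forall>t. d dvd t \<longrightarrow> (agree l (rot l t x) x \<longleftrightarrow> r dvd t)"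
    and all: "\<forall>x t. sol x \<longrightarrow> r dvd t \<longrightarrow> agree l (rot l t x) x"
    using r r0 unfolding search_result_def by auto
  obtain y0 where y0: "feasible a y0" "\<forall>j. stable a y0 j \<longleftrightarrow> M dvd j"
    using min unfolding minimal_stabiliser_def by blast
  define y where "y = (\<lambda>i. if i < a then y0 i else x (i - a))"
  have sa: "start a" using B by (auto simp: start_def)
  have wy: "word y = x" by (simp add: y_def)
  have ya: "feasible a y" "\<forall>j. stable a y j \<longleftrightarrow> M dvd j"
    using y0 feasible_cong[OF sa, of y y0] stable_cong[OF sa, of y y0] by (auto simp: y_def)
  have vals: "\<forall>i<l. y (a + i) \<le> 1 \<and> (a + i \<in> I0 \<longrightarrow> y (a + i) = 0) \<and> (a + i \<in> I1 \<longrightarrow> y (a + i) = 1)"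
    using sol_compatible[OF x(1)] by (simp add: compatible_def y_def)
  have "\<not> lexless l (word y) (rot l (j * e) (word y))" if "stable a y j" for j
    unfolding wy using x(1) shift_multiple that ya(2) unfolding sol_def by blast
  then have "feasible (a + l) y" unfolding feasible_word using ya vals by blast
  moreover have "stable (a + l) y j \<longleftrightarrow> lcm M k dvd j" for j
  proof -
    have "stable (a + l) y j \<longleftrightarrow> M dvd j \<and> agree l x (rot l (j * e) x)"
      using stable_word[of l y j] ya wy by simp
    also have "\<dots> \<longleftrightarrow> M dvd j \<and> r dvd j * e" 
    proof (cases "M dvd j")
      case True
      have "agree l x (rot l (j * e) x) \<longleftrightarrow> agree l (rot l (j * e) x) x" by (auto simp: agree_def)
      then show ?thesis using x(2)[rule_format, OF shift_multiple[OF True]] by simp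
    qed simp
    finally show ?thesis using k by simp
  qed
  ultimately show "\<exists>y. feasible (Suc b) y \<and> (\<forall>j. stable (Suc b) y j \<longleftrightarrow> lcm M k dvd j)"
    using ab by auto
  show "stable (Suc b) y j" if F: "feasible (Suc b) y" and j: "lcm M k dvd j" for y j
  proof -
    have Mj: "M dvd j" "k dvd j" using j by simp_all
    have "sol (word y)" using feasible_sol[OF F] .
    then have "agree l (rot l (j * e) (word y)) (word y)" using all k Mj by blast
    moreover have "feasible a y" using feasible_mono[OF F] ab by simp
    then have "stable a y j" using min Mj unfolding minimal_stabiliser_def by blast
    ultimately show ?thesis using stable_word[of l y j] ab agree_sym[of l "rot l (j * e) (word y)"] by simp
  qed
qed

end
end

end

section \<open>Monotone and ordered permutations\<close>

text \<open>Natural exponents suffice because \<open>p\<close> has finite order, which makes its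
  inverse a power.\<close>

lemma generate_singleton:
  assumes p: "p permutes {1..n}"
  shows "generate (sym_group n) {p} = {p ^^ j | j. True}"
proof
  have pc: "p \<in> carrier (sym_group n)" using p by (simp add: sym_group_carrier)
  obtain k where k: "p ^^ k = id" "0 < k"
    using permutation_is_nilpotent[OF sym_group_carrier'[OF pc]] by blast
  have "h \<in> {p ^^ j | j. True}" if "h \<in> generate (sym_group n) {p}" for h
    using that
  proof induction
    case one
    have "id = p ^^ 0" by simp
    then show ?case unfolding sym_group_one by blast
  next
    case (incl h)
    then have "h = p ^^ 1" by simp
    then show ?case by blast
  next
    case (inv h)
    have "p \<circ> p ^^ (k - 1) = id" using k by (metis Suc_diff_1 funpow.simps(2))
    then have "inv' p = p ^^ (k - 1)" using permutes_inv_o(2)[OF p] by (metis comp_assoc comp_id fun.map_id id_comp)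
    then show ?case using inv sym_group_inv_equality[OF pc] by auto
  next
    case (eng h1 h2)
    then obtain i j where "h1 = p ^^ i" "h2 = p ^^ j" by blast
    then have "h1 \<circ> h2 = p ^^ (i + j)" by (simp add: funpow_add)
    then show ?case unfolding sym_group_mult by blast
  qed
  then show "generate (sym_group n) {p} \<subseteq> {p ^^ j | j. True}" by blast
  have "p ^^ j \<in> generate (sym_group n) {p}" for j
  proof (induction j)
    case 0
    show ?case using generate.one[of "sym_group n" "{p}"] unfolding sym_group_one funpow.simps(1) .
  next
    case (Suc j)
    have "p \<in> generate (sym_group n) {p}" by (rule generate.incl) simp
    from generate.eng[OF this Suc.IH] show ?case unfolding sym_group_mult funpow.simps(2) .
  qed
  then show "{p ^^ j | j. True} \<subseteq> generate (sym_group n) {p}" by blast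
qed

text \<open>The point \<open>b\<close> can only go down, so it is the one descent and all others go
  up. Then \<open>a\<close> has no preimage but \<open>b\<close>, and inductively the preimage of
  \<open>i\<close> is below \<open>i\<close>, while the points below \<open>i - 1\<close> already
  have other images.\<close>

lemma consecutive_cycle:
  fixes \<zeta> :: "nat \<Rightarrow> nat"
  assumes p: "\<zeta> permutes {a..b}" and ab: "a \<le> b" and moved: "\<And>i. a \<le> i \<Longrightarrow> i \<le> b \<Longrightarrow> \<zeta> i \<noteq> i"
    and mono: "monotone_cycle \<zeta>"
  shows "\<zeta> b = a" and "a \<le> i \<Longrightarrow> i < b \<Longrightarrow> \<zeta> i = Suc i"
proof -
  have inS: "a \<le> \<zeta> i \<and> \<zeta> i \<le> b" if "a \<le> i" "i \<le> b" for i
    using permutes_in_image[OF p, of i] that by simp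
  have "\<zeta> b < b" using inS[of b] moved[of b] ab by simp
  then have up: "i < \<zeta> i" if "a \<le> i" "i < b" for i
    using mono moved[of i] that unfolding monotone_cycle_def by (metis less_imp_le linorder_neqE_nat order_less_irrefl)
  have pre: "\<exists>j. a \<le> j \<and> j \<le> b \<and> \<zeta> j = i" if "a \<le> i" "i \<le> b" for i
  proof -
    have "i \<in> \<zeta> ` {a..b}" using permutes_image[OF p] that by simp
    then show ?thesis by auto
  qed
  show ba: "\<zeta> b = a"
  proof -
    obtain j where "a \<le> j" "j \<le> b" "\<zeta> j = a" using pre[of a] ab by auto
    then show ?thesis using up[of j] by (cases "j = b") auto
  qed
  have "\<zeta> (i - 1) = i" if "a < i" "i \<le> b" for i
    using that
  proof (induction i rule: less_induct)
    case (less i)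
    obtain j where j: "a \<le> j" "j \<le> b" "\<zeta> j = i" using pre[of i] less.prems by auto
    have "j \<noteq> b" using j ba less.prems by auto
    then have "j < i" using up[of j] j by simp
    show ?case
    proof (cases "j = i - 1")
      case False
      then have "\<zeta> (Suc j - 1) = Suc j" using \<open>j < i\<close> j less.prems by (intro less.IH) auto
      then show ?thesis using j \<open>j < i\<close> False by simp
    qed (use j in simp)
  qed
  from this[of "Suc i"] show "a \<le> i \<Longrightarrow> i < b \<Longrightarrow> \<zeta> i = Suc i" by simp
qed

lemma nontrivial_cycle_supp:
  assumes "nontrivial_cycle \<zeta>"
  shows "\<zeta> permutes supp \<zeta>" "finite (supp \<zeta>)"
proof -
  obtain cs where cs: "\<zeta> = cycle_of_list cs" using assms unfolding nontrivial_cycle_def by blast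
  then have p: "\<zeta> permutes set cs" by (simp add: cycle_permutes)
  then show "finite (supp \<zeta>)"
    by (intro finite_subset[of "supp \<zeta>" "set cs"]) (auto simp: supp_def permutes_def)
  show "\<zeta> permutes supp \<zeta>"
    using permutes_superset[OF p, of "supp \<zeta>"] by (auto simp: supp_def)
qed

lemma foldr_disjoint:
  assumes "\<And>\<zeta>. \<zeta> \<in> set \<zeta>s \<Longrightarrow> \<zeta> permutes supp \<zeta>"
    and "\<And>c c'. c < length \<zeta>s \<Longrightarrow> c' < length \<zeta>s \<Longrightarrow> c \<noteq> c' \<Longrightarrow> supp (\<zeta>s ! c) \<inter> supp (\<zeta>s ! c') = {}"
  shows "(c < length \<zeta>s \<longrightarrow> k \<in> supp (\<zeta>s ! c) \<longrightarrow> foldr (\<circ>) \<zeta>s id k = (\<zeta>s ! c) k) \<and>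
    ((\<forall>c<length \<zeta>s. k \<notin> supp (\<zeta>s ! c)) \<longrightarrow> foldr (\<circ>) \<zeta>s id k = k)"
  using assms
proof (induction \<zeta>s arbitrary: c k)
  case Nil then show ?case by simp
next
  case (Cons z zs)
  have dz: "supp z \<inter> supp (zs ! c) = {}" if "c < length zs" for c
    using Cons.prems(2)[of 0 "Suc c"] that by simp
  have dzs: "\<And>c c'. c < length zs \<Longrightarrow> c' < length zs \<Longrightarrow> c \<noteq> c' \<Longrightarrow> supp (zs ! c) \<inter> supp (zs ! c') = {}"
    using Cons.prems(2)[of "Suc _" "Suc _"] by simp
  have IH: "(c < length zs \<longrightarrow> k \<in> supp (zs ! c) \<longrightarrow> foldr (\<circ>) zs id k = (zs ! c) k) \<and>
    ((\<forall>c<length zs. k \<notin> supp (zs ! c)) \<longrightarrow> foldr (\<circ>) zs id k = k)" for c k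
    by (rule Cons.IH) (use Cons.prems(1) dzs in auto)
  have fixed: "z i = i" if "i \<notin> supp z" for i using that by (simp add: supp_def)
  show ?case
  proof (intro conjI impI)
    assume c: "c < length (z # zs)" "k \<in> supp ((z # zs) ! c)"
    show "foldr (\<circ>) (z # zs) id k = ((z # zs) ! c) k"
    proof (cases c)
      case 0
      then have "\<forall>c<length zs. k \<notin> supp (zs ! c)" using c dz by auto
      then show ?thesis using IH 0 by simp
    next
      case (Suc c')
      then have c': "c' < length zs" "k \<in> supp (zs ! c')" using c by auto
      then have "(zs ! c') k \<in> supp (zs ! c')"
        using Cons.prems(1)[of "zs ! c'"] permutes_in_image by fastforce
      then have "(zs ! c') k \<notin> supp z" using dz[OF c'(1)] by auto
      then show ?thesis using IH[of c' k] c' Suc fixed by simp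
    qed
  next
    assume k: "\<forall>c<length (z # zs). k \<notin> supp ((z # zs) ! c)"
    have "k \<notin> supp z" using k[rule_format, of 0] by simp
    moreover have "\<forall>c<length zs. k \<notin> supp (zs ! c)" using k by force
    ultimately show "foldr (\<circ>) (z # zs) id k = k" using IH fixed by simp
  qed
qed

text \<open>The supports cover \<open>{1..n}\<close> and are ordered, so no point of another cycle
  lies between the extremes of one support. Each support is therefore an interval, to which
  \<open>consecutive_cycle\<close> applies.\<close>

lemma valid_instance_blocks:
  assumes V: "valid_instance n \<gamma> \<zeta>s \<Gamma> g I0 I1" and k: "1 \<le> k" "k \<le> n"
  shows "\<exists>a b. is_block n \<gamma> a b \<and> a \<le> k \<and> k \<le> b \<and> b < a + max_cycle_size \<zeta>s"
proof -
  have sg: "supp \<gamma> = {1..n}" and dcf: "disjoint_cycle_factors \<zeta>s \<gamma>"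
    and mono: "\<forall>\<zeta>\<in>set \<zeta>s. monotone_cycle \<zeta>" and ord: "ordered_cycles \<zeta>s"
    using V by (auto simp: valid_instance_def)
  have \<gamma>: "\<gamma> = foldr (\<circ>) \<zeta>s id" and nt: "\<And>\<zeta>. \<zeta> \<in> set \<zeta>s \<Longrightarrow> nontrivial_cycle \<zeta>"
    using dcf by (auto simp: disjoint_cycle_factors_def)
  have fd: "(c < length \<zeta>s \<longrightarrow> k \<in> supp (\<zeta>s ! c) \<longrightarrow> \<gamma> k = (\<zeta>s ! c) k) \<and>
      ((\<forall>c<length \<zeta>s. k \<notin> supp (\<zeta>s ! c)) \<longrightarrow> \<gamma> k = k)" for c k
    unfolding \<gamma> using dcf nontrivial_cycle_supp(1)
    by (intro foldr_disjoint) (auto simp: disjoint_cycle_factors_def)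
  have ex: "\<exists>c<length \<zeta>s. i \<in> supp (\<zeta>s ! c)" if "1 \<le> i" "i \<le> n" for i
    using fd[of _ i] that sg unfolding supp_def by fastforce
  then obtain c where c: "c < length \<zeta>s" "k \<in> supp (\<zeta>s ! c)" using k by blast
  let ?\<zeta> = "\<zeta>s ! c"
  let ?S = "supp ?\<zeta>"
  have z: "?\<zeta> permutes ?S" "finite ?S" using nontrivial_cycle_supp nt c by auto
  define a where "a = Min ?S"
  define b where "b = Max ?S"
  have aS: "a \<in> ?S" "b \<in> ?S" and bds: "\<And>i. i \<in> ?S \<Longrightarrow> a \<le> i \<and> i \<le> b"
    unfolding a_def b_def using c z(2) by (auto intro: Min_in Max_in)
  have Sn: "?S \<subseteq> {1..n}"
  proof
    fix i assume i: "i \<in> ?S"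
    then have "\<gamma> i \<noteq> i" using fd[of c i] c by (auto simp: supp_def)
    then show "i \<in> {1..n}" using sg by (auto simp: supp_def)
  qed
  have S: "?S = {a..b}"
  proof
    show "{a..b} \<subseteq> ?S"
    proof
      fix i assume i: "i \<in> {a..b}"
      then have "1 \<le> i" "i \<le> n" using aS Sn by auto
      then obtain c' where c': "c' < length \<zeta>s" "i \<in> supp (\<zeta>s ! c')" using ex by blast
      consider "c' < c" | "c' = c" | "c < c'" by linarith
      then show "i \<in> ?S"
      proof cases
        case 1
        then have "i < a" using ord c c' aS unfolding ordered_cycles_def by blast
        then show ?thesis using i by simp
      next
        case 3
        then have "b < i" using ord c c' aS unfolding ordered_cycles_def by blast
        then show ?thesis using i by simp
      qed (use c' in simp)
    qed
  qed (use bds in auto)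
  have ab: "a \<le> b" using bds[OF aS(1)] by simp
  have moved: "?\<zeta> i \<noteq> i" if "a \<le> i" "i \<le> b" for i
  proof -
    have "i \<in> ?S" unfolding S using that by simp
    then show ?thesis by (simp add: supp_def)
  qed
  have cc: "?\<zeta> b = a" "\<And>i. a \<le> i \<Longrightarrow> i < b \<Longrightarrow> ?\<zeta> i = Suc i"
  proof -
    have m: "monotone_cycle ?\<zeta>" using mono c(1) by simp
    show "?\<zeta> b = a" by (rule consecutive_cycle(1)[OF z(1)[unfolded S] ab moved m])
    show "?\<zeta> i = Suc i" if "a \<le> i" "i < b" for i
      by (rule consecutive_cycle(2)[OF z(1)[unfolded S] ab moved m that])
  qed
  have eq: "\<gamma> i = ?\<zeta> i" if "a \<le> i" "i \<le> b" for i 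
  proof -
    have "i \<in> ?S" unfolding S using that by simp
    then show ?thesis using fd[of c i] c(1) by blast
  qed
  have blk: "is_block n \<gamma> a b"
    unfolding is_block_def using aS Sn ab cc eq[of b] eq by (auto dest: less_imp_le)
  have "card ?S \<le> max_cycle_size \<zeta>s"
    unfolding max_cycle_size_def using c by (intro Max_ge) auto
  then have "b < a + max_cycle_size \<zeta>s" unfolding S using ab by simp
  then show ?thesis using blk bds[OF c(2)] by blast
qed

lemma valid_instance_block_rotation:
  assumes V: "valid_instance n \<gamma> \<zeta>s \<Gamma> g I0 I1"
  shows "block_rotation n (max_cycle_size \<zeta>s) \<gamma> g"
proof
  fix k assume "1 \<le> k" "k \<le> n"
  then show "\<exists>a b. is_block n \<gamma> a b \<and> a \<le> k \<and> k \<le> b" using valid_instance_blocks[OF V] by blast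
next
  fix a b assume B: "is_block n \<gamma> a b"
  then have "1 \<le> a" "a \<le> n" "a \<le> b" by (auto simp: is_block_def)
  then obtain a' b' where B': "is_block n \<gamma> a' b'" "a' \<le> a" "a \<le> b'" "b' < a' + max_cycle_size \<zeta>s"
    using valid_instance_blocks[OF V, of a] by blast
  then show "b < a + max_cycle_size \<zeta>s"
    using is_block_unique[OF B B'(1), of a] \<open>a \<le> b\<close> by simp
next
  fix a b assume B: "is_block n \<gamma> a b"
  have "g \<in> generate (sym_group n) {\<gamma>}" "\<gamma> permutes {1..n}" using V by (auto simp: valid_instance_def)
  then obtain j where g: "g = \<gamma> ^^ j" using generate_singleton by blast
  let ?l = "Suc b - a"
  have l: "0 < ?l" using B by (simp add: is_block_def)
  \<comment> \<open>On the block \<open>\<gamma>\<close> is the unit rotation, so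
    \<open>g = \<gamma> ^^ j\<close> rotates it by \<open>j\<close>.\<close>
  have pw: "(\<gamma> ^^ j) (a + i) = a + (i + j) mod ?l" if "i \<le> b - a" for i j
  proof (induction j)
    case 0
    have "i < ?l" using that l by linarith
    then show ?case by simp
  next
    case (Suc j)
    let ?r = "(i + j) mod ?l"
    have r: "?r < ?l" using l by simp
    have "\<gamma> (a + ?r) = a + Suc ?r mod ?l"
    proof (cases "a + ?r = b")
      case True
      then have "Suc ?r = ?l" by simp
      then show ?thesis using B True by (simp add: is_block_def)
    next
      case False
      then have "a + ?r < b" using r by linarith
      then have "Suc ?r < ?l" by linarith
      then show ?thesis using B \<open>a + ?r < b\<close> by (simp add: is_block_def)
    qed
    then show ?case using Suc by (simp add: mod_Suc_eq)
  qed
  show "\<exists>e\<le>b - a. \<forall>i\<le>b - a. g (a + i) = a + (i + e) mod ?l"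
  proof (intro exI[of _ "j mod ?l"] conjI allI impI)
    have "j mod ?l < ?l" using l by simp
    then show "j mod ?l \<le> b - a" by linarith
    fix i assume "i \<le> b - a"
    then show "g (a + i) = a + (i + j mod ?l) mod ?l" using pw g by (simp add: mod_add_right_eq)
  qed
qed

section \<open>From real vectors to feasible 0/1 words\<close>

lemma less_fun_perm_act:
  assumes x: "x \<in> binary_vectors n"
  shows "less_fun x (perm_act n h x) \<longleftrightarrow>
    (\<exists>k. 1 \<le> k \<and> k \<le> n \<and> x k < x (inv' h k) \<and> (\<forall>i. 1 \<le> i \<and> i < k \<longrightarrow> x i = x (inv' h i)))"
proof -
  \<comment> \<open>Although \<open>less_fun\<close> compares at all naturals, both vectors are
    \<open>undefined\<close> outside \<open>{1..n}\<close>, so the first difference lies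
    inside.\<close>
  have out: "x i = perm_act n h x i" if "\<not> (1 \<le> i \<and> i \<le> n)" for i
    using x that unfolding binary_vectors_def perm_act_def by (auto simp: PiE_def extensional_def)
  have inn: "perm_act n h x i = x (inv' h i)" if "1 \<le> i" "i \<le> n" for i
    using that by (simp add: perm_act_def)
  show ?thesis
  proof
    assume "less_fun x (perm_act n h x)"
    then obtain k where k: "x k < perm_act n h x k" "\<forall>i<k. x i = perm_act n h x i"
      unfolding less_fun_def by blast
    have "1 \<le> k \<and> k \<le> n" using out[of k] k by fastforce
    then show "\<exists>k. 1 \<le> k \<and> k \<le> n \<and> x k < x (inv' h k) \<and> (\<forall>i. 1 \<le> i \<and> i < k \<longrightarrow> x i = x (inv' h i))"
      using k inn by (intro exI[of _ k]) auto
  next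
    assume "\<exists>k. 1 \<le> k \<and> k \<le> n \<and> x k < x (inv' h k) \<and> (\<forall>i. 1 \<le> i \<and> i < k \<longrightarrow> x i = x (inv' h i))"
    then obtain k where k: "1 \<le> k" "k \<le> n" "x k < x (inv' h k)" "\<forall>i. 1 \<le> i \<and> i < k \<longrightarrow> x i = x (inv' h i)"
      by blast
    have "x i = perm_act n h x i" if "i < k" for i
      using k that inn[of i] out[of i] by (cases "1 \<le> i") auto
    moreover have "x k < perm_act n h x k" using k inn[of k] by simp
    ultimately show "less_fun x (perm_act n h x)" unfolding less_fun_def by blast
  qed
qed

text \<open>The face is given by \<open>J0\<close> and \<open>J1\<close> instead of the sets of the
  instance because the fixing loop tests modified faces.\<close>

lemma X_group_nonempty_iff:
  assumes V: "valid_instance n \<gamma> \<zeta>s \<Gamma> g I0 I1" and J: "J0 \<subseteq> {1..n}" "J1 \<subseteq> {1..n}"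
  shows "X_group n \<Gamma> \<inter> fixing_face n J0 J1 \<noteq> {} \<longleftrightarrow> (\<exists>y. block_rotation.feasible g J0 J1 (Suc n) y)"
proof -
  interpret block_rotation n "max_cycle_size \<zeta>s" \<gamma> g J0 J1
    by (rule valid_instance_block_rotation[OF V])
  have gp: "g permutes {1..n}" and \<Gamma>: "\<Gamma> = generate (sym_group n) {g}" and gr: "subgroup \<Gamma> (sym_group n)"
    using V unfolding valid_instance_def subgroup_def by (auto simp: sym_group_carrier)
  have \<Gamma>j: "\<Gamma> = {g ^^ j | j. True}" using generate_singleton[OF gp] \<Gamma> by simp
  have inv\<Gamma>: "inv' h \<in> \<Gamma>" "inv' (inv' h) = h" if "h \<in> \<Gamma>" for h
  proof -
    have h: "h \<in> carrier (sym_group n)" using gr that by (auto simp: subgroup_def)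
    then show "inv' h \<in> \<Gamma>" using subgroup.m_inv_closed[OF gr that] by simp
    show "inv' (inv' h) = h" using h permutes_inv_inv by (auto simp: sym_group_carrier)
  qed
  have XG: "x \<in> X_group n \<Gamma> \<longleftrightarrow> x \<in> binary_vectors n \<and>
      (\<forall>j k. 1 \<le> k \<and> k \<le> n \<and> (\<forall>i. 1 \<le> i \<and> i < k \<longrightarrow> x i = x ((g ^^ j) i)) \<longrightarrow> \<not> x k < x ((g ^^ j) k))"
    (is "_ \<longleftrightarrow> ?b \<and> (\<forall>j. ?P (g ^^ j))") for x
  proof -
    have "id \<in> \<Gamma>" using generate.one[of "sym_group n" "{g}"] \<Gamma> by (simp add: sym_group_one)
    then have "x \<in> X_group n \<Gamma> \<longleftrightarrow> ?b \<and> (\<forall>h\<in>\<Gamma>. \<not> less_fun x (perm_act n h x))"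
      unfolding X_group_def X_perm_def lex_ge_def by auto
    also have "\<dots> \<longleftrightarrow> ?b \<and> (\<forall>h\<in>\<Gamma>. ?P (inv' h))"
      using less_fun_perm_act by blast
    \<comment> \<open>The action uses inverses, but the group is closed under inversion, so
      quantifying over it absorbs them.\<close>
    also have "\<dots> \<longleftrightarrow> ?b \<and> (\<forall>h\<in>\<Gamma>. ?P h)"
      using inv\<Gamma> by metis
    finally show ?thesis using \<Gamma>j by auto
  qed
  have inr: "1 \<le> (g ^^ j) k \<and> (g ^^ j) k \<le> n" if "1 \<le> k" "k \<le> n" for j k
    using iterate_below[of "Suc n" k j] that by (simp add: start_def)
  show ?thesis
  proof
    assume "X_group n \<Gamma> \<inter> fixing_face n J0 J1 \<noteq> {}"
    then obtain x where x: "x \<in> X_group n \<Gamma>" "x \<in> fixing_face n J0 J1" by blast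
    define y where "y = (\<lambda>i. if x i = 1 then 1 else 0 :: nat)"
    have xy: "x i = real (y i)" if "1 \<le> i" "i \<le> n" for i
      using x(2) that unfolding fixing_face_def binary_vectors_def y_def by (auto simp: PiE_def Pi_def)
    have "y k \<le> 1 \<and> (k \<in> J0 \<longrightarrow> y k = 0) \<and> (k \<in> J1 \<longrightarrow> y k = 1)" for k
      using x(2) by (auto simp: fixing_face_def y_def)
    moreover have "\<not> y k < y ((g ^^ j) k)" if k: "1 \<le> k \<and> k < Suc n \<and> stable k y j" for j k
    proof -
      have "x i = x ((g ^^ j) i)" if "1 \<le> i" "i < k" for i
      proof -
        have "y i = y ((g ^^ j) i)" using k that unfolding stable_def by blast
        then show ?thesis using xy[of i] xy[of "(g ^^ j) i"] inr[of i j] k that by simp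
      qed
      then have "\<not> x k < x ((g ^^ j) k)" using x(1) k unfolding XG by auto
      then show ?thesis using xy[of k] xy[of "(g ^^ j) k"] inr[of k j] k by simp
    qed
    ultimately have "feasible (Suc n) y" unfolding feasible_def by blast
    then show "\<exists>y. feasible (Suc n) y" by blast
  next
    assume "\<exists>y. feasible (Suc n) y"
    then obtain y where y: "feasible (Suc n) y" by blast
    define x where "x = (\<lambda>i\<in>{1..n}. real (y i))"
    have xy: "x i = real (y i)" if "1 \<le> i" "i \<le> n" for i using that by (simp add: x_def)
    have vals: "y k \<le> 1 \<and> (k \<in> J0 \<longrightarrow> y k = 0) \<and> (k \<in> J1 \<longrightarrow> y k = 1)" if "1 \<le> k" "k \<le> n" for k
      using y that unfolding feasible_def by auto
    have "x i \<in> {0, 1}" if "i \<in> {1..n}" for i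
    proof -
      have "y i = 0 \<or> y i = 1" using vals[of i] that by (auto simp: le_Suc_eq)
      then show ?thesis using that by (auto simp: x_def)
    qed
    then have xb: "x \<in> binary_vectors n" unfolding binary_vectors_def by (auto simp: x_def)
    have "x i = 0" if "i \<in> J0" for i using vals[of i] xy[of i] J that by auto
    moreover have "x i = 1" if "i \<in> J1" for i using vals[of i] xy[of i] J that by auto
    ultimately have "x \<in> fixing_face n J0 J1" using xb by (simp add: fixing_face_def)
    moreover have "x \<in> X_group n \<Gamma>"
      unfolding XG
    proof (intro conjI xb allI impI)
      fix j k assume k: "1 \<le> k \<and> k \<le> n \<and> (\<forall>i. 1 \<le> i \<and> i < k \<longrightarrow> x i = x ((g ^^ j) i))"
      have "stable k y j"
        unfolding stable_def
      proof (intro allI impI)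
        fix i assume i: "1 \<le> i \<and> i < k"
        then have "x i = x ((g ^^ j) i)" using k by blast
        then show "y i = y ((g ^^ j) i)" using xy[of i] xy[of "(g ^^ j) i"] inr[of i j] k i by simp
      qed
      then have "\<not> y k < y ((g ^^ j) k)" using y k unfolding feasible_def by auto
      then show "\<not> x k < x ((g ^^ j) k)" using xy[of k] xy[of "(g ^^ j) k"] inr[of k j] k by simp
    qed
    ultimately show "X_group n \<Gamma> \<inter> fixing_face n J0 J1 \<noteq> {}" by blast
  qed
qed

section \<open>Number-theoretic loops\<close>

definition find_end :: com where
  "find_end = ''c'' ::= V ''a'' ;; While (Less (V ''c'') (Cell ''perm'' (V ''c''))) (''c'' ::= V ''c'' [+] N 1)"

text \<open>Finds the least \<open>G\<close> divisible by all flagged divisors of \<open>l\<close>.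
  Counting up keeps every number small; restarting \<open>k\<close> after each increment makes the
  loop quadratic, like the search itself.\<close>

definition flag_gcd :: com where
  "flag_gcd = ''G'' ::= N 1 ;; ''k'' ::= N 1 ;;
     While (BNot (Less (V ''l'') (V ''k'')))
       (If (BAnd (Eq (V ''l'' [mod] V ''k'') (N 0))
              (BAnd (Eq (Cell ''F'' (V ''k'')) (N 1)) (BNot (Eq (V ''G'' [mod] V ''k'') (N 0)))))
          (''G'' ::= V ''G'' [+] N 1 ;; ''k'' ::= N 1)
          (''k'' ::= V ''k'' [+] N 1))"

text \<open>Counting down from \<open>l\<close> meets the greatest common divisor first, in linearly
  many rounds.\<close>

definition shift_gcd :: com where
  "shift_gcd = ''d'' ::= V ''l'' ;;
     While (BNot (BAnd (Eq (V ''l'' [mod] V ''d'') (N 0)) (Eq ((V ''G'' [*] V ''e'') [mod] V ''d'') (N 0))))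
       (''d'' ::= V ''d'' [-] N 1)"

text \<open>The additive order of \<open>e\<close> modulo \<open>r\<close>; it is at most
  \<open>r\<close>, so linearly many rounds suffice.\<close>

definition find_order :: com where
  "find_order = ''o'' ::= N 1 ;;
     While (BNot (Eq ((V ''o'' [*] V ''e'') [mod] V ''r'') (N 0))) (''o'' ::= V ''o'' [+] N 1)"

definition mark_divisors :: com where
  "mark_divisors = ''k'' ::= N 1 ;;
     While (BNot (Less (V ''o'') (V ''k'')))
       (If (Eq (V ''o'' [mod] V ''k'') (N 0)) (Store ''F'' (V ''k'') (N 1)) Skip ;; ''k'' ::= V ''k'' [+] N 1)"

text \<open>The fixing loop repeats the emptiness test in the same memory, where flags of the
  previous run survive.\<close>

definition clear_flags :: com where
  "clear_flags = ''k'' ::= N 1 ;;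
     While (BNot (Less (V ''n'') (V ''k''))) (Store ''F'' (V ''k'') (N 0) ;; ''k'' ::= V ''k'' [+] N 1)"

lemma find_end_wp:
  assumes B: "is_block n \<gamma> a b" and s: "reg s ''a'' = a" "\<forall>i\<in>{a..b}. arr s ''perm'' i = \<gamma> i" and W: "b + 1 \<le> W"
  shows "wp W find_end (\<lambda>t s'. reg s' ''c'' = b \<and> t \<le> 10 * (Suc b - a) + 10) s"
proof -
  have ab: "a \<le> b" "\<gamma> b = a" "\<And>i. a \<le> i \<Longrightarrow> i < b \<Longrightarrow> \<gamma> i = Suc i" using B by (auto simp: is_block_def)
  let ?s = "s\<lparr>reg := (reg s)(''c'' := a)\<rparr>"
  have "wp W (While (Less (V ''c'') (Cell ''perm'' (V ''c''))) (''c'' ::= V ''c'' [+] N 1))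
     (\<lambda>t s'. reg s' ''c'' = b \<and> 2 + t \<le> 10 * (Suc b - a) + 10) ?s"
  proof (rule wp_WhileI[where I = "\<lambda>s. a \<le> reg s ''c'' \<and> reg s ''c'' \<le> b" and \<Phi> = "\<lambda>s. 10 * (b - reg s ''c'')"])
    show "a \<le> reg ?s ''c'' \<and> reg ?s ''c'' \<le> b" using ab by simp
  next
    fix s' assume I: "a \<le> reg s' ''c'' \<and> reg s' ''c'' \<le> b"
      and u: "unchanged (''c'' ::= V ''c'' [+] N 1) ?s s'"
    have perm: "arr s' ''perm'' (reg s' ''c'') = (if reg s' ''c'' = b then a else Suc (reg s' ''c''))"
      using unchangedD(2)[OF u, of "''perm''"] s I ab by auto
    show "bfits W (Less (V ''c'') (Cell ''perm'' (V ''c''))) s'" using perm I W ab by simp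
    {
      assume "bval (Less (V ''c'') (Cell ''perm'' (V ''c''))) s'"
      then have "reg s' ''c'' < b" using perm I ab by (auto split: if_splits)
      then show "wp W (''c'' ::= V ''c'' [+] N 1) (\<lambda>t s''. (a \<le> reg s'' ''c'' \<and> reg s'' ''c'' \<le> b) \<and>
          10 * (b - reg s'' ''c'') + t + bcost (Less (V ''c'') (Cell ''perm'' (V ''c''))) + 1 \<le> 10 * (b - reg s' ''c'')) s'"
        using I W by (simp add: wp_simps)
    }
    {
      fix t assume "\<not> bval (Less (V ''c'') (Cell ''perm'' (V ''c''))) s'"
        and t: "t + 10 * (b - reg s' ''c'') \<le> 10 * (b - reg ?s ''c'') + bcost (Less (V ''c'') (Cell ''perm'' (V ''c''))) + 1"
      then have "reg s' ''c'' = b" using perm I by (auto split: if_splits)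
      then show "reg s' ''c'' = b \<and> 2 + t \<le> 10 * (Suc b - a) + 10" using t ab by simp
    }
  qed
  then show ?thesis using s W ab by (simp add: find_end_def wp_Seq wp_Assign)
qed

text \<open>The flagged numbers represent \<open>M\<close>, the least common multiple of numbers up to \<open>n\<close>, by the
  divisors of those numbers. The second condition holds because \<open>gcd l\<close> distributes over \<open>lcm\<close>.\<close>

definition flags_for :: "nat \<Rightarrow> nat \<Rightarrow> (nat \<Rightarrow> nat) \<Rightarrow> bool" where
  "flags_for n M F \<longleftrightarrow> (\<forall>k. 1 \<le> k \<and> k \<le> n \<longrightarrow> F k \<le> 1 \<and> (F k = 1 \<longrightarrow> k dvd M)) \<and>
     (\<forall>l G. 0 < l \<and> l \<le> n \<and> (\<forall>k. 1 \<le> k \<and> k \<le> l \<and> F k = 1 \<and> k dvd l \<longrightarrow> k dvd G) \<longrightarrow> gcd l M dvd G)"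

lemma flags_for_init: "\<forall>k. 1 \<le> k \<and> k \<le> n \<longrightarrow> F k = 0 \<Longrightarrow> flags_for n 1 F"
  by (simp add: flags_for_def)

text \<open>The divisor \<open>gcd l k\<close> of \<open>k\<close> becomes flagged and is at most
  \<open>l\<close>. So it divides \<open>G\<close>, as does \<open>gcd l M\<close>, and the lcm of
  the two is \<open>gcd l (lcm M k)\<close>.\<close>

lemma flags_for_lcm:
  assumes F: "flags_for n M F" and k: "0 < k" "k \<le> n"
  shows "flags_for n (lcm M k) (\<lambda>i. if 1 \<le> i \<and> i \<le> k \<and> i dvd k then 1 else F i)" (is "flags_for n _ ?F")
  unfolding flags_for_def
proof (intro conjI allI impI)
  fix i assume i: "1 \<le> i \<and> i \<le> n"
  then show "?F i \<le> 1" using F by (auto simp: flags_for_def)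
  show "i dvd lcm M k" if "?F i = 1"
  proof (cases "i dvd k")
    case False
    then have "i dvd M" using that F i unfolding flags_for_def by simp
    then show ?thesis by (rule dvd_lcmI1)
  qed (rule dvd_lcmI2)
next
  fix l G assume l: "0 < l \<and> l \<le> n \<and> (\<forall>k. 1 \<le> k \<and> k \<le> l \<and> ?F k = 1 \<and> k dvd l \<longrightarrow> k dvd G)"
  then have "\<forall>i. 1 \<le> i \<and> i \<le> l \<and> F i = 1 \<and> i dvd l \<longrightarrow> i dvd G" by auto
  then have "gcd l M dvd G" using F l unfolding flags_for_def by blast
  moreover have "gcd l k dvd G"
  proof -
    have "1 \<le> gcd l k" "gcd l k \<le> l" "gcd l k \<le> k" using l k by (simp_all add: Suc_le_eq gcd_le1_nat gcd_le2_nat)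
    then show ?thesis using l by auto
  qed
  ultimately have "lcm (gcd l M) (gcd l k) dvd G" by simp
  then show "gcd l (lcm M k) dvd G" by (simp add: gcd_lcm_distrib)
qed

lemma flag_gcd_wp:
  assumes F: "flags_for n M (arr s ''F'')" and l: "reg s ''l'' = l" "0 < l" "l \<le> n" and W: "2 * l + 2 \<le> W"
  shows "wp W flag_gcd (\<lambda>t s'. reg s' ''G'' = gcd l M \<and> t \<le> 40 * (l * (l + 3) + 3)) s"
proof -
  let ?c = "BNot (Less (V ''l'') (V ''k''))"
  let ?g = "gcd l M"
  let ?F = "arr s ''F''"
  have g: "1 \<le> ?g" "?g \<le> l" using l by (simp_all add: Suc_le_eq gcd_le1_nat)
  have Fk: "?F k \<le> 1" "?F k = 1 \<Longrightarrow> k dvd M" if "1 \<le> k" "k \<le> l" for k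
    using F l that unfolding flags_for_def by auto
  let ?body = "If (BAnd (Eq (V ''l'' [mod] V ''k'') (N 0))
              (BAnd (Eq (Cell ''F'' (V ''k'')) (N 1)) (BNot (Eq (V ''G'' [mod] V ''k'') (N 0)))))
          (''G'' ::= V ''G'' [+] N 1 ;; ''k'' ::= N 1)
          (''k'' ::= V ''k'' [+] N 1)"
  let ?s = "s\<lparr>reg := (reg s)(''G'' := 1, ''k'' := 1)\<rparr>"
  let ?I = "\<lambda>s. 1 \<le> reg s ''G'' \<and> reg s ''G'' \<le> ?g \<and> 1 \<le> reg s ''k'' \<and> reg s ''k'' \<le> l + 1 \<and>
     (\<forall>i. 1 \<le> i \<and> i < reg s ''k'' \<and> ?F i = 1 \<and> i dvd l \<longrightarrow> i dvd reg s ''G'')"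
  let ?\<Phi> = "\<lambda>s. 40 * ((l - reg s ''G'') * (l + 2) + (l + 1 - reg s ''k''))"
  have "wp W (While ?c ?body) (\<lambda>t s'. reg s' ''G'' = ?g \<and> 4 + t \<le> 40 * (l * (l + 3) + 3)) ?s"
  proof (rule wp_WhileI[where I = ?I and \<Phi> = ?\<Phi>])
    show "?I ?s" using g by simp
  next
    fix s' assume I: "?I s'" and u: "unchanged ?body ?s s'"
    have l': "reg s' ''l'' = l" and F': "arr s' ''F'' = ?F"
      using unchangedD[OF u] l by simp_all
    define G where "G = reg s' ''G''"
    define k where "k = reg s' ''k''"
    have Gk: "1 \<le> G" "G \<le> ?g" "1 \<le> k" "k \<le> l + 1"
      and low: "\<And>i. 1 \<le> i \<Longrightarrow> i < k \<Longrightarrow> ?F i = 1 \<Longrightarrow> i dvd l \<Longrightarrow> i dvd G"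
      using I by (auto simp: G_def k_def)
    have regs: "reg s' ''G'' = G" "reg s' ''k'' = k" by (simp_all add: G_def k_def)
    show "bfits W ?c s'" using Gk W l' regs by simp
    {
      assume "bval ?c s'"
      then have kl: "k \<le> l" using l' regs by simp
      have Ws: "l \<le> W" "k \<le> W" "l mod k \<le> W" "G mod k \<le> W" "G \<le> W" "G + 1 \<le> W" "k + 1 \<le> W" "?F k \<le> W" "1 \<le> W"
        using W Gk g kl Fk(1)[of k] mod_less_eq_dividend[of l k] mod_less_eq_dividend[of G k] by linarith+
      show "wp W ?body (\<lambda>t s''. ?I s'' \<and> ?\<Phi> s'' + t + bcost ?c + 1 \<le> ?\<Phi> s') s'"
      proof (cases "k dvd l \<and> ?F k = 1 \<and> \<not> k dvd G")
        case True
        \<comment> \<open>A flagged divisor of \<open>l\<close> divides the gcd, so a failed test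
          shows that \<open>G\<close> has not reached it; this keeps \<open>G\<close> from
          overshooting.\<close>
        then have "k dvd ?g" using Fk(2)[of k] Gk kl by simp
        then have "G \<noteq> ?g" using True by auto
        then have Gg: "G + 1 \<le> ?g" using Gk by simp
        then have "l - G = Suc (l - (G + 1))" using g by simp
        then have "(l - (G + 1)) * (l + 2) + (l + 2) \<le> (l - G) * (l + 2)" by simp
        moreover have "A + (l + 2) \<le> B \<Longrightarrow> 40 * (A + (l + 1 - 1)) + 40 \<le> 40 * (B + c)" for A B c :: nat
          by (rule order_trans[of _ "40 * (A + (l + 2))"]) simp_all
        ultimately have pot: "40 * ((l - (G + 1)) * (l + 2) + (l + 1 - 1)) + 40 \<le> 40 * ((l - G) * (l + 2) + (l + 1 - k))"
          by blast
        show ?thesis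
          using True Ws l' F' regs Gk Gg pot
          by (simp add: wp_simps dvd_imp_mod_0 mod_eq_0_iff_dvd del: mult_Suc_right add_2_eq_Suc')
      next
        case False
        have nb: "\<not> bval (BAnd (Eq (V ''l'' [mod] V ''k'') (N 0))
              (BAnd (Eq (Cell ''F'' (V ''k'')) (N 1)) (BNot (Eq (V ''G'' [mod] V ''k'') (N 0))))) s'"
          using False l' F' regs by (simp add: mod_eq_0_iff_dvd)
        have low': "i dvd G" if "1 \<le> i" "i < k + 1" "?F i = 1" "i dvd l" for i
          using low[of i] False that by (cases "i = k") auto
        have pot: "40 * ((l - G) * (l + 2) + (l + 1 - (k + 1))) + 40 \<le> 40 * ((l - G) * (l + 2) + (l + 1 - k))"
          using kl by simp
        show ?thesis unfolding wp_If if_not_P[OF nb]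
          using Ws l' F' regs Gk kl pot low'
          by (simp add: wp_simps del: mult_Suc_right add_2_eq_Suc')
      qed
    }
    {
      fix t assume "\<not> bval ?c s'" and t: "t + ?\<Phi> s' \<le> ?\<Phi> ?s + bcost ?c + 1"
      then have "k = l + 1" using l' regs Gk by simp
      then have "\<forall>k. 1 \<le> k \<and> k \<le> l \<and> ?F k = 1 \<and> k dvd l \<longrightarrow> k dvd G" using low by simp
      then have "?g dvd G" using F l unfolding flags_for_def by blast
      then have "G = ?g" using Gk by (simp add: dvd_imp_le le_antisym)
      moreover have "?\<Phi> ?s \<le> 40 * (l * (l + 3))"
      proof -
        have "(l - 1) * (l + 2) \<le> l * (l + 2)" by (rule mult_le_mono1) simp
        then have "(l - 1) * (l + 2) + l \<le> l * (l + 2) + l" by simp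
        also have "\<dots> = l * (l + 3)" by (simp add: algebra_simps)
        finally have "40 * ((l - 1) * (l + 2) + l) \<le> 40 * (l * (l + 3))" by (rule mult_le_mono2)
        then show ?thesis by simp
      qed
      ultimately show "reg s' ''G'' = ?g \<and> 4 + t \<le> 40 * (l * (l + 3) + 3)" using t regs by simp
    }
  qed
  then show ?thesis using W l by (simp add: flag_gcd_def wp_Seq wp_Assign)
qed

lemma shift_gcd_wp:
  assumes s: "reg s ''l'' = l" "reg s ''G'' = G" "reg s ''e'' = e" and l: "0 < l" "G \<le> l" "e \<le> l"
    and W: "l * l \<le> W"
  shows "wp W shift_gcd (\<lambda>t s'. reg s' ''d'' = gcd l (G * e) \<and> t \<le> 30 * (l + 1)) s"
proof -
  let ?c = "BNot (BAnd (Eq (V ''l'' [mod] V ''d'') (N 0)) (Eq ((V ''G'' [*] V ''e'') [mod] V ''d'') (N 0)))"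
  let ?g = "gcd l (G * e)"
  let ?s = "s\<lparr>reg := (reg s)(''d'' := l)\<rparr>"
  have g: "1 \<le> ?g" "?g \<le> l" using l by (simp_all add: Suc_le_eq gcd_le1_nat)
  have lW: "l \<le> W" using W l by (metis le_trans le_square)
  have Ge: "G * e \<le> W" using l W by (meson le_trans mult_le_mono)
  have "wp W (While ?c (''d'' ::= V ''d'' [-] N 1)) (\<lambda>t s'. reg s' ''d'' = ?g \<and> 2 + t \<le> 30 * (l + 1)) ?s"
  proof (rule wp_WhileI[where I = "\<lambda>s. ?g \<le> reg s ''d'' \<and> reg s ''d'' \<le> l" and \<Phi> = "\<lambda>s. 30 * (reg s ''d'' - ?g)"])
    show "?g \<le> reg ?s ''d'' \<and> reg ?s ''d'' \<le> l" using g by simp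
  next
    fix s' assume I: "?g \<le> reg s' ''d'' \<and> reg s' ''d'' \<le> l" and u: "unchanged (''d'' ::= V ''d'' [-] N 1) ?s s'"
    have regs: "reg s' ''l'' = l" "reg s' ''G'' = G" "reg s' ''e'' = e"
      using unchangedD(1)[OF u] s by simp_all
    define d where "d = reg s' ''d''"
    have d: "reg s' ''d'' = d" "?g \<le> d" "d \<le> l" "1 \<le> d" using I g by (simp_all add: d_def)
    have ms: "l mod d \<le> W" "(G * e) mod d \<le> W" "G \<le> W" "e \<le> W" "d \<le> W"
      using lW Ge l d mod_less_eq_dividend[of l d] mod_less_eq_dividend[of "G * e" d] by linarith+
    show "bfits W ?c s'" using regs d ms lW Ge by simp
    {
      assume "bval ?c s'"
      then have "\<not> (d dvd l \<and> d dvd G * e)" using regs d by (auto simp: mod_eq_0_iff_dvd)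
      then have "d \<noteq> ?g" by auto
      then have "?g < d" using d by simp
      then show "wp W (''d'' ::= V ''d'' [-] N 1) (\<lambda>t s''. (?g \<le> reg s'' ''d'' \<and> reg s'' ''d'' \<le> l) \<and>
          30 * (reg s'' ''d'' - ?g) + t + bcost ?c + 1 \<le> 30 * (reg s' ''d'' - ?g)) s'"
        using d ms by (simp add: wp_simps; intro conjI; linarith)
    }
    {
      fix t assume "\<not> bval ?c s'" and t: "t + 30 * (reg s' ''d'' - ?g) \<le> 30 * (reg ?s ''d'' - ?g) + bcost ?c + 1"
      then have "d dvd ?g" using regs d by (simp add: mod_eq_0_iff_dvd)
      then have "d = ?g" using d g by (simp add: dvd_imp_le le_antisym)
      then show "reg s' ''d'' = ?g \<and> 2 + t \<le> 30 * (l + 1)" using t d g by simp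
    }
  qed
  then show ?thesis using lW s by (simp add: shift_gcd_def wp_Seq wp_Assign)
qed

lemma find_order_wp:
  assumes s: "reg s ''r'' = r" "reg s ''e'' = e" and r: "0 < r" "r \<le> l" "e \<le> l" and W: "l * l \<le> W" "l + 1 \<le> W"
  shows "wp W find_order (\<lambda>t s'. 0 < reg s' ''o'' \<and> reg s' ''o'' \<le> r \<and>
     (\<forall>j. r dvd j * e \<longleftrightarrow> reg s' ''o'' dvd j) \<and> t \<le> 20 * (l + 1)) s"
proof -
  let ?c = "BNot (Eq ((V ''o'' [*] V ''e'') [mod] V ''r'') (N 0))"
  let ?s = "s\<lparr>reg := (reg s)(''o'' := 1)\<rparr>"
  let ?I = "\<lambda>s. 1 \<le> reg s ''o'' \<and> reg s ''o'' \<le> r \<and> (\<forall>i. 1 \<le> i \<and> i < reg s ''o'' \<longrightarrow> \<not> r dvd i * e)"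
  have "wp W (While ?c (''o'' ::= V ''o'' [+] N 1)) (\<lambda>t s'. 0 < reg s' ''o'' \<and> reg s' ''o'' \<le> r \<and>
     (\<forall>j. r dvd j * e \<longleftrightarrow> reg s' ''o'' dvd j) \<and> 2 + t \<le> 20 * (l + 1)) ?s"
  proof (rule wp_WhileI[where I = ?I and \<Phi> = "\<lambda>s. 20 * (r - reg s ''o'')"])
    show "?I ?s" using r by simp
  next
    fix s' assume I: "?I s'" and u: "unchanged (''o'' ::= V ''o'' [+] N 1) ?s s'"
    have regs: "reg s' ''r'' = r" "reg s' ''e'' = e" using unchangedD(1)[OF u] s by simp_all
    define k where "k = reg s' ''o''"
    have k: "reg s' ''o'' = k" "1 \<le> k" "k \<le> r" "\<And>i. 1 \<le> i \<Longrightarrow> i < k \<Longrightarrow> \<not> r dvd i * e"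
      using I by (simp_all add: k_def)
    have "k * e \<le> l * l" using k r by (intro mult_le_mono) auto
    then have ms: "k * e \<le> W" "(k * e) mod r \<le> W" "k \<le> W" "e \<le> W" "r \<le> W" "k + 1 \<le> W"
      using W k r mod_less_eq_dividend[of "k * e" r] by linarith+
    show "bfits W ?c s'" using regs k ms by simp
    {
      assume "bval ?c s'"
      then have nd: "\<not> r dvd k * e" using regs k by (simp add: mod_eq_0_iff_dvd)
      then have "k < r" using k by (cases "k = r") auto
      moreover have "\<not> r dvd i * e" if "1 \<le> i" "i < Suc k" for i using that k nd by (cases "i = k") auto
      ultimately show "wp W (''o'' ::= V ''o'' [+] N 1) (\<lambda>t s''. ?I s'' \<and>
          20 * (r - reg s'' ''o'') + t + bcost ?c + 1 \<le> 20 * (r - reg s' ''o'')) s'"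
        using k ms by (simp add: wp_simps)
    }
    {
      fix t assume "\<not> bval ?c s'" and t: "t + 20 * (r - reg s' ''o'') \<le> 20 * (r - reg ?s ''o'') + bcost ?c + 1"
      then have rk: "r dvd k * e" using regs k by (simp add: mod_eq_0_iff_dvd)
      have "r dvd j * e \<longleftrightarrow> k dvd j" for j
      proof
        assume rj: "r dvd j * e"
        \<comment> \<open>The remainder \<open>j mod k\<close> is again an exponent with this
          property, so minimality of \<open>k\<close> forces it to be 0.\<close>
        have "j * e = (j div k) * (k * e) + (j mod k) * e"
          by (metis add_mult_distrib div_mult_mod_eq mult.assoc)
        moreover have "r dvd (j div k) * (k * e)" using rk by (rule dvd_mult)
        ultimately have "r dvd (j mod k) * e" using rj by (simp add: dvd_add_right_iff)
        moreover have "j mod k < k" using k by simp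
        ultimately have "j mod k = 0" using k(4)[of "j mod k"] by (cases "j mod k") auto
        then show "k dvd j" by (simp add: mod_eq_0_iff_dvd)
      next
        assume "k dvd j"
        then show "r dvd j * e" using rk by (meson dvd_trans mult_dvd_mono dvd_refl)
      qed
      then show "0 < reg s' ''o'' \<and> reg s' ''o'' \<le> r \<and> (\<forall>j. r dvd j * e \<longleftrightarrow> reg s' ''o'' dvd j) \<and> 2 + t \<le> 20 * (l + 1)"
        using t k r by simp
    }
  qed
  then show ?thesis using W s by (simp add: find_order_def wp_Seq wp_Assign)
qed

lemma mark_divisors_wp:
  assumes s: "reg s ''o'' = k0" "arr s ''F'' = F" and W: "k0 + 1 \<le> W"
  shows "wp W mark_divisors (\<lambda>t s'. arr s' ''F'' = (\<lambda>i. if 1 \<le> i \<and> i \<le> k0 \<and> i dvd k0 then 1 else F i) \<and> t \<le> 30 * (k0 + 1)) s"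
proof -
  let ?c = "BNot (Less (V ''o'') (V ''k''))"
  let ?body = "If (Eq (V ''o'' [mod] V ''k'') (N 0)) (Store ''F'' (V ''k'') (N 1)) Skip ;; ''k'' ::= V ''k'' [+] N 1"
  let ?s = "s\<lparr>reg := (reg s)(''k'' := 1)\<rparr>"
  let ?I = "\<lambda>s. 1 \<le> reg s ''k'' \<and> reg s ''k'' \<le> k0 + 1 \<and>
     arr s ''F'' = (\<lambda>i. if 1 \<le> i \<and> i < reg s ''k'' \<and> i dvd k0 then 1 else F i)"
  have "wp W (While ?c ?body) (\<lambda>t s'. arr s' ''F'' = (\<lambda>i. if 1 \<le> i \<and> i \<le> k0 \<and> i dvd k0 then 1 else F i) \<and> 2 + t \<le> 30 * (k0 + 1)) ?s"
  proof (rule wp_WhileI[where I = ?I and \<Phi> = "\<lambda>s. 25 * (k0 + 1 - reg s ''k'')"])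
    show "?I ?s" using s by auto
  next
    fix s' assume I: "?I s'" and u: "unchanged ?body ?s s'"
    have ro: "reg s' ''o'' = k0" using unchangedD(1)[OF u] s by simp
    define k where "k = reg s' ''k''"
    have k: "reg s' ''k'' = k" "1 \<le> k" "k \<le> k0 + 1" using I by (simp_all add: k_def)
    have F': "arr s' ''F'' = (\<lambda>i. if 1 \<le> i \<and> i < k \<and> i dvd k0 then 1 else F i)" using I k by simp
    show "bfits W ?c s'" using k ro W by simp
    {
      assume "bval ?c s'"
      then have kk: "k \<le> k0" using ro k by simp
      have ms: "k0 mod k \<le> W" "k0 \<le> W" "k \<le> W" "k + 1 \<le> W" "1 \<le> W"
        using W kk mod_less_eq_dividend[of k0 k] by linarith+
      have F1: "(arr s' ''F'')(k := 1) = (\<lambda>i. if 1 \<le> i \<and> i < Suc k \<and> i dvd k0 then 1 else F i)" if "k dvd k0"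
        using that k unfolding F' by (auto simp: fun_eq_iff less_Suc_eq)
      have F2: "arr s' ''F'' = (\<lambda>i. if 1 \<le> i \<and> i < Suc k \<and> i dvd k0 then 1 else F i)" if "\<not> k dvd k0"
        using that k unfolding F' by (auto simp: fun_eq_iff less_Suc_eq)
      show "wp W ?body (\<lambda>t s''. ?I s'' \<and> 25 * (k0 + 1 - reg s'' ''k'') + t + bcost ?c + 1 \<le> 25 * (k0 + 1 - reg s' ''k'')) s'"
      proof (cases "k dvd k0")
        case True
        then show ?thesis using F1[OF True] ms k kk ro by (simp add: wp_simps)
      next
        case False
        then show ?thesis using F2[OF False] ms k kk ro by (simp add: wp_simps mod_eq_0_iff_dvd)
      qed
    }
    {
      fix t assume "\<not> bval ?c s'" and t: "t + 25 * (k0 + 1 - reg s' ''k'') \<le> 25 * (k0 + 1 - reg ?s ''k'') + bcost ?c + 1"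
      then have "k = k0 + 1" using ro k by simp
      then show "arr s' ''F'' = (\<lambda>i. if 1 \<le> i \<and> i \<le> k0 \<and> i dvd k0 then 1 else F i) \<and> 2 + t \<le> 30 * (k0 + 1)"
        using t F' by (simp add: less_Suc_eq_le)
    }
  qed
  then show ?thesis using W by (simp add: mark_divisors_def wp_Seq wp_Assign)
qed

lemma clear_flags_wp:
  assumes s: "reg s ''n'' = n" and W: "n + 1 \<le> W"
  shows "wp W clear_flags (\<lambda>t s'. (\<forall>k. 1 \<le> k \<and> k \<le> n \<longrightarrow> arr s' ''F'' k = 0) \<and> t \<le> 20 * (n + 1)) s"
proof -
  let ?c = "BNot (Less (V ''n'') (V ''k''))"
  let ?body = "Store ''F'' (V ''k'') (N 0) ;; ''k'' ::= V ''k'' [+] N 1"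
  let ?s = "s\<lparr>reg := (reg s)(''k'' := 1)\<rparr>"
  let ?I = "\<lambda>s. 1 \<le> reg s ''k'' \<and> reg s ''k'' \<le> n + 1 \<and> (\<forall>i. 1 \<le> i \<and> i < reg s ''k'' \<longrightarrow> arr s ''F'' i = 0)"
  have "wp W (While ?c ?body) (\<lambda>t s'. (\<forall>k. 1 \<le> k \<and> k \<le> n \<longrightarrow> arr s' ''F'' k = 0) \<and> 2 + t \<le> 20 * (n + 1)) ?s"
  proof (rule wp_WhileI[where I = ?I and \<Phi> = "\<lambda>s. 15 * (n + 1 - reg s ''k'')"])
    show "?I ?s" by simp
  next
    fix s' assume I: "?I s'" and u: "unchanged ?body ?s s'"
    have rn: "reg s' ''n'' = n" using unchangedD(1)[OF u] s by simp
    show "bfits W ?c s'" using I rn W by simp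
    show "wp W ?body (\<lambda>t s''. ?I s'' \<and> 15 * (n + 1 - reg s'' ''k'') + t + bcost ?c + 1 \<le> 15 * (n + 1 - reg s' ''k'')) s'"
      if "bval ?c s'" using that I rn W by (simp add: wp_simps less_Suc_eq)
    show "(\<forall>k. 1 \<le> k \<and> k \<le> n \<longrightarrow> arr s' ''F'' k = 0) \<and> 2 + t \<le> 20 * (n + 1)"
      if "\<not> bval ?c s'" "t + 15 * (n + 1 - reg s' ''k'') \<le> 15 * (n + 1 - reg ?s ''k'') + bcost ?c + 1" for t
      using that I rn by auto
  qed
  then show ?thesis using W by (simp add: clear_flags_def wp_Seq wp_Assign)
qed

section \<open>Deciding emptiness\<close>

text \<open>An infeasible block moves \<open>a\<close> beyond \<open>n\<close> and thereby ends the
  loop.\<close>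

definition block_body :: com where
  "block_body =
     find_end ;;
     (''l'' ::= (V ''c'' [+] N 1) [-] V ''a'' ;; ''e'' ::= Cell ''gen'' (V ''a'') [-] V ''a'') ;;
     flag_gcd ;; shift_gcd ;; search ;;
     If (Eq (V ''r'') (N 0)) (''empty'' ::= N 1 ;; ''a'' ::= V ''n'' [+] N 1)
       (find_order ;; mark_divisors ;; ''a'' ::= V ''c'' [+] N 1)"

definition emptiness :: com where
  "emptiness = ''empty'' ::= N 0 ;; clear_flags ;; ''a'' ::= N 1 ;;
     While (BNot (Less (V ''n'') (V ''a''))) block_body"

section \<open>Write sets of the programs and the encoding of the input\<close>

lemma writes [simp]:
  "set (wregs find_end) = {''c''}" "set (warrs find_end) = {}"
  "set (wregs flag_gcd) = {''G'', ''k''}" "set (warrs flag_gcd) = {}"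
  "set (wregs shift_gcd) = {''d''}" "set (warrs shift_gcd) = {}"
  "set (wregs search) = {''m'', ''p'', ''q'', ''k'', ''r'', ''f'', ''h'', ''b'', ''v''}" "set (warrs search) = {''y''}"
  "set (wregs find_order) = {''o''}" "set (warrs find_order) = {}"
  "set (wregs mark_divisors) = {''k''}" "set (warrs mark_divisors) = {''F''}"
  "set (wregs clear_flags) = {''k''}" "set (warrs clear_flags) = {''F''}"
  by (auto simp: find_end_def flag_gcd_def shift_gcd_def search_def search_body_def scan_letter_def scan_place_def
      scan_end_def scan_backtrack_def find_order_def mark_divisors_def clear_flags_def)

lemma writes_block_body [simp]:
  "set (wregs block_body) = {''l'', ''e'', ''empty'', ''a'', ''c'', ''G'', ''d'', ''o'', ''m'', ''p'', ''q'', ''k'', ''r'', ''f'', ''h'', ''b'', ''v''}"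
  "set (warrs block_body) = {''y'', ''F''}"
  by (auto simp: block_body_def)

lemma writes_emptiness [simp]:
  "set (wregs emptiness) = {''l'', ''e'', ''empty'', ''a'', ''c'', ''G'', ''d'', ''o'', ''m'', ''p'', ''q'', ''k'', ''r'', ''f'', ''h'', ''b'', ''v''}"
  "set (warrs emptiness) = {''y'', ''F''}"
  by (auto simp: emptiness_def)

text \<open>Lets \<open>shift_gcd\<close> work with \<open>gcd l M\<close>, at most
  \<open>l\<close>, where \<open>M\<close> itself might not fit a word.\<close>

lemma gcd_gcd_mult: "gcd l (gcd l M * e) = gcd l (M * e)" for l M e :: nat
proof (rule dvd_antisym)
  have "gcd l (gcd l M * e) dvd gcd l M * e" by (rule gcd_dvd2)
  also have "\<dots> dvd M * e" by (rule mult_dvd_mono) simp_all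
  finally show "gcd l (gcd l M * e) dvd gcd l (M * e)" by simp
  have "gcd l (M * e) dvd e * l" by (rule dvd_mult) simp
  moreover have "gcd l (M * e) dvd e * M" by (metis gcd_dvd2 mult.commute)
  ultimately have "gcd l (M * e) dvd e * gcd l M" unfolding gcd_mult_distrib_nat by (rule gcd_greatest)
  then show "gcd l (M * e) dvd gcd l (gcd l M * e)" by (simp add: mult.commute)
qed

lemma quadratic_bound: "1 \<le> (l::nat) \<Longrightarrow> a * (l * l) + b * l + c \<le> (a + b + c) * (l * l)"
proof -
  assume l: "1 \<le> l"
  then have "1 \<le> l * l" "l \<le> l * l" by simp_all
  then have "b * l \<le> b * (l * l)" "c * 1 \<le> c * (l * l)" by (intro mult_le_mono2; simp)+
  moreover have "(a + b + c) * (l * l) = a * (l * l) + b * (l * l) + c * (l * l)"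
    by (simp only: add_mult_distrib)
  ultimately show ?thesis by linarith
qed

text \<open>Unlike equality with the input state, this survives the writes of the program and holds
  for the sets temporarily modified by the fixing loop. The bound on \<open>W\<close> covers
  products such as \<open>G * e\<close> and \<open>o * e\<close>.\<close>

definition encodes ::
    "nat \<Rightarrow> (nat \<Rightarrow> nat) \<Rightarrow> (nat \<Rightarrow> nat) \<Rightarrow> nat set \<Rightarrow> nat set \<Rightarrow> nat \<Rightarrow> state \<Rightarrow> bool" where
  "encodes n \<gamma> g I0 I1 W s \<longleftrightarrow> reg s ''n'' = n \<and> I0 \<inter> I1 = {} \<and> 10 * ((n + 1) * (n + 1)) \<le> W \<and>
     (\<forall>i\<in>{1..n}. arr s ''perm'' i = \<gamma> i \<and> arr s ''gen'' i = g i \<and>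
        arr s ''I0'' i = of_bool (i \<in> I0) \<and> arr s ''I1'' i = of_bool (i \<in> I1))"

lemma encodes_cong:
  assumes "encodes n \<gamma> g I0 I1 W s" "reg s' ''n'' = reg s ''n''"
    "\<And>x. x \<in> {''perm'', ''gen'', ''I0'', ''I1''} \<Longrightarrow> arr s' x = arr s x"
  shows "encodes n \<gamma> g I0 I1 W s'"
  using assms(1,2) assms(3)[of "''perm''"] assms(3)[of "''gen''"] assms(3)[of "''I0''"] assms(3)[of "''I1''"]
  unfolding encodes_def by simp

lemma encodes_unchanged:
  assumes s: "encodes n \<gamma> g I0 I1 W s" and u: "unchanged c s s'"
    and w: "''n'' \<notin> set (wregs c)" "set (warrs c) \<inter> {''perm'', ''gen'', ''I0'', ''I1''} = {}"
  shows "encodes n \<gamma> g I0 I1 W s'"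
proof (rule encodes_cong[OF s])
  show "reg s' ''n'' = reg s ''n''" using unchangedD(1)[OF u w(1)] .
  show "arr s' x = arr s x" if "x \<in> {''perm'', ''gen'', ''I0'', ''I1''}" for x
    using unchangedD(2)[OF u, of x] w(2) that by blast
qed

section \<open>Correctness and cost of the emptiness test\<close>

context block_rotation begin

definition at_block :: "nat \<Rightarrow> nat \<Rightarrow> nat \<Rightarrow> nat \<Rightarrow> state \<Rightarrow> bool" where
  "at_block W a b M s \<longleftrightarrow> encodes n \<gamma> g I0 I1 W s \<and> reg s ''a'' = a \<and> reg s ''c'' = b \<and> reg s ''l'' = Suc b - a \<and>
     reg s ''e'' = g a - a \<and> reg s ''empty'' = 0 \<and> flags_for n M (arr s ''F'')"

lemma at_block_unchanged:
  assumes s: "at_block W a b M s" and u: "unchanged c s s'"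
    and w: "set (wregs c) \<inter> {''n'', ''a'', ''c'', ''l'', ''e'', ''empty''} = {}"
      "set (warrs c) \<inter> {''perm'', ''gen'', ''I0'', ''I1'', ''F''} = {}"
  shows "at_block W a b M s'"
proof -
  have r: "reg s' x = reg s x" if "x \<in> {''n'', ''a'', ''c'', ''l'', ''e'', ''empty''}" for x
    using unchangedD(1)[OF u, of x] w that by blast
  have a: "arr s' x = arr s x" if "x \<in> {''perm'', ''gen'', ''I0'', ''I1'', ''F''}" for x
    using unchangedD(2)[OF u, of x] w that by blast
  have "encodes n \<gamma> g I0 I1 W s'" by (rule encodes_cong[where s = s]) (use s r a in \<open>auto simp: at_block_def\<close>)
  then show ?thesis using s r a by (simp add: at_block_def)
qed

text \<open>\<open>M\<close> occurs only under an existential quantifier, as memory holds nothing of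
  it but the flags.\<close>

definition progress :: "state \<Rightarrow> bool" where
  "progress s \<longleftrightarrow> (if reg s ''empty'' = 0
     then start (reg s ''a'') \<and> (\<exists>M. minimal_stabiliser (reg s ''a'') M \<and> flags_for n M (arr s ''F''))
     else reg s ''empty'' = 1 \<and> reg s ''a'' = Suc n \<and> (\<forall>y. \<not> feasible (Suc n) y))"

context
  fixes W a b M l e :: nat
  assumes B: "block a b" and min: "minimal_stabiliser a M" and l: "l = Suc b - a" and e: "e = g a - a"
    and W: "10 * ((n + 1) * (n + 1)) \<le> W"
begin

lemma block_bounds: "1 \<le> l" "l \<le> n" "e \<le> l" "1 \<le> a" "a \<le> b" "b \<le> n" "a + l = Suc b" "n + 1 \<le> W" "l * l \<le> W"
    "a + l \<le> W" "4 * l + 4 \<le> W" "n + 2 \<le> W"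
proof -
  show ln: "1 \<le> l" "l \<le> n" "1 \<le> a" "a \<le> b" "b \<le> n" "a + l = Suc b" using B l by (auto simp: is_block_def)
  show "e \<le> l" using iterate(3)[OF B, of 0] e l by simp
  have "l * l \<le> (n + 1) * (n + 1)" using ln by (intro mult_le_mono) auto
  then show "l * l \<le> W" using W by linarith
  have "10 * (n + 1) \<le> 10 * ((n + 1) * (n + 1))" by (intro mult_le_mono2) simp
  then have "10 * n + 10 \<le> W" using W by simp
  then show "n + 1 \<le> W" "a + l \<le> W" "4 * l + 4 \<le> W" "n + 2 \<le> W" using ln by linarith+
qed

lemma block_tail_wp:
  assumes s: "at_block W a b M s"
    and r: "cyclic_word.search_result l (gcd l (M * e)) {i. a + i \<in> I0} {i. a + i \<in> I1} (reg s ''r'')"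
  shows "wp W (If (Eq (V ''r'') (N 0)) (''empty'' ::= N 1 ;; ''a'' ::= V ''n'' [+] N 1)
       (find_order ;; mark_divisors ;; ''a'' ::= V ''c'' [+] N 1))
     (\<lambda>t s'. t \<le> 50 * l + 70 \<and> progress s' \<and> Suc b \<le> reg s' ''a'' \<and> reg s' ''a'' \<le> Suc n) s"
proof -
  interpret cyclic_word l "gcd l (M * e)" "{i. a + i \<in> I0}" "{i. a + i \<in> I1}"
    by unfold_locales (use block_bounds(1) in auto)
  note bb = block_bounds
  have regs: "reg s ''n'' = n" "reg s ''a'' = a" "reg s ''c'' = b" "reg s ''l'' = l" "reg s ''e'' = e" "reg s ''empty'' = 0"
    using s l e by (auto simp: at_block_def encodes_def)
  show ?thesis
  proof (cases "reg s ''r'' = 0")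
    case True
    have "\<not> feasible (Suc n) y" for y
      using block_infeasible[OF B l e min refl r True] feasible_mono[of "Suc n" y "Suc b"] bb by auto
    then show ?thesis using True regs bb by (simp add: wp_simps progress_def)
  next
    case False
    have rl: "reg s ''r'' \<le> l" using r False bb by (auto simp: search_result_def dvd_imp_le)
    have "wp W (find_order ;; mark_divisors ;; ''a'' ::= V ''c'' [+] N 1)
     (\<lambda>t s'. t \<le> 50 * l + 60 \<and> progress s' \<and> reg s' ''a'' = Suc b) s"
    proof (rule wp_bind)
      show "wp W find_order (\<lambda>t s'. 0 < reg s' ''o'' \<and> reg s' ''o'' \<le> reg s ''r'' \<and>
         (\<forall>j. reg s ''r'' dvd j * e \<longleftrightarrow> reg s' ''o'' dvd j) \<and> t \<le> 20 * (l + 1)) s"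
        using regs False rl bb by (intro find_order_wp) auto
    next
      fix t1 s1 assume o: "0 < reg s1 ''o'' \<and> reg s1 ''o'' \<le> reg s ''r'' \<and>
         (\<forall>j. reg s ''r'' dvd j * e \<longleftrightarrow> reg s1 ''o'' dvd j) \<and> t1 \<le> 20 * (l + 1)"
        and u: "unchanged find_order s s1"
      have s1: "at_block W a b M s1" by (rule at_block_unchanged[OF s u]) auto
      define k where "k = reg s1 ''o''"
      have k: "0 < k" "k \<le> l" using o rl by (auto simp: k_def)
      let ?F = "\<lambda>i. if 1 \<le> i \<and> i \<le> k \<and> i dvd k then 1 else arr s1 ''F'' i"
      have fl: "flags_for n (lcm M k) ?F"
        by (rule flags_for_lcm) (use s1 k bb in \<open>auto simp: at_block_def\<close>)
      have ms: "minimal_stabiliser (Suc b) (lcm M k)"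
        by (rule block_feasible[OF B l e min refl r False]) (use o in \<open>auto simp: k_def\<close>)
      show "wp W (mark_divisors ;; ''a'' ::= V ''c'' [+] N 1)
         (\<lambda>t2 s'. t1 + t2 \<le> 50 * l + 60 \<and> progress s' \<and> reg s' ''a'' = Suc b) s1"
      proof (rule wp_bind)
        show "wp W mark_divisors (\<lambda>t s'. arr s' ''F'' = ?F \<and> t \<le> 30 * (k + 1)) s1"
          by (rule mark_divisors_wp) (use k bb in \<open>auto simp: k_def\<close>)
      next
        fix t2 s2 assume F: "arr s2 ''F'' = ?F \<and> t2 \<le> 30 * (k + 1)" and u2: "unchanged mark_divisors s1 s2"
        have "reg s2 ''c'' = b" "reg s2 ''empty'' = 0" using unchangedD(1)[OF u2] s1 by (auto simp: at_block_def)
        moreover have "start (Suc b)" by (rule start_next[OF B])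
        ultimately show "wp W (''a'' ::= V ''c'' [+] N 1)
           (\<lambda>t3 s'. t1 + (t2 + t3) \<le> 50 * l + 60 \<and> progress s' \<and> reg s' ''a'' = Suc b) s2"
          using F fl ms o k bb by (auto simp: wp_simps progress_def)
      qed
    qed
    from wp_mono[OF this] show ?thesis using False regs bb rl by (simp add: wp_If)
  qed
qed

lemma block_body_wp:
  assumes s: "encodes n \<gamma> g I0 I1 W s" "reg s ''a'' = a" "reg s ''empty'' = 0" "flags_for n M (arr s ''F'')"
  shows "wp W block_body (\<lambda>t s'. t \<le> 1200 * (l * l) \<and> progress s' \<and> Suc b \<le> reg s' ''a'' \<and> reg s' ''a'' \<le> Suc n) s"
    (is "wp W _ ?Q s")
  unfolding block_body_def
proof (rule wp_bind)
  note bb = block_bounds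
  have arrs: "arr s ''perm'' i = \<gamma> i" "arr s ''gen'' i = g i" if "1 \<le> i" "i \<le> n" for i
    using s(1) that by (auto simp: encodes_def)
  show "wp W find_end (\<lambda>t s'. reg s' ''c'' = b \<and> t \<le> 10 * (Suc b - a) + 10) s"
    by (rule find_end_wp[OF B]) (use s arrs bb in auto)
  let ?If = "If (Eq (V ''r'') (N 0)) (''empty'' ::= N 1 ;; ''a'' ::= V ''n'' [+] N 1)
       (find_order ;; mark_divisors ;; ''a'' ::= V ''c'' [+] N 1)"
  fix t1 s1 assume c: "reg s1 ''c'' = b \<and> t1 \<le> 10 * (Suc b - a) + 10" and u1: "unchanged find_end s s1"
  have r1: "reg s1 ''a'' = a" "reg s1 ''empty'' = 0" "arr s1 = arr s"
    using unchangedD[OF u1] s by (auto simp: fun_eq_iff)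
  have in1: "encodes n \<gamma> g I0 I1 W s1" by (rule encodes_unchanged[OF s(1) u1]) simp_all
  have ga: "g a \<le> W" "g a - a \<le> W" "Suc b - a \<le> W" "a \<le> W" "b + 1 \<le> W" "arr s ''gen'' a = g a" using iterate(3)[OF B, of 0] bb arrs by auto
  let ?R = "\<lambda>(t::nat) s'. t \<le> 20 \<and> at_block W a b M s'"
  show "wp W ((''l'' ::= (V ''c'' [+] N 1) [-] V ''a'' ;; ''e'' ::= Cell ''gen'' (V ''a'') [-] V ''a'') ;;
     flag_gcd ;; shift_gcd ;; search ;; ?If) (\<lambda>t2. ?Q (t1 + t2)) s1"
  proof (rule wp_bind)
    have "at_block W a b M (s1\<lparr>reg := (reg s1)(''l'' := Suc b - a, ''e'' := g a - a)\<rparr>)"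
      unfolding at_block_def using encodes_cong[OF in1] c r1 s by auto
    then show "wp W (''l'' ::= (V ''c'' [+] N 1) [-] V ''a'' ;; ''e'' ::= Cell ''gen'' (V ''a'') [-] V ''a'') ?R s1"
      using c r1 s ga bb by (simp add: wp_simps)
  next
    fix t2 s2 assume s2: "?R t2 s2"
    have regs2: "reg s2 ''l'' = l" "reg s2 ''e'' = e" "flags_for n M (arr s2 ''F'')"
      using s2 l e by (auto simp: at_block_def)
    show "wp W (flag_gcd ;; shift_gcd ;; search ;; ?If) (\<lambda>t3. ?Q (t1 + (t2 + t3))) s2"
    proof (rule wp_bind)
      show "wp W flag_gcd (\<lambda>t s'. reg s' ''G'' = gcd l M \<and> t \<le> 40 * (l * (l + 3) + 3)) s2"
        by (rule flag_gcd_wp) (use regs2 bb in auto)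
    next
      fix t3 s3 assume G: "reg s3 ''G'' = gcd l M \<and> t3 \<le> 40 * (l * (l + 3) + 3)" and u3: "unchanged flag_gcd s2 s3"
      have s3: "at_block W a b M s3" by (rule at_block_unchanged[OF _ u3]) (use s2 in auto)
      have regs3: "reg s3 ''l'' = l" "reg s3 ''e'' = e" using s3 l e by (auto simp: at_block_def)
      show "wp W (shift_gcd ;; search ;; ?If) (\<lambda>t4. ?Q (t1 + (t2 + (t3 + t4)))) s3"
      proof (rule wp_bind)
        show "wp W shift_gcd (\<lambda>t s'. reg s' ''d'' = gcd l (gcd l M * e) \<and> t \<le> 30 * (l + 1)) s3"
          by (rule shift_gcd_wp) (use regs3 bb G in \<open>auto simp: gcd_le1_nat\<close>)
      next
        fix t4 s4 assume d: "reg s4 ''d'' = gcd l (gcd l M * e) \<and> t4 \<le> 30 * (l + 1)" and u4: "unchanged shift_gcd s3 s4"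
        have s4: "at_block W a b M s4" by (rule at_block_unchanged[OF s3 u4]) auto
        have "gcd l (gcd l M * e) = gcd l (M * e)"
          by (rule gcd_gcd_mult)
        then have d4: "reg s4 ''d'' = gcd l (M * e)" using d by simp
        interpret cyclic_word l "gcd l (M * e)" "{i. a + i \<in> I0}" "{i. a + i \<in> I1}"
          by unfold_locales (use bb(1) in auto)
        have "search_state W s4"
          unfolding search_state_def using s4 d4 bb l unfolding at_block_def encodes_def by auto
        then have sw: "wp W search (\<lambda>t s'. search_result (reg s' ''r'') \<and> reg s' ''r'' \<le> l \<and> t \<le> 110 * (l * (l + 3) + 2)) s4"
          by (rule search_wp)
        show "wp W (search ;; ?If) (\<lambda>t5. ?Q (t1 + (t2 + (t3 + (t4 + t5))))) s4"
        proof (rule wp_bind[OF sw])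
          fix t5 s5 assume r5: "search_result (reg s5 ''r'') \<and> reg s5 ''r'' \<le> l \<and> t5 \<le> 110 * (l * (l + 3) + 2)"
            and u5: "unchanged search s4 s5"
          have s5: "at_block W a b M s5" by (rule at_block_unchanged[OF s4 u5]) auto
          have "t1 + (t2 + (t3 + (t4 + (t5 + t6)))) \<le> 1200 * (l * l)" if "t6 \<le> 50 * l + 70" for t6
          proof -
            have "40 * (l * (l + 3) + 3) = 40 * (l * l) + 120 * l + 120"
              "110 * (l * (l + 3) + 2) = 110 * (l * l) + 330 * l + 220" by (simp_all add: algebra_simps)
            \<comment> \<open>The quadratic coefficient 150 collects \<open>flag_gcd\<close> (40)
              and \<open>search\<close> (110); \<open>l \<ge> 1\<close> then absorbs the lower
              terms.\<close>
            then have "t1 + (t2 + (t3 + (t4 + (t5 + t6)))) \<le> 150 * (l * l) + 540 * l + 510"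
              using c s2 G d r5 that l by simp
            also have "\<dots> \<le> (150 + 540 + 510) * (l * l)" by (rule quadratic_bound[OF bb(1)])
            finally show ?thesis by simp
          qed
          then show "wp W ?If (\<lambda>t6. ?Q (t1 + (t2 + (t3 + (t4 + (t5 + t6)))))) s5"
            using r5 by (intro wp_mono[OF block_tail_wp[OF s5]]) auto
        qed
      qed
    qed
  qed
qed

end

lemma emptiness_wp:
  assumes s: "encodes n \<gamma> g I0 I1 W s" and n: "1 \<le> n"
  shows "wp W emptiness (\<lambda>t s'. reg s' ''empty'' = of_bool (\<not> (\<exists>y. feasible (Suc n) y)) \<and> t \<le> 1400 * (n * L)) s"
proof -
  have W: "10 * ((n + 1) * (n + 1)) \<le> W" using s by (simp add: encodes_def)
  have "10 * (n + 1) \<le> 10 * ((n + 1) * (n + 1))" by (intro mult_le_mono2) simp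
  then have "10 * n + 10 \<le> W" using W by simp
  then have W2: "n + 2 \<le> W" by linarith
  obtain b where "block 1 b" using start_first n by (auto simp: start_def)
  then have L: "1 \<le> L" using small[of 1 b] by (auto simp: is_block_def)
  let ?c = "BNot (Less (V ''n'') (V ''a''))"
  let ?I = "\<lambda>s. progress s \<and> 1 \<le> reg s ''a'' \<and> reg s ''a'' \<le> Suc n"
  \<comment> \<open>A block of length \<open>l\<close> costs at most \<open>1200 * (l * L)\<close>
    and advances \<open>a\<close> by at least \<open>l\<close>, so the costs add up to order
    \<open>n * L\<close>. The surplus of 100 pays for the loop guard.\<close>
  let ?\<Phi> = "\<lambda>s. 1300 * ((Suc n - reg s ''a'') * L)"
  have loop: "wp W (While ?c block_body) (\<lambda>t s'. reg s' ''empty'' = of_bool (\<not> (\<exists>y. feasible (Suc n) y)) \<and> t \<le> 1300 * (n * L) + 5) s1"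
    if s1: "encodes n \<gamma> g I0 I1 W s1" "reg s1 ''a'' = 1" "progress s1" for s1
  proof (rule wp_WhileI[where I = ?I and \<Phi> = ?\<Phi>])
    show "?I s1" using s1 n by simp
  next
    fix s' assume I: "?I s'" and u: "unchanged block_body s1 s'"
    have in': "encodes n \<gamma> g I0 I1 W s'" by (rule encodes_unchanged[OF s1(1) u]) simp_all
    have rn: "reg s' ''n'' = n" using in' by (simp add: encodes_def)
    show "bfits W ?c s'" using I rn W2 by simp
    {
      assume "bval ?c s'"
      then have an: "reg s' ''a'' \<le> n" using rn by simp
      then have e0: "reg s' ''empty'' = 0" using I by (auto simp: progress_def split: if_splits)
      then obtain b M where B: "block (reg s' ''a'') b" and M: "minimal_stabiliser (reg s' ''a'') M" "flags_for n M (arr s' ''F'')"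
        using I an by (auto simp: progress_def start_def)
      let ?a = "reg s' ''a''" and ?l = "Suc b - reg s' ''a''"
      have ab: "?a \<le> b" "b \<le> n" using B by (auto simp: is_block_def)
      have lL: "?l \<le> L" using small[OF B] by simp
      show "wp W block_body (\<lambda>t s''. ?I s'' \<and> ?\<Phi> s'' + t + bcost ?c + 1 \<le> ?\<Phi> s') s'"
      proof (rule wp_mono[OF block_body_wp[OF B M(1) refl refl W in' refl e0 M(2)]])
        fix t s'' assume h: "t \<le> 1200 * (?l * ?l) \<and> progress s'' \<and> Suc b \<le> reg s'' ''a'' \<and> reg s'' ''a'' \<le> Suc n"
        have "(Suc n - reg s'' ''a'') * L + ?l * L \<le> (Suc n - ?a) * L"
        proof -
          have "(Suc n - reg s'' ''a'') + ?l \<le> Suc n - ?a" using h ab by arith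
          then show ?thesis by (metis add_mult_distrib mult_le_mono1)
        qed
        moreover have "?l * ?l \<le> ?l * L" using lL by (rule mult_le_mono2)
        moreover have "1 \<le> ?l * L" using L ab by (simp add: Suc_le_eq)
        moreover have "A + B \<le> D \<Longrightarrow> X \<le> B \<Longrightarrow> 1 \<le> B \<Longrightarrow> t \<le> 1200 * X \<Longrightarrow> 1300 * A + t + 5 \<le> 1300 * D"
          for A B D X :: nat by arith
        ultimately have "?\<Phi> s'' + t + 5 \<le> ?\<Phi> s'" using h by blast
        then show "?I s'' \<and> ?\<Phi> s'' + t + bcost ?c + 1 \<le> ?\<Phi> s'" using h ab by simp
      qed
    }
    {
      fix t assume "\<not> bval ?c s'" and t: "t + ?\<Phi> s' \<le> ?\<Phi> s1 + bcost ?c + 1"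
      then have an: "reg s' ''a'' = Suc n" using rn I by simp
      have "reg s' ''empty'' = of_bool (\<not> (\<exists>y. feasible (Suc n) y))"
        using I an by (auto simp: progress_def minimal_stabiliser_def split: if_splits)
      then show "reg s' ''empty'' = of_bool (\<not> (\<exists>y. feasible (Suc n) y)) \<and> t \<le> 1300 * (n * L) + 5"
        using t an s1(2) by simp
    }
  qed
  let ?s0 = "s\<lparr>reg := (reg s)(''empty'' := 0)\<rparr>"
  have "wp W (clear_flags ;; ''a'' ::= N 1 ;; While ?c block_body)
     (\<lambda>t s'. reg s' ''empty'' = of_bool (\<not> (\<exists>y. feasible (Suc n) y)) \<and> 2 + t \<le> 1400 * (n * L)) ?s0"
  proof (rule wp_bind)
    show "wp W clear_flags (\<lambda>t s'. (\<forall>k. 1 \<le> k \<and> k \<le> n \<longrightarrow> arr s' ''F'' k = 0) \<and> t \<le> 20 * (n + 1)) ?s0"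
      by (rule clear_flags_wp) (use s W2 in \<open>auto simp: encodes_def\<close>)
  next
    fix t1 s1 assume F: "(\<forall>k. 1 \<le> k \<and> k \<le> n \<longrightarrow> arr s1 ''F'' k = 0) \<and> t1 \<le> 20 * (n + 1)"
      and u1: "unchanged clear_flags ?s0 s1"
    let ?s1 = "s1\<lparr>reg := (reg s1)(''a'' := 1)\<rparr>"
    have "encodes n \<gamma> g I0 I1 W ?s0" by (rule encodes_cong[OF s]) simp_all
    from encodes_unchanged[OF this u1] have "encodes n \<gamma> g I0 I1 W s1" by simp
    then have in1: "encodes n \<gamma> g I0 I1 W ?s1" by (rule encodes_cong) simp_all
    have "reg s1 ''empty'' = 0" using unchangedD(1)[OF u1, of "''empty''"] by simp
    then have "progress ?s1"
      using F flags_for_init start_first minimal_stabiliser_first by (auto simp: progress_def)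
    then have lp: "wp W (While ?c block_body) (\<lambda>t s'. reg s' ''empty'' = of_bool (\<not> (\<exists>y. feasible (Suc n) y)) \<and> t \<le> 1300 * (n * L) + 5) ?s1"
      using in1 by (intro loop) auto
    have "1 * 1 \<le> n * L" "n * 1 \<le> n * L" using n L by (intro mult_le_mono; simp)+
    then have nL: "1 \<le> n * L" "n \<le> n * L" by simp_all
    have "1 \<le> P \<Longrightarrow> n \<le> P \<Longrightarrow> t2 \<le> 1300 * P + 5 \<Longrightarrow> t1 \<le> 20 * n + 20 \<Longrightarrow> 2 + (t1 + (2 + t2)) \<le> 1400 * P"
      for P t2 :: nat by arith
    from this[OF nL] have time: "2 + (t1 + (2 + t2)) \<le> 1400 * (n * L)" if "t2 \<le> 1300 * (n * L) + 5" for t2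
      using that F by simp
    have "wp W (While ?c block_body) (\<lambda>t2 s'. reg s' ''empty'' = of_bool (\<not> (\<exists>y. feasible (Suc n) y)) \<and> 2 + (t1 + (2 + t2)) \<le> 1400 * (n * L)) ?s1"
      by (rule wp_mono[OF lp]) (use time in blast)
    then show "wp W (''a'' ::= N 1 ;; While ?c block_body)
       (\<lambda>t2 s'. reg s' ''empty'' = of_bool (\<not> (\<exists>y. feasible (Suc n) y)) \<and> 2 + (t1 + t2) \<le> 1400 * (n * L)) s1"
      using W2 by (simp add: wp_Seq wp_Assign)
  qed
  then show ?thesis unfolding emptiness_def wp_Seq[of W "''empty'' ::= N 0"] wp_Assign by simp
qed

end

section \<open>Complete fixings\<close>

text \<open>An entry is constantly 0 iff forcing it to 1 leaves nothing, and vice versa. A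
  prescribed entry is copied instead, since forcing the other value would break the disjointness
  demanded by \<open>encodes\<close>; the copy is correct if the face is nonempty.\<close>

definition fix_entry :: com where
  "fix_entry =
     If (BAnd (Eq (Cell ''I0'' (V ''j'')) (N 0)) (Eq (Cell ''I1'' (V ''j'')) (N 0)))
       (Store ''I1'' (V ''j'') (N 1) ;; emptiness ;;
        (Store ''J0'' (V ''j'') (V ''empty'') ;; Store ''I1'' (V ''j'') (N 0) ;; Store ''I0'' (V ''j'') (N 1)) ;;
        emptiness ;;
        Store ''J1'' (V ''j'') (V ''empty'') ;; Store ''I0'' (V ''j'') (N 0) ;; ''j'' ::= V ''j'' [+] N 1)
       (Store ''J0'' (V ''j'') (Cell ''I0'' (V ''j'')) ;; Store ''J1'' (V ''j'') (Cell ''I1'' (V ''j'')) ;;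
        ''j'' ::= V ''j'' [+] N 1)"

text \<open>The final run, on the restored input, overwrites the verdicts of the probes by the one
  for the given face.\<close>

definition fixings :: com where
  "fixings = (''j'' ::= N 1 ;; While (BNot (Less (V ''n'') (V ''j''))) fix_entry) ;; emptiness"

lemma max_cycle_size_le:
  assumes V: "valid_instance n \<gamma> \<zeta>s \<Gamma> g I0 I1"
  shows "max_cycle_size \<zeta>s \<le> n"
proof -
  have sg: "supp \<gamma> = {1..n}" "1 \<le> n" and dcf: "disjoint_cycle_factors \<zeta>s \<gamma>"
    using V by (auto simp: valid_instance_def)
  have \<gamma>: "\<gamma> = foldr (\<circ>) \<zeta>s id" and nt: "\<And>\<zeta>. \<zeta> \<in> set \<zeta>s \<Longrightarrow> \<zeta> permutes supp \<zeta>"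
    using dcf nontrivial_cycle_supp(1) by (auto simp: disjoint_cycle_factors_def)
  have "card (supp \<zeta>) \<le> n" if \<zeta>: "\<zeta> \<in> set \<zeta>s" for \<zeta>
  proof -
    obtain c where c: "c < length \<zeta>s" "\<zeta> = \<zeta>s ! c" using \<zeta> by (metis in_set_conv_nth)
    have "\<gamma> k = \<zeta> k" if "k \<in> supp \<zeta>" for k
      using foldr_disjoint[of \<zeta>s c k] nt dcf c that unfolding \<gamma> disjoint_cycle_factors_def by blast
    then have "supp \<zeta> \<subseteq> supp \<gamma>" by (auto simp: supp_def)
    then show ?thesis using sg card_mono[of "{1..n}" "supp \<zeta>"] by simp
  qed
  moreover have "\<zeta>s \<noteq> []"
  proof
    assume "\<zeta>s = []"
    then have "supp \<gamma> = {}" unfolding \<gamma> supp_def by simp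
    then show False using sg by simp
  qed
  ultimately show ?thesis unfolding max_cycle_size_def by (intro Max.boundedI) auto
qed

lemma fixed_iff_empty:
  assumes "i \<in> {1..n}" "X = A \<inter> fixing_face n I0 I1"
  shows "i \<in> complete_fixings n X 0 \<longleftrightarrow> A \<inter> fixing_face n I0 (insert i I1) = {}"
    and "i \<in> complete_fixings n X 1 \<longleftrightarrow> A \<inter> fixing_face n (insert i I0) I1 = {}"
proof -
  have "x i = 0 \<or> x i = 1" if "x \<in> binary_vectors n" for x
    using that assms(1) unfolding binary_vectors_def by (auto simp: PiE_def Pi_def)
  then have "\<forall>x\<in>X. x i = 0 \<or> x i = 1" using assms(2) by (simp add: fixing_face_def)
  moreover have "A \<inter> fixing_face n I0 (insert i I1) = {x \<in> X. x i = 1}"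
    "A \<inter> fixing_face n (insert i I0) I1 = {x \<in> X. x i = 0}"
    using assms(2) by (auto simp: fixing_face_def)
  ultimately show "i \<in> complete_fixings n X 0 \<longleftrightarrow> A \<inter> fixing_face n I0 (insert i I1) = {}"
    and "i \<in> complete_fixings n X 1 \<longleftrightarrow> A \<inter> fixing_face n (insert i I0) I1 = {}"
    using assms(1) unfolding complete_fixings_def by force+
qed

section \<open>Correctness and cost of the fixing loop\<close>

context
  fixes n \<gamma> \<zeta>s \<Gamma> g I0 I1 L
  assumes V: "valid_instance n \<gamma> \<zeta>s \<Gamma> g I0 I1" and L: "L = max_cycle_size \<zeta>s"
begin

lemma n_pos: "1 \<le> n" and I01: "I0 \<subseteq> {1..n}" "I1 \<subseteq> {1..n}" "I0 \<inter> I1 = {}"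
  using V by (auto simp: valid_instance_def)

lemma L_pos: "1 \<le> L"
proof -
  interpret block_rotation n L \<gamma> g unfolding L by (rule valid_instance_block_rotation[OF V])
  obtain a b where "is_block n \<gamma> a b" using cover[of 1] n_pos by blast
  then show ?thesis using small[of a b] by (auto simp: is_block_def)
qed

lemma emptiness_correct:
  assumes J: "J0 \<subseteq> {1..n}" "J1 \<subseteq> {1..n}" and s: "encodes n \<gamma> g J0 J1 W s"
  shows "wp W emptiness (\<lambda>t s'. reg s' ''empty'' = of_bool (X_group n \<Gamma> \<inter> fixing_face n J0 J1 = {}) \<and>
     t \<le> 1400 * (n * L)) s"
proof -
  interpret block_rotation n L \<gamma> g J0 J1 unfolding L by (rule valid_instance_block_rotation[OF V])
  have "(\<exists>y. feasible (Suc n) y) \<longleftrightarrow> X_group n \<Gamma> \<inter> fixing_face n J0 J1 \<noteq> {}"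
    using X_group_nonempty_iff[OF V J] by blast
  then show ?thesis using emptiness_wp[OF s n_pos] by simp
qed

lemma fix_entry_wp:
  assumes s: "encodes n \<gamma> g I0 I1 W s" and j: "reg s ''j'' = j" "1 \<le> j" "j \<le> n"
    and X: "X = X_group n \<Gamma> \<inter> fixing_face n I0 I1"
  shows "wp W fix_entry (\<lambda>t s'. encodes n \<gamma> g I0 I1 W s' \<and> reg s' ''j'' = Suc j \<and>
     (X \<noteq> {} \<longrightarrow> arr s' ''J0'' = (arr s ''J0'')(j := of_bool (j \<in> complete_fixings n X 0)) \<and>
        arr s' ''J1'' = (arr s ''J1'')(j := of_bool (j \<in> complete_fixings n X 1))) \<and>
     t \<le> 2800 * (n * L) + 60) s"
proof -
  have W: "10 * ((n + 1) * (n + 1)) \<le> W" and I: "arr s ''I0'' j = of_bool (j \<in> I0)" "arr s ''I1'' j = of_bool (j \<in> I1)"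
    using s j by (auto simp: encodes_def)
  have "10 * (n + 1) \<le> 10 * ((n + 1) * (n + 1))" by (intro mult_le_mono2) simp
  then have "10 * n + 10 \<le> W" using W by simp
  then have Wj: "j \<le> W" "Suc j \<le> W" "1 \<le> W" using j by linarith+
  show ?thesis
  proof (cases "j \<in> I0 \<union> I1")
    case True
    have fixed: "(j \<in> complete_fixings n X 0 \<longleftrightarrow> j \<in> I0) \<and> (j \<in> complete_fixings n X 1 \<longleftrightarrow> j \<in> I1)"
      if ne: "X \<noteq> {}"
    proof -
      obtain x where x: "x \<in> X" using ne by blast
      have all: "j \<in> I0 \<Longrightarrow> \<forall>x\<in>X. x j = 0" "j \<in> I1 \<Longrightarrow> \<forall>x\<in>X. x j = 1" using X by (auto simp: fixing_face_def)
      show ?thesis using True all x j unfolding complete_fixings_def by fastforce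
    qed
    let ?s = "s\<lparr>arr := (arr s)(''J0'' := (arr s ''J0'')(j := of_bool (j \<in> I0)),
       ''J1'' := (arr s ''J1'')(j := of_bool (j \<in> I1))), reg := (reg s)(''j'' := Suc j)\<rparr>"
    have "encodes n \<gamma> g I0 I1 W ?s" by (rule encodes_cong[OF s]) auto
    then have "wp W fix_entry (\<lambda>t s'. encodes n \<gamma> g I0 I1 W s' \<and> reg s' ''j'' = Suc j \<and>
       arr s' ''J0'' = (arr s ''J0'')(j := of_bool (j \<in> I0)) \<and>
       arr s' ''J1'' = (arr s ''J1'')(j := of_bool (j \<in> I1)) \<and> t \<le> 60) s"
      unfolding fix_entry_def using True I j Wj by (auto simp: wp_simps)
    then show ?thesis by (rule wp_mono) (use fixed in auto)
  next
    case False
    note emp = fixed_iff_empty[OF _ X, of j]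
    let ?e0 = "of_bool (j \<in> complete_fixings n X 0) :: nat" and ?e1 = "of_bool (j \<in> complete_fixings n X 1) :: nat"
    let ?T = "1400 * (n * L)"
    let ?s1 = "s\<lparr>arr := (arr s)(''I1'' := (arr s ''I1'')(j := 1))\<rparr>"
    have s1: "encodes n \<gamma> g I0 (insert j I1) W ?s1" using s False unfolding encodes_def by auto
    have e1: "wp W emptiness (\<lambda>t s'. reg s' ''empty'' = ?e0 \<and> t \<le> ?T) ?s1"
      using emptiness_correct[OF _ _ s1] I01 j emp(1) by simp
    let ?tail = "emptiness ;; Store ''J1'' (V ''j'') (V ''empty'') ;; Store ''I0'' (V ''j'') (N 0) ;; ''j'' ::= V ''j'' [+] N 1"
    let ?mid = "Store ''J0'' (V ''j'') (V ''empty'') ;; Store ''I1'' (V ''j'') (N 0) ;; Store ''I0'' (V ''j'') (N 1)"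
    let ?Q = "\<lambda>t s'. encodes n \<gamma> g I0 I1 W s' \<and> reg s' ''j'' = Suc j \<and>
      arr s' ''J0'' = (arr s ''J0'')(j := ?e0) \<and> arr s' ''J1'' = (arr s ''J1'')(j := ?e1) \<and>
      t \<le> 2800 * (n * L) + 40"
    have "wp W (emptiness ;; ?mid ;; ?tail) ?Q ?s1"
    proof (rule wp_bind[OF e1])
      fix t2 s2 assume r2: "reg s2 ''empty'' = ?e0 \<and> t2 \<le> ?T" and u2: "unchanged emptiness ?s1 s2"
      have in2: "encodes n \<gamma> g I0 (insert j I1) W s2" by (rule encodes_unchanged[OF s1 u2]) simp_all
      have k2: "reg s2 ''j'' = j" "arr s2 ''J0'' = arr s ''J0''" "arr s2 ''J1'' = arr s ''J1''"
        using unchangedD(1)[OF u2, of "''j''"] unchangedD(2)[OF u2, of "''J0''"] unchangedD(2)[OF u2, of "''J1''"] j by simp_all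
      let ?s3 = "s2\<lparr>arr := (arr s2)(''J0'' := (arr s ''J0'')(j := ?e0), ''I1'' := (arr s2 ''I1'')(j := 0), ''I0'' := (arr s2 ''I0'')(j := 1))\<rparr>"
      have s3: "encodes n \<gamma> g (insert j I0) I1 W ?s3" using in2 False unfolding encodes_def by auto
      show "wp W (?mid ;; ?tail) (\<lambda>t. ?Q (t2 + t)) s2"
      proof (rule wp_bind)
        show "wp W ?mid (\<lambda>t s'. t = 9 \<and> s' = ?s3) s2" using r2 k2 Wj by (simp add: wp_simps)
      next
        fix t3 :: nat and s' assume t3: "t3 = 9 \<and> s' = ?s3"
        have e3: "wp W emptiness (\<lambda>t s'. reg s' ''empty'' = ?e1 \<and> t \<le> ?T) ?s3"
          using emptiness_correct[OF _ _ s3] I01 j emp(2) by simp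
        show "wp W ?tail (\<lambda>t. ?Q (t2 + (t3 + t))) s'"
          unfolding t3[THEN conjunct2]
        proof (rule wp_bind[OF e3])
          fix t4 s4 assume r4: "reg s4 ''empty'' = ?e1 \<and> t4 \<le> ?T" and u4: "unchanged emptiness ?s3 s4"
          have in4: "encodes n \<gamma> g (insert j I0) I1 W s4" by (rule encodes_unchanged[OF s3 u4]) simp_all
          have k4: "reg s4 ''j'' = j" "arr s4 ''J0'' = (arr s ''J0'')(j := ?e0)" "arr s4 ''J1'' = arr s ''J1''"
            using unchangedD(1)[OF u4, of "''j''"] unchangedD(2)[OF u4, of "''J0''"] unchangedD(2)[OF u4, of "''J1''"] k2 by simp_all
          let ?s5 = "s4\<lparr>arr := (arr s4)(''J1'' := (arr s4 ''J1'')(j := ?e1), ''I0'' := (arr s4 ''I0'')(j := 0)), reg := (reg s4)(''j'' := Suc j)\<rparr>"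
          have s5: "encodes n \<gamma> g I0 I1 W ?s5" using in4 False unfolding encodes_def by auto
          show "wp W (Store ''J1'' (V ''j'') (V ''empty'') ;; Store ''I0'' (V ''j'') (N 0) ;; ''j'' ::= V ''j'' [+] N 1)
             (\<lambda>t. ?Q (t2 + (t3 + (t4 + t)))) s4"
            using r4 k4 Wj s5 r2 t3 by (simp add: wp_simps)
        qed
      qed
    qed
    from wp_mono[OF this] show ?thesis
      unfolding fix_entry_def using False I j Wj by (simp add: wp_If wp_Seq[of W "Store x e f" for x e f] wp_Store)
  qed
qed

lemma fixings_wp:
  assumes s: "encodes n \<gamma> g I0 I1 W s" and X: "X = X_group n \<Gamma> \<inter> fixing_face n I0 I1"
  shows "wp W fixings (\<lambda>t s'. output_emptiness X s' \<and> (X \<noteq> {} \<longrightarrow> output_fixings n X s') \<and>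
     t \<le> 5000 * (n * (n * L))) s"
proof -
  have W: "10 * ((n + 1) * (n + 1)) \<le> W" using s by (simp add: encodes_def)
  have "10 * (n + 1) \<le> 10 * ((n + 1) * (n + 1))" by (intro mult_le_mono2) simp
  then have "10 * n + 10 \<le> W" using W by simp
  then have W2: "n + 1 \<le> W" by linarith
  let ?c = "BNot (Less (V ''n'') (V ''j''))"
  \<comment> \<open>Two emptiness tests at \<open>1400 * (n * L)\<close> each, plus the bookkeeping
    for one index.\<close>
  let ?A = "2800 * (n * L) + 70"
  let ?done = "\<lambda>m s. X \<noteq> {} \<longrightarrow> (\<forall>i. 1 \<le> i \<and> i < m \<longrightarrow>
      arr s ''J0'' i = of_bool (i \<in> complete_fixings n X 0) \<and>
      arr s ''J1'' i = of_bool (i \<in> complete_fixings n X 1))"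
  let ?I = "\<lambda>s. encodes n \<gamma> g I0 I1 W s \<and> 1 \<le> reg s ''j'' \<and> reg s ''j'' \<le> Suc n \<and> ?done (reg s ''j'') s"
  let ?s = "s\<lparr>reg := (reg s)(''j'' := 1)\<rparr>"
  have "wp W (While ?c fix_entry) (\<lambda>t s'. encodes n \<gamma> g I0 I1 W s' \<and> ?done (Suc n) s' \<and> 2 + t \<le> ?A * n + 10) ?s"
  proof (rule wp_WhileI[where I = ?I and \<Phi> = "\<lambda>s. ?A * (Suc n - reg s ''j'')"])
    show "?I ?s" using encodes_cong[OF s, of ?s] n_pos by auto
  next
    fix s' assume I: "?I s'"
    then have rn: "reg s' ''n'' = n" by (simp add: encodes_def)
    show "bfits W ?c s'" using I rn W2 by simp
    {
      assume "bval ?c s'"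
      then have jn: "reg s' ''j'' \<le> n" using rn by simp
      then have pot: "?A * (Suc n - Suc (reg s' ''j'')) + ?A = ?A * (Suc n - reg s' ''j'')"
        by (simp add: Suc_diff_le)
      show "wp W fix_entry (\<lambda>t s''. ?I s'' \<and> ?A * (Suc n - reg s'' ''j'') + t + bcost ?c + 1 \<le> ?A * (Suc n - reg s' ''j'')) s'"
        by (rule wp_mono[OF fix_entry_wp[OF _ refl _ jn X]]) (use I jn pot in \<open>auto simp: less_Suc_eq\<close>)
    }
    {
      fix t assume "\<not> bval ?c s'" and t: "t + ?A * (Suc n - reg s' ''j'') \<le> ?A * (Suc n - reg ?s ''j'') + bcost ?c + 1"
      then have "reg s' ''j'' = Suc n" using I rn by simp
      then show "encodes n \<gamma> g I0 I1 W s' \<and> ?done (Suc n) s' \<and> 2 + t \<le> ?A * n + 10" using I t by simp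
    }
  qed
  then have loop: "wp W (''j'' ::= N 1 ;; While ?c fix_entry)
     (\<lambda>t s'. encodes n \<gamma> g I0 I1 W s' \<and> ?done (Suc n) s' \<and> t \<le> ?A * n + 10) s"
    using W2 by (simp add: wp_Seq wp_Assign)
  show ?thesis
    unfolding fixings_def
  proof (rule wp_bind[OF loop])
    fix t1 s1 assume s1: "encodes n \<gamma> g I0 I1 W s1 \<and> ?done (Suc n) s1 \<and> t1 \<le> ?A * n + 10"
    then have e: "wp W emptiness (\<lambda>t s'. reg s' ''empty'' = of_bool (X = {}) \<and> t \<le> 1400 * (n * L)) s1"
      unfolding X by (intro emptiness_correct) (use I01 in auto)
    have L1: "1 \<le> L" using L_pos .
    have nnL: "n \<le> n * (n * L)" "n * L \<le> n * (n * L)" "1 \<le> n * (n * L)" using n_pos L1 by simp_all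
    have eqA: "?A * n = 2800 * (n * (n * L)) + 70 * n" by (simp add: algebra_simps)
    have "n \<le> P \<Longrightarrow> R \<le> P \<Longrightarrow> 1 \<le> P \<Longrightarrow> t1 \<le> 2800 * P + 70 * n + 10 \<Longrightarrow> t2 \<le> 1400 * R \<Longrightarrow> t1 + t2 \<le> 5000 * P"
      for P R t2 :: nat by arith
    from this[OF nnL] have time: "t1 + t2 \<le> 5000 * (n * (n * L))" if "t2 \<le> 1400 * (n * L)" for t2
      using s1 that unfolding eqA by blast
    show "wp W emptiness (\<lambda>t2 s'. output_emptiness X s' \<and> (X \<noteq> {} \<longrightarrow> output_fixings n X s') \<and>
       t1 + t2 \<le> 5000 * (n * (n * L))) s1"
    proof (rule wp_mono[OF e])
      fix t2 s2 assume e2: "reg s2 ''empty'' = of_bool (X = {}) \<and> t2 \<le> 1400 * (n * L)" and u: "unchanged emptiness s1 s2"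
      have "arr s2 ''J0'' = arr s1 ''J0''" "arr s2 ''J1'' = arr s1 ''J1''"
        using unchangedD(2)[OF u, of "''J0''"] unchangedD(2)[OF u, of "''J1''"] by simp_all
      then have "X \<noteq> {} \<longrightarrow> output_fixings n X s2" using s1 by (auto simp: output_fixings_def)
      then show "output_emptiness X s2 \<and> (X \<noteq> {} \<longrightarrow> output_fixings n X s2) \<and> t1 + t2 \<le> 5000 * (n * (n * L))"
        using e2 time by (auto simp: output_emptiness_def)
    qed
  qed
qed

end

lemma input_state_encodes:
  assumes V: "valid_instance n \<gamma> \<zeta>s \<Gamma> g I0 I1" and W: "40 * n ^ 2 \<le> W"
  shows "encodes n \<gamma> g I0 I1 W (input_state n \<gamma> g I0 I1)"
proof -
  have n: "1 \<le> n" "I0 \<inter> I1 = {}" using V by (auto simp: valid_instance_def)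
  \<comment> \<open>From \<open>n \<ge> 1\<close>; this is the origin of the factor 40.\<close>
  have "(n + 1) * (n + 1) \<le> (2 * n) * (2 * n)" using n by (intro mult_le_mono) auto
  then have "10 * ((n + 1) * (n + 1)) \<le> 40 * n ^ 2" by (simp add: power2_eq_square)
  then have "10 * ((n + 1) * (n + 1)) \<le> W" using W by (rule le_trans)
  then show ?thesis using n by (simp add: encodes_def input_state_def)
qed

theorem mainTheorem6:
  shows "(\<exists>(P :: com) (C :: nat) (d :: nat).
      \<forall>n \<gamma> \<zeta>s \<Gamma> g I0 I1. valid_instance n \<gamma> \<zeta>s \<Gamma> g I0 I1 \<longrightarrow>
        (\<exists>t s. exec (C * n ^ d) P (input_state n \<gamma> g I0 I1) t s \<and>
           t \<le> C * (n ^ 2 * max_cycle_size \<zeta>s) \<and> t \<le> C * n ^ 3 \<and>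
           output_emptiness (X_group n \<Gamma> \<inter> fixing_face n I0 I1) s \<and>
           (X_group n \<Gamma> \<inter> fixing_face n I0 I1 \<noteq> {} \<longrightarrow>
              output_fixings n (X_group n \<Gamma> \<inter> fixing_face n I0 I1) s)))
    \<and>
    (\<exists>(P :: com) (C :: nat) (d :: nat).
      \<forall>n \<gamma> \<zeta>s \<Gamma> g I0 I1. valid_instance n \<gamma> \<zeta>s \<Gamma> g I0 I1 \<longrightarrow>
        (\<exists>t s. exec (C * n ^ d) P (input_state n \<gamma> g I0 I1) t s \<and>
           t \<le> C * (n * max_cycle_size \<zeta>s) \<and> t \<le> C * n ^ 2 \<and>
           output_emptiness (X_group n \<Gamma> \<inter> fixing_face n I0 I1) s))"
\<comment> \<open>The witness 5000 serves as time factor and in the word bound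
  \<open>5000 * n ^ 2\<close>, where 40 would already suffice.\<close>
proof (rule conjI, rule_tac [1] exI[of _ fixings], rule_tac [2] exI[of _ emptiness];
    rule exI[of _ 5000], rule exI[of _ 2], intro allI impI)
  fix n \<gamma> \<zeta>s \<Gamma> g I0 I1 assume V: "valid_instance n \<gamma> \<zeta>s \<Gamma> g I0 I1"
  let ?L = "max_cycle_size \<zeta>s" and ?X = "X_group n \<Gamma> \<inter> fixing_face n I0 I1"
  have enc: "encodes n \<gamma> g I0 I1 (5000 * n ^ 2) (input_state n \<gamma> g I0 I1)"
    by (rule input_state_encodes[OF V]) simp
  have Ln: "?L \<le> n" by (rule max_cycle_size_le[OF V])
  obtain t s where ts: "exec (5000 * n ^ 2) fixings (input_state n \<gamma> g I0 I1) t s"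
      "output_emptiness ?X s" "?X \<noteq> {} \<longrightarrow> output_fixings n ?X s" "t \<le> 5000 * (n * (n * ?L))"
    using fixings_wp[OF V refl enc refl] unfolding wp_def by blast
  have "5000 * (n * (n * ?L)) \<le> 5000 * (n * (n * n))" using Ln by (intro mult_le_mono2)
  from le_trans[OF ts(4) this] have "t \<le> 5000 * n ^ 3" by (simp add: power3_eq_cube mult.assoc)
  moreover have "t \<le> 5000 * (n ^ 2 * ?L)" using ts(4) by (simp add: power2_eq_square mult.assoc)
  ultimately show "\<exists>t s. exec (5000 * n ^ 2) fixings (input_state n \<gamma> g I0 I1) t s \<and>
      t \<le> 5000 * (n ^ 2 * ?L) \<and> t \<le> 5000 * n ^ 3 \<and> output_emptiness ?X s \<and>
      (?X \<noteq> {} \<longrightarrow> output_fixings n ?X s)"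
    using ts by blast
next
  fix n \<gamma> \<zeta>s \<Gamma> g I0 I1 assume V: "valid_instance n \<gamma> \<zeta>s \<Gamma> g I0 I1"
  let ?L = "max_cycle_size \<zeta>s" and ?X = "X_group n \<Gamma> \<inter> fixing_face n I0 I1"
  have enc: "encodes n \<gamma> g I0 I1 (5000 * n ^ 2) (input_state n \<gamma> g I0 I1)"
    by (rule input_state_encodes[OF V]) simp
  have Ln: "?L \<le> n" by (rule max_cycle_size_le[OF V])
  have I: "I0 \<subseteq> {1..n}" "I1 \<subseteq> {1..n}" using V by (auto simp: valid_instance_def)
  obtain t s where ts: "exec (5000 * n ^ 2) emptiness (input_state n \<gamma> g I0 I1) t s"
      "reg s ''empty'' = of_bool (?X = {})" "t \<le> 1400 * (n * ?L)"
    using emptiness_correct[OF V refl I enc] unfolding wp_def by blast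
  have "1400 * (n * ?L) \<le> 1400 * (n * n)" using Ln by (intro mult_le_mono2)
  from le_trans[OF ts(3) this] have "t \<le> 5000 * n ^ 2" by (simp add: power2_eq_square)
  moreover have "t \<le> 5000 * (n * ?L)" using ts(3) by simp
  ultimately show "\<exists>t s. exec (5000 * n ^ 2) emptiness (input_state n \<gamma> g I0 I1) t s \<and>
      t \<le> 5000 * (n * ?L) \<and> t \<le> 5000 * n ^ 2 \<and> output_emptiness ?X s"
    using ts unfolding output_emptiness_def by blast
qed

end
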